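(* Let $d\ge 1$ and $q>2$. If $f\in L_{q}(\mathbb{R}^d)$ and $g\in L_{q,w}(\mathbb{R}^d)$, then $f(X)\,g(-i\nabla)\in\mathfrak{S}_{q,w}( L_2(\mathbb{R}^d) )$ with $$ \| f(X)\, g(-i\nabla) \|_{q,w}^q \le \left( \frac{q}{q-2} \right)^{q/2} \left( \frac{q+2}{q-2} \right)^{(q-2)/2} (2\pi)^{-d} \ \| f \|_{q}^{q} \ \| g\|_{q,w}^q . $$
   Context: $f(X)$ denotes multiplication by the function $f$ in position space; $g(-i\nabla)$ denotes multiplication by $g$ in momentum space, i.e. $g(-i\nabla)=\mathcal F^{-1} g \mathcal F$ with the unitary Fourier transform $(\mathcal F u)(p)=(2\pi)^{-d/2}\int_{\mathbb{R}^d} e^{-ip\cdot x}u(x)\,dx$. $L_{q,w}(\mathbb{R}^d)$ is the space of functions $g$ on $\mathbb{R}^d$ for which the quasi-norm given by $\|g\|_{q,w}^q=\sup_{\tau>0}\tau^q\,|\{|g|>\tau\}|$ is finite ($|\cdot|$ is Lebesgue measure). For a separable Hilbert space $\mathcal H$, $\mathfrak{S}_{q,w}(\mathcal H)$ is the space of compact operators $K$ on $\mathcal H$ satisfying $$\|K\|_{q,w}^q=\sup_{\kappa>0}\kappa^q\, n(\kappa,(K^*K)^{1/2})<\infty,$$ where $n(\kappa,(K^*K)^{1/2})$ denotes the number of eigenvalues of $(K^*K)^{1/2}$ larger than $\kappa$, counting multiplicities. *)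

theory Defs
  imports "HOL-Analysis.Analysis"
begin

text \<open>The inner product is linear in its second argument. The real inner product of the
  superclass is its real part, so that norm and topology are the library's ones.\<close>

class complex_hilbert_space = real_inner + complete_space +
  fixes scaleC :: "complex \<Rightarrow> 'a \<Rightarrow> 'a"  (infixr \<open>*\<^sub>C\<close> 75)
    and cinner :: "'a \<Rightarrow> 'a \<Rightarrow> complex"
  assumes scaleC_add_right: "a *\<^sub>C (x + y) = a *\<^sub>C x + a *\<^sub>C y"
    and scaleC_add_left: "(a + b) *\<^sub>C x = a *\<^sub>C x + b *\<^sub>C x"
    and scaleC_scaleC: "a *\<^sub>C b *\<^sub>C x = (a * b) *\<^sub>C x"
    and scaleC_of_real: "complex_of_real r *\<^sub>C x = r *\<^sub>R x"
    and cinner_commute: "cinner x y = cnj (cinner y x)"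
    and cinner_add_right: "cinner x (y + z) = cinner x y + cinner x z"
    and cinner_scaleC_right: "cinner x (a *\<^sub>C y) = a * cinner x y"
    and inner_eq_Re_cinner: "inner x y = Re (cinner x y)"

interpretation complex_vector:
  vector_space "scaleC :: complex \<Rightarrow> 'a \<Rightarrow> 'a::complex_hilbert_space"
proof unfold_locales
  show "1 *\<^sub>C x = x" for x :: 'a
    using scaleC_of_real[of 1 x] by simp
qed (rule scaleC_add_right scaleC_add_left scaleC_scaleC)+

definition compact_operator :: "('a::complex_hilbert_space \<Rightarrow> 'a) \<Rightarrow> bool" where
  "compact_operator K \<longleftrightarrow> Vector_Spaces.linear scaleC scaleC K \<and> compact (closure (K ` cball 0 1))"

definition cadjoint :: "('a::complex_hilbert_space \<Rightarrow> 'a) \<Rightarrow> 'a \<Rightarrow> 'a" where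
  "cadjoint K = (THE L. \<forall>x y. cinner (K x) y = cinner x (L y))"

definition positive_operator :: "('a::complex_hilbert_space \<Rightarrow> 'a) \<Rightarrow> bool" where
  "positive_operator S \<longleftrightarrow> Vector_Spaces.linear scaleC scaleC S \<and> bounded_linear S
     \<and> (\<forall>x. cinner x (S x) \<in> \<real>\<^sub>\<ge>\<^sub>0)"

definition sqrt_operator :: "('a::complex_hilbert_space \<Rightarrow> 'a) \<Rightarrow> 'a \<Rightarrow> 'a" where
  "sqrt_operator P = (THE S. positive_operator S \<and> S \<circ> S = P)"

definition abs_operator :: "('a::complex_hilbert_space \<Rightarrow> 'a) \<Rightarrow> 'a \<Rightarrow> 'a" where
  "abs_operator K = sqrt_operator (cadjoint K \<circ> K)"

definition eigenspace :: "('a::complex_hilbert_space \<Rightarrow> 'a) \<Rightarrow> real \<Rightarrow> 'a set" where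
  "eigenspace S l = {x. S x = complex_of_real l *\<^sub>C x}"

text \<open>Complex dimension of a subspace, with value \<open>\<infinity>\<close> (rather than the library's \<open>0\<close>) for
  infinite-dimensional ones.\<close>

definition ecdim :: "'a::complex_hilbert_space set \<Rightarrow> ennreal" where
  "ecdim V = (SUP B \<in> {B. B \<subseteq> V \<and> finite B \<and> \<not> module.dependent scaleC B}. of_nat (card B))"

text \<open>Number of eigenvalues larger than \<open>\<kappa>\<close> of a self-adjoint operator, counted with
  multiplicity. Numbers that are not eigenvalues have a trivial eigenspace and contribute \<open>0\<close>.\<close>

definition n_eigenvalues :: "real \<Rightarrow> ('a::complex_hilbert_space \<Rightarrow> 'a) \<Rightarrow> ennreal" where
  "n_eigenvalues \<kappa> S = (\<Sum>\<^sub>\<infinity>l\<in>{\<kappa><..}. ecdim (eigenspace S l))"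

definition weak_schatten_sup :: "real \<Rightarrow> ('a::complex_hilbert_space \<Rightarrow> 'a) \<Rightarrow> ennreal" where
  "weak_schatten_sup q K =
     (SUP \<kappa>\<in>{0<..}. ennreal (\<kappa> powr q) * n_eigenvalues \<kappa> (abs_operator K))"

definition weak_schatten :: "real \<Rightarrow> ('a::complex_hilbert_space \<Rightarrow> 'a) set" where
  "weak_schatten q = {K. compact_operator K \<and> weak_schatten_sup q K < \<infinity>}"

definition weak_schatten_norm :: "real \<Rightarrow> ('a::complex_hilbert_space \<Rightarrow> 'a) \<Rightarrow> real" where
  "weak_schatten_norm q K = enn2real (weak_schatten_sup q K) powr (1 / q)"

definition Lp :: "real \<Rightarrow> ('a::euclidean_space \<Rightarrow> complex) set" where
  "Lp q = {f \<in> borel_measurable lebesgue. integrable lebesgue (\<lambda>x. norm (f x) powr q)}"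

definition Lp_norm :: "real \<Rightarrow> ('a::euclidean_space \<Rightarrow> complex) \<Rightarrow> real" where
  "Lp_norm q f = (LINT x|lebesgue. norm (f x) powr q) powr (1 / q)"

definition weak_Lp_sup :: "real \<Rightarrow> ('a::euclidean_space \<Rightarrow> complex) \<Rightarrow> ennreal" where
  "weak_Lp_sup q g =
     (SUP \<tau>\<in>{0<..}. ennreal (\<tau> powr q) * emeasure lebesgue {x. norm (g x) > \<tau>})"

definition weak_Lp :: "real \<Rightarrow> ('a::euclidean_space \<Rightarrow> complex) set" where
  "weak_Lp q = {g \<in> borel_measurable lebesgue. weak_Lp_sup q g < \<infinity>}"

definition weak_Lp_norm :: "real \<Rightarrow> ('a::euclidean_space \<Rightarrow> complex) \<Rightarrow> real" where
  "weak_Lp_norm q g = enn2real (weak_Lp_sup q g) powr (1 / q)"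

definition square_integrable :: "('a::euclidean_space \<Rightarrow> complex) \<Rightarrow> bool" where
  "square_integrable u \<longleftrightarrow>
     u \<in> borel_measurable lebesgue \<and> integrable lebesgue (\<lambda>x. (norm (u x))\<^sup>2)"

lemma square_integrable_measurable [measurable_dest]:
  "square_integrable u \<Longrightarrow> u \<in> borel_measurable lebesgue"
  by (simp add: square_integrable_def)

lemma borel_measurable_cnj_mult:
  assumes "square_integrable u" "square_integrable v"
  shows "(\<lambda>x. cnj (u x) * v x) \<in> borel_measurable lebesgue"
proof (rule borel_measurable_times)
  have "cnj \<in> borel_measurable borel"
    by (intro borel_measurable_continuous_onI continuous_intros)
  from measurable_compose[OF square_integrable_measurable[OF assms(1)] this]
  show "(\<lambda>x. cnj (u x)) \<in> borel_measurable lebesgue" .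
qed (rule square_integrable_measurable[OF assms(2)])

lemma square_integrable_0: "square_integrable (\<lambda>x. 0)"
  by (simp add: square_integrable_def)

lemma square_integrable_scale:
  assumes "square_integrable u" shows "square_integrable (\<lambda>x. a * u x)"
  using assms by (auto simp: square_integrable_def norm_mult power_mult_distrib)

lemma square_integrable_add:
  assumes u: "square_integrable u" and v: "square_integrable v"
  shows "square_integrable (\<lambda>x. u x + v x)"
proof -
  have "integrable lebesgue (\<lambda>x. (norm (u x + v x))\<^sup>2)"
  proof (rule Bochner_Integration.integrable_bound)
    show "integrable lebesgue (\<lambda>x. 2 * (norm (u x))\<^sup>2 + 2 * (norm (v x))\<^sup>2)"
      using u v by (auto simp: square_integrable_def)
    show "AE x in lebesgue. norm ((norm (u x + v x))\<^sup>2)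
            \<le> norm (2 * (norm (u x))\<^sup>2 + 2 * (norm (v x))\<^sup>2)"
    proof (rule AE_I2)
      fix x
      have "(norm (u x + v x))\<^sup>2 \<le> (norm (u x) + norm (v x))\<^sup>2"
        by (intro power_mono norm_triangle_ineq) auto
      also have "\<dots> \<le> 2 * (norm (u x))\<^sup>2 + 2 * (norm (v x))\<^sup>2"
        using zero_le_power2[of "norm (u x) - norm (v x)"]
        by (simp add: power2_sum power2_diff)
      finally show "norm ((norm (u x + v x))\<^sup>2) \<le> norm (2 * (norm (u x))\<^sup>2 + 2 * (norm (v x))\<^sup>2)"
        by simp
    qed
  qed (use u v in measurable)
  with u v show ?thesis by (auto simp: square_integrable_def)
qed

lemma square_integrable_minus:
  "square_integrable u \<Longrightarrow> square_integrable (\<lambda>x. - u x)"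
  using square_integrable_scale[of u "-1"] by simp

lemma square_integrable_diff:
  "square_integrable u \<Longrightarrow> square_integrable v \<Longrightarrow> square_integrable (\<lambda>x. u x - v x)"
  using square_integrable_add[of u "\<lambda>x. - v x"] square_integrable_minus[of v] by simp

lemma integrable_cnj_mult:
  assumes u: "square_integrable u" and v: "square_integrable v"
  shows "integrable lebesgue (\<lambda>x. cnj (u x) * v x)"
proof (rule Bochner_Integration.integrable_bound)
  show "integrable lebesgue (\<lambda>x. (norm (u x))\<^sup>2 + (norm (v x))\<^sup>2)"
    using u v by (auto simp: square_integrable_def)
  show "(\<lambda>x. cnj (u x) * v x) \<in> borel_measurable lebesgue"
    using u v by (simp add: borel_measurable_cnj_mult)
  show "AE x in lebesgue. norm (cnj (u x) * v x) \<le> norm ((norm (u x))\<^sup>2 + (norm (v x))\<^sup>2)"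
  proof (rule AE_I2)
    fix x
    have "2 * (norm (u x) * norm (v x)) \<le> (norm (u x))\<^sup>2 + (norm (v x))\<^sup>2"
      using zero_le_power2[of "norm (u x) - norm (v x)"] by (simp add: power2_diff)
    moreover have "0 \<le> norm (u x) * norm (v x)" by simp
    ultimately have "norm (u x) * norm (v x) \<le> (norm (u x))\<^sup>2 + (norm (v x))\<^sup>2" by linarith
    then show "norm (cnj (u x) * v x) \<le> norm ((norm (u x))\<^sup>2 + (norm (v x))\<^sup>2)"
      by (simp add: norm_mult)
  qed
qed

lemma cnj_integral_cnj_mult:
  "(LINT x|lebesgue. cnj (u x) * v x) = cnj (LINT x|lebesgue. cnj (v x) * u x)"
  by (simp add: mult.commute flip: Bochner_Integration.integral_cnj)

lemma integral_cnj_mult_self: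
  "(LINT x|lebesgue. cnj (u x) * u x) = complex_of_real (LINT x|lebesgue. (norm (u x))\<^sup>2)"
proof -
  have "(LINT x|lebesgue. cnj (u x) * u x) = (LINT x|lebesgue. complex_of_real ((norm (u x))\<^sup>2))"
    by (intro Bochner_Integration.integral_cong)
       (auto simp: complex_norm_square mult.commute simp del: of_real_power)
  also have "\<dots> = complex_of_real (LINT x|lebesgue. (norm (u x))\<^sup>2)"
    by (rule integral_complex_of_real)
  finally show ?thesis .
qed

definition L2_rel :: "('a::euclidean_space \<Rightarrow> complex) \<Rightarrow> ('a \<Rightarrow> complex) \<Rightarrow> bool" where
  "L2_rel u v \<longleftrightarrow> square_integrable u \<and> square_integrable v \<and> (AE x in lebesgue. u x = v x)"

lemma L2_relI: "square_integrable u \<Longrightarrow> (\<And>x. u x = v x) \<Longrightarrow> L2_rel u v"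
proof -
  assume "square_integrable u" and "\<And>x. u x = v x"
  moreover from this(2) have "u = v" by (rule ext)
  ultimately show "L2_rel u v" by (simp add: L2_rel_def)
qed

quotient_type (overloaded) 'a L2 = "'a::euclidean_space \<Rightarrow> complex" / partial: L2_rel
proof (rule part_equivpI)
  show "\<exists>u :: 'a \<Rightarrow> complex. L2_rel u u"
    by (rule exI[of _ "\<lambda>x. 0"]) (simp add: L2_rel_def square_integrable_0)
  show "symp (L2_rel :: ('a \<Rightarrow> complex) \<Rightarrow> _)"
    by (auto simp: symp_def L2_rel_def elim: AE_mp)
  show "transp (L2_rel :: ('a \<Rightarrow> complex) \<Rightarrow> _)"
    by (auto simp: transp_def L2_rel_def elim: AE_mp)
qed

instantiation L2 :: (euclidean_space) real_inner
begin

lift_definition zero_L2 :: "'a L2" is "\<lambda>x. 0"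
  by (simp add: L2_rel_def square_integrable_0)

lift_definition plus_L2 :: "'a L2 \<Rightarrow> 'a L2 \<Rightarrow> 'a L2" is "\<lambda>u v x. u x + v x"
  by (auto simp: L2_rel_def intro: square_integrable_add)

lift_definition uminus_L2 :: "'a L2 \<Rightarrow> 'a L2" is "\<lambda>u x. - u x"
  by (auto simp: L2_rel_def intro: square_integrable_minus)

lift_definition minus_L2 :: "'a L2 \<Rightarrow> 'a L2 \<Rightarrow> 'a L2" is "\<lambda>u v x. u x - v x"
  by (auto simp: L2_rel_def intro: square_integrable_diff)

lift_definition scaleR_L2 :: "real \<Rightarrow> 'a L2 \<Rightarrow> 'a L2" is "\<lambda>r u x. complex_of_real r * u x"
  by (auto simp: L2_rel_def intro: square_integrable_scale)

lift_definition inner_L2 :: "'a L2 \<Rightarrow> 'a L2 \<Rightarrow> real"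
  is "\<lambda>u v. Re (LINT x|lebesgue. cnj (u x) * v x)"
  by (auto simp: L2_rel_def intro!: arg_cong[where f = Re] integral_cong_AE borel_measurable_cnj_mult)

definition norm_L2 :: "'a L2 \<Rightarrow> real" where "norm_L2 u = sqrt (inner u u)"
definition sgn_L2 :: "'a L2 \<Rightarrow> 'a L2" where "sgn_L2 u = scaleR (inverse (norm u)) u"
definition dist_L2 :: "'a L2 \<Rightarrow> 'a L2 \<Rightarrow> real" where "dist_L2 u v = norm (u - v)"
definition uniformity_L2 :: "('a L2 \<times> 'a L2) filter" where
  "uniformity_L2 = (INF e\<in>{0<..}. principal {(x, y). dist x y < e})"
definition open_L2 :: "'a L2 set \<Rightarrow> bool" where
  "open_L2 U \<longleftrightarrow> (\<forall>x\<in>U. eventually (\<lambda>(x', y). x' = x \<longrightarrow> y \<in> U) uniformity)"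

instance
proof
  fix x y z :: "'a L2" and r s :: real
  show "x + y + z = x + (y + z)" "x + y = y + x" "0 + x = x" "- x + x = 0" "x - y = x + - y"
    by (transfer; auto simp: L2_rel_def algebra_simps square_integrable_0
          intro!: square_integrable_add square_integrable_diff square_integrable_minus)+
  show "r *\<^sub>R (x + y) = r *\<^sub>R x + r *\<^sub>R y" "(r + s) *\<^sub>R x = r *\<^sub>R x + s *\<^sub>R x"
    "r *\<^sub>R s *\<^sub>R x = (r * s) *\<^sub>R x" "1 *\<^sub>R x = x"
    by (transfer; rule L2_relI;
        (intro square_integrable_add square_integrable_scale; simp add: L2_rel_def)?;
        simp add: algebra_simps)+
  show "sgn x = scaleR (inverse (norm x)) x" by (rule sgn_L2_def)
  show "dist x y = norm (x - y)" by (rule dist_L2_def)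
  show "(uniformity :: ('a L2 \<times> 'a L2) filter) = (INF e\<in>{0<..}. principal {(x, y). dist x y < e})"
    by (rule uniformity_L2_def)
  show "open U \<longleftrightarrow> (\<forall>x\<in>U. eventually (\<lambda>(x', y). x' = x \<longrightarrow> y \<in> U) uniformity)" for U :: "'a L2 set"
    by (rule open_L2_def)
  show "norm x = sqrt (inner x x)" by (rule norm_L2_def)
  show "inner x y = inner y x"
    by transfer (subst cnj_integral_cnj_mult, simp)
  show "inner (x + y) z = inner x z + inner y z"
    by transfer (simp add: L2_rel_def distrib_right integrable_cnj_mult)
  show "inner (r *\<^sub>R x) y = r * inner x y"
    by transfer (simp add: L2_rel_def mult.assoc)
  show "0 \<le> inner x x"
    by transfer (simp add: integral_cnj_mult_self)
  show "inner x x = 0 \<longleftrightarrow> x = 0"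
  proof transfer
    fix u :: "'a \<Rightarrow> complex" assume "L2_rel u u"
    then have u: "square_integrable u" by (simp add: L2_rel_def)
    then have "(LINT x|lebesgue. (norm (u x))\<^sup>2) = 0 \<longleftrightarrow> (AE x in lebesgue. (norm (u x))\<^sup>2 = 0)"
      by (intro integral_nonneg_eq_0_iff_AE) (auto simp: square_integrable_def)
    with u show "Re (LINT x|lebesgue. cnj (u x) * u x) = 0 \<longleftrightarrow> L2_rel u (\<lambda>x. 0)"
      by (simp add: integral_cnj_mult_self L2_rel_def square_integrable_0)
  qed
qed

end

lemma square_integrable_rep_L2: "square_integrable (rep_L2 u)"
  using Quotient3_rep_reflp[OF Quotient3_L2, of u] by (simp add: L2_rel_def)

lemma abs_rep_L2: "abs_L2 (rep_L2 u) = u"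
  by (rule Quotient3_abs_rep[OF Quotient3_L2])

lemma norm_abs_L2_diff:
  assumes u: "square_integrable u" and v: "square_integrable v"
  shows "ennreal ((norm (abs_L2 u - abs_L2 v))\<^sup>2)
           = (\<integral>\<^sup>+ x. ennreal ((norm (u x - v x))\<^sup>2) \<partial>lebesgue)"
proof -
  let ?w = "\<lambda>x. u x - v x"
  have w: "square_integrable ?w" using u v by (rule square_integrable_diff)
  have "abs_L2 u - abs_L2 v = abs_L2 ?w"
    using u v by (simp add: minus_L2.abs_eq L2_rel_def)
  then have "(norm (abs_L2 u - abs_L2 v))\<^sup>2 = inner (abs_L2 ?w) (abs_L2 ?w)"
    by (simp add: power2_norm_eq_inner)
  also have "\<dots> = Re (LINT x|lebesgue. cnj (?w x) * ?w x)"
    using w by (subst inner_L2.abs_eq) (auto simp: L2_rel_def)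
  finally have "(norm (abs_L2 u - abs_L2 v))\<^sup>2 = (LINT x|lebesgue. (norm (?w x))\<^sup>2)"
    by (simp only: integral_cnj_mult_self Re_complex_of_real)
  with w show ?thesis
    by (subst nn_integral_eq_integral) (auto simp: square_integrable_def)
qed

instance L2 :: (euclidean_space) complete_space
proof
  fix X :: "nat \<Rightarrow> 'a L2"
  assume X: "Cauchy X"
  have "\<exists>N. \<forall>m\<ge>N. \<forall>n\<ge>N. norm (X m - X n) < (1/8) ^ k" for k
    using X by (simp add: Cauchy_iff)
  then obtain N where N: "\<And>k m n. m \<ge> N k \<Longrightarrow> n \<ge> N k \<Longrightarrow> norm (X m - X n) < (1/8) ^ k"
    by metis
  define r where "r k = k + (\<Sum>i\<le>k. N i)" for k
  have r_mono: "strict_mono r"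
    by (rule strict_monoI_Suc) (simp add: r_def)
  have r_ge: "N k \<le> r n" if "k \<le> n" for k n
    using member_le_sum[of k "{..n}" N] that by (simp add: r_def)
  define a where "a k = rep_L2 (X (r k))" for k
  have a: "square_integrable (a k)" for k
    by (simp add: a_def square_integrable_rep_L2)
  have abs_a: "abs_L2 (a k) = X (r k)" for k
    by (simp add: a_def abs_rep_L2)
  have [measurable]: "a k \<in> borel_measurable lebesgue" for k
    using a by measurable
  have close: "(\<integral>\<^sup>+ x. ennreal ((norm (a m x - a n x))\<^sup>2) \<partial>lebesgue) \<le> ennreal ((1/8) ^ k)"
    if "k \<le> m" "k \<le> n" for k m n
  proof -
    have "(norm (X (r m) - X (r n)))\<^sup>2 \<le> ((1/8) ^ k)\<^sup>2"
      using N[OF r_ge r_ge, OF that] by (intro power_mono) auto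
    also have "\<dots> \<le> (1/8) ^ k"
      using power_decreasing[of k "k * 2" "1/8 :: real"] by (simp add: power_mult)
    finally show ?thesis
      using norm_abs_L2_diff[OF a a, of m n]
      unfolding abs_a by (metis ennreal_leI)
  qed

  define D where "D k x = ennreal (4 ^ k * (norm (a k x - a (Suc k) x))\<^sup>2)" for k x
  have [measurable]: "D k \<in> borel_measurable lebesgue" for k
    unfolding D_def by measurable
  have "(\<integral>\<^sup>+ x. D k x \<partial>lebesgue) \<le> ennreal ((1/2) ^ k)" for k
  proof -
    have "(\<integral>\<^sup>+ x. D k x \<partial>lebesgue)
            = ennreal (4 ^ k) * (\<integral>\<^sup>+ x. ennreal ((norm (a k x - a (Suc k) x))\<^sup>2) \<partial>lebesgue)"
      unfolding D_def by (subst nn_integral_cmult[symmetric]) (auto simp: ennreal_mult)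
    also have "\<dots> \<le> ennreal (4 ^ k) * ennreal ((1/8) ^ k)"
      by (intro mult_left_mono close) auto
    also have "\<dots> = ennreal ((1/2) ^ k)"
      by (simp flip: ennreal_mult power_mult_distrib)
    finally show ?thesis .
  qed
  then have "(\<Sum>k. \<integral>\<^sup>+ x. D k x \<partial>lebesgue) \<le> (\<Sum>k. ennreal ((1/2) ^ k))"
    by (intro suminf_le) auto
  also have "\<dots> = ennreal (\<Sum>k. (1/2) ^ k)"
    by (rule suminf_ennreal2) (auto intro: summable_geometric)
  finally have fin: "(\<integral>\<^sup>+ x. (\<Sum>k. D k x) \<partial>lebesgue) \<noteq> \<infinity>"
    by (subst nn_integral_suminf) (auto simp: top_unique)
  have "AE x in lebesgue. (\<Sum>k. D k x) \<noteq> \<infinity>"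
    using fin by (intro nn_integral_PInf_AE) auto
  then have conv: "AE x in lebesgue. convergent (\<lambda>k. a k x)"
  proof eventually_elim
    case (elim x)
    then obtain C where C: "(\<Sum>k. D k x) = ennreal C" "0 \<le> C"
      by (cases "\<Sum>k. D k x") auto
    have "norm (a (Suc k) x - a k x) \<le> sqrt C * (1/2) ^ k" for k
    proof -
      have "D k x \<le> (\<Sum>k. D k x)"
        using sum_le_suminf[of "\<lambda>k. D k x" "{k}"] by simp
      then have "4 ^ k * (norm (a k x - a (Suc k) x))\<^sup>2 \<le> C"
        using C by (simp add: D_def)
      then have "(2 ^ k * norm (a k x - a (Suc k) x))\<^sup>2 \<le> C"
        by (simp add: power_mult_distrib power2_eq_square[of "2 ^ k"] flip: power_mult_distrib[of 2 2])
      then have "2 ^ k * norm (a k x - a (Suc k) x) \<le> sqrt C"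
        by (rule real_le_rsqrt)
      then show ?thesis
        by (simp add: norm_minus_commute field_simps)
    qed
    moreover have "summable (\<lambda>k. sqrt C * (1/2) ^ k)"
      by (rule summable_mult) (simp add: summable_geometric)
    ultimately have "summable (\<lambda>k. a (Suc k) x - a k x)"
      by (rule summable_comparison_test'[rotated])
    then have "convergent (\<lambda>n. \<Sum>k<n. a (Suc k) x - a k x)"
      by (rule iffD1[OF summable_iff_convergent])
    then have "convergent (\<lambda>n. a n x - a 0 x)"
      by (simp only: sum_lessThan_telescope[where f = "\<lambda>k. a k x"])
    from convergent_add[OF this convergent_const[of "a 0 x"]] show ?case
      by (simp only: diff_add_cancel)
  qed

  define h where "h x = lim (\<lambda>k. a k x)" for x
  have [measurable]: "h \<in> borel_measurable lebesgue"
    unfolding h_def by measurable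
  have fatou: "(\<integral>\<^sup>+ x. ennreal ((norm (a k x - h x))\<^sup>2) \<partial>lebesgue) \<le> ennreal ((1/8) ^ k)" for k
  proof -
    have "(\<integral>\<^sup>+ x. ennreal ((norm (a k x - h x))\<^sup>2) \<partial>lebesgue)
            = (\<integral>\<^sup>+ x. liminf (\<lambda>n. ennreal ((norm (a k x - a n x))\<^sup>2)) \<partial>lebesgue)"
    proof (rule nn_integral_cong_AE borel_measurable_cnj_mult)
      show "AE x in lebesgue. ennreal ((norm (a k x - h x))\<^sup>2)
              = liminf (\<lambda>n. ennreal ((norm (a k x - a n x))\<^sup>2))"
        using conv
      proof eventually_elim
        case (elim x)
        then have "(\<lambda>n. a n x) \<longlonglongrightarrow> h x"
          by (simp add: h_def convergent_LIMSEQ_iff)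
        then have "(\<lambda>n. ennreal ((norm (a k x - a n x))\<^sup>2)) \<longlonglongrightarrow> ennreal ((norm (a k x - h x))\<^sup>2)"
          by (intro tendsto_intros)
        then show ?case
          by (rule lim_imp_Liminf[OF sequentially_bot, symmetric])
      qed
    qed
    also have "\<dots> \<le> liminf (\<lambda>n. \<integral>\<^sup>+ x. ennreal ((norm (a k x - a n x))\<^sup>2) \<partial>lebesgue)"
      by (rule nn_integral_liminf) measurable
    also have "\<dots> \<le> Limsup sequentially (\<lambda>n. \<integral>\<^sup>+ x. ennreal ((norm (a k x - a n x))\<^sup>2) \<partial>lebesgue)"
      by (rule Liminf_le_Limsup) simp
    also have "\<dots> \<le> ennreal ((1/8) ^ k)"
      by (rule Limsup_bounded) (auto simp: eventually_sequentially intro!: exI[of _ k] close)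
    finally show ?thesis .
  qed
  have "square_integrable (\<lambda>x. a 0 x - h x)"
  proof -
    have "integrable lebesgue (\<lambda>x. (norm (a 0 x - h x))\<^sup>2)"
      using fatou[of 0] by (intro integrableI_bounded) (auto simp: le_less_trans)
    then show ?thesis by (simp add: square_integrable_def)
  qed
  from square_integrable_diff[OF a[of 0] this] have h: "square_integrable h"
    by simp
  have bound: "(norm (X (r k) - abs_L2 h))\<^sup>2 \<le> (1/8) ^ k" for k
  proof -
    have "ennreal ((norm (X (r k) - abs_L2 h))\<^sup>2) \<le> ennreal ((1/8) ^ k)"
      using fatou[of k] norm_abs_L2_diff[OF a h, of k] unfolding abs_a by simp
    then show ?thesis by (subst (asm) ennreal_le_iff) auto
  qed
  have "(\<lambda>k. (norm (X (r k) - abs_L2 h))\<^sup>2) \<longlonglongrightarrow> 0"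
    by (rule tendsto_sandwich[of "\<lambda>_. 0" _ _ "\<lambda>k. (1/8) ^ k"])
       (auto simp: bound intro!: LIMSEQ_power_zero)
  then have "(\<lambda>k. norm (X (r k) - abs_L2 h)) \<longlonglongrightarrow> 0"
    using tendsto_real_sqrt[of "\<lambda>k. (norm (X (r k) - abs_L2 h))\<^sup>2" 0 sequentially] by simp
  then have "(X \<circ> r) \<longlonglongrightarrow> abs_L2 h"
    by (simp only: o_def tendsto_norm_zero_iff LIM_zero_iff)
  then show "convergent X"
    using Cauchy_converges_subseq[OF X r_mono] by (auto simp: convergent_def)
qed

instantiation L2 :: (euclidean_space) complex_hilbert_space
begin

lift_definition scaleC_L2 :: "complex \<Rightarrow> 'a L2 \<Rightarrow> 'a L2" is "\<lambda>c u x. c * u x"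
  by (auto simp: L2_rel_def intro: square_integrable_scale)

lift_definition cinner_L2 :: "'a L2 \<Rightarrow> 'a L2 \<Rightarrow> complex"
  is "\<lambda>u v. LINT x|lebesgue. cnj (u x) * v x"
  by (auto simp: L2_rel_def intro!: integral_cong_AE borel_measurable_cnj_mult)

instance
proof
  fix x y z :: "'a L2" and a b :: complex and r :: real
  show "a *\<^sub>C (x + y) = a *\<^sub>C x + a *\<^sub>C y" "(a + b) *\<^sub>C x = a *\<^sub>C x + b *\<^sub>C x"
    "a *\<^sub>C b *\<^sub>C x = (a * b) *\<^sub>C x" "complex_of_real r *\<^sub>C x = r *\<^sub>R x"
    by (transfer; rule L2_relI;
        (intro square_integrable_add square_integrable_scale; simp add: L2_rel_def)?;
        simp add: algebra_simps)+
  show "cinner x y = cnj (cinner y x)"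
    by transfer (rule cnj_integral_cnj_mult)
  show "cinner x (y + z) = cinner x y + cinner x z"
    by transfer (simp add: L2_rel_def distrib_left integrable_cnj_mult)
  show "cinner x (a *\<^sub>C y) = a * cinner x y"
    by transfer (simp add: L2_rel_def mult.left_commute)
  show "inner x y = Re (cinner x y)"
    by transfer simp
qed

end

text \<open>The integral defining the transform converges only on \<open>L\<^sub>1 \<inter> L\<^sub>2\<close>. On \<open>L\<^sub>2\<close> the
  transform is the limit in \<open>L\<^sub>2\<close> of the integrals over the balls of radius \<open>n\<close>; by Plancherel
  these are square-integrable in \<open>p\<close>, the limit exists, and the result is a unitary bijection.\<close>

definition fourier :: "'a::euclidean_space L2 \<Rightarrow> 'a L2" where
  "fourier u = lim (\<lambda>n. abs_L2 (\<lambda>p. complex_of_real ((2 * pi) powr (- real DIM('a) / 2)) *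
     (LINT x:cball 0 (real n)|lebesgue. exp (- \<i> * complex_of_real (inner p x)) * rep_L2 u x)))"

text \<open>Possibly unbounded operators are given by their graphs. Both operators below have their
  maximal domain: \<open>u\<close> is in the domain of \<open>f(X)\<close> iff \<open>f u\<close> is in \<open>L\<^sub>2\<close>, and in that of
  \<open>g(-i\<nabla>)\<close> iff \<open>g\<close> times the Fourier transform of \<open>u\<close> is in \<open>L\<^sub>2\<close>.\<close>

definition position_op :: "('a::euclidean_space \<Rightarrow> complex) \<Rightarrow> ('a L2 \<times> 'a L2) set" where
  "position_op f = {(u, v). AE x in lebesgue. rep_L2 v x = f x * rep_L2 u x}"

definition momentum_op :: "('a::euclidean_space \<Rightarrow> complex) \<Rightarrow> ('a L2 \<times> 'a L2) set" where
  "momentum_op g = {(u, inv fourier v) |u v. (fourier u, v) \<in> position_op g}"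

text \<open>\<open>f(X) g(-i\<nabla>)\<close> on its natural domain; \<open>O\<close> applies its left argument first.\<close>

definition position_momentum_op ::
  "('a::euclidean_space \<Rightarrow> complex) \<Rightarrow> ('a \<Rightarrow> complex) \<Rightarrow> ('a L2 \<times> 'a L2) set" where
  "position_momentum_op f g = momentum_op g O position_op f"

text \<open>A densely defined operator with graph \<open>T\<close> that is bounded on its domain is identified with
  its unique bounded extension \<open>K\<close> to the whole space, that is, with its closure: the closure of
  \<open>T\<close> in the product topology is the graph of the everywhere defined map \<open>K\<close>. In particular
  \<open>K\<close> is determined by \<open>T\<close>, and density of the domain is part of the assertion.\<close>

definition is_operator_closure :: "('h::complex_hilbert_space \<times> 'h) set \<Rightarrow> ('h \<Rightarrow> 'h) \<Rightarrow> bool" where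
  "is_operator_closure T K \<longleftrightarrow> closure T = {(u, K u) |u. True}"

end

theory Submission
  imports Defs "HOL-Probability.Characteristic_Functions"
begin

text \<open>The estimate is Rumin's argument. Let \<open>\<phi>\<^sub>1, \<dots>, \<phi>\<^sub>N\<close> be orthonormal with Fourier transforms
  \<open>\<psi>\<^sub>j\<close>, let \<open>u\<^sub>j\<close> be the inverse transform of \<open>g \<psi>\<^sub>j\<close>, and \<open>\<rho> = \<Sum>\<^sub>j |u\<^sub>j|\<^sup>2\<close>. For \<open>E > 0\<close> split \<open>g\<close> at
  the level \<open>|g| = 1/\<surd>E\<close>. By Bessel's inequality the large values of \<open>g\<close> contribute at most
  \<open>A E\<^sup>2\<^sup>a\<close> to \<open>\<rho>\<close> at almost every point, with \<open>a = (q - 2)/4\<close>; the contribution of the small values,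
  integrated over space and over \<open>E\<close>, is at most \<open>N\<close>. Hence \<open>\<integral>\<integral> (\<surd>\<rho> - \<surd>A E\<^sup>a)\<^sub>+\<^sup>2 dE dx \<le> N\<close>, which is a
  bound \<open>B N\<close> for the integral of \<open>\<rho>\<close> to the power \<open>q/(q - 2)\<close>, and Young's inequality turns it into
  a bound for \<open>\<Sum>\<^sub>j \<parallel>K \<phi>\<^sub>j\<parallel>\<^sup>2 = \<integral> |f|\<^sup>2 \<rho>\<close>. An orthonormal set on which \<open>\<parallel>K \<phi>\<parallel> > \<kappa>\<close> therefore has at most
  \<open>C \<kappa>\<^sup>-\<^sup>q\<close> elements; this gives compactness of \<open>K\<close> as well as the bound on the eigenvalues of \<open>|K|\<close>.

  Plancherel's theorem comes from Gaussian regularisation: the Fourier transform is a contraction of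
  \<open>L\<^sub>2\<close> by Schur's test, it preserves the norm of indicator functions of bounded open sets by Fatou's
  lemma, and these functions are total.\<close>

section \<open>Operators on complex Hilbert spaces\<close>

text \<open>Where C comes from: the weight in Young's inequality gives the number N of vectors the
  coefficient (1 - 2/q) \<kappa>^2. As N \<kappa>^2 is at most the sum of the squared norms, that
  term is absorbed on the left; 2/q N \<kappa>^2 remains, and 2/q cancels against the coefficient of
  the other term. Hence C = B powr ((q - 2)/2) times the integral of |f|^q. Two obstacles shape the
  rest. First, \<open>K\<close> is a closure and orthonormal vectors need not lie in the natural
  domain, while approximating them inside the domain destroys orthonormality. So \<open>g\<close> is
  cut off instead of the vectors: where |g| \<le> n it obeys the same weak-type bound and has full
  domain, and the estimate survives n \<rightarrow> \<infinity>. Second, the argument divides by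
  powers of the weak quasi-norm of \<open>g\<close>, which may vanish; it is run with an arbitrary
  larger W > 0, which is lowered at the end. Since the estimate concerns arbitrary orthonormal sets,
  no spectral decomposition of \<open>K\<close> enters: compactness comes from a maximal such set,
  the eigenvalue count from eigenvectors of |K|.\<close>

abbreviation clinear :: "('a::complex_hilbert_space \<Rightarrow> 'a) \<Rightarrow> bool" where
  "clinear \<equiv> Vector_Spaces.linear scaleC scaleC"

lemma clinear_iff:
  "clinear K \<longleftrightarrow> (\<forall>x y. K (x + y) = K x + K y) \<and> (\<forall>c x. K (c *\<^sub>C x) = c *\<^sub>C K x)"
  by (simp add: Vector_Spaces.linear_iff complex_vector.vector_space_axioms)

lemma clinearD:
  assumes "clinear K"
  shows "K (x + y) = K x + K y" "K (c *\<^sub>C x) = c *\<^sub>C K x" "K (r *\<^sub>R x) = r *\<^sub>R K x"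
    "K (x - y) = K x - K y" "K 0 = 0" "K (sum f A) = (\<Sum>a\<in>A. K (f a))"
proof -
  show 1: "K (x + y) = K x + K y" for x y using assms by (simp add: clinear_iff)
  show 2: "K (c *\<^sub>C x) = c *\<^sub>C K x" for c x using assms by (simp add: clinear_iff)
  show 3: "K (r *\<^sub>R x) = r *\<^sub>R K x" for r x using 2[of "complex_of_real r"] by (simp add: scaleC_of_real)
  show "K (x - y) = K x - K y" using 1[of "x - y" y] by (simp add: algebra_simps)
  show 0: "K 0 = 0" using 3[of 0 0] by simp
  show "K (sum f A) = (\<Sum>a\<in>A. K (f a))"
    by (induction A rule: infinite_finite_induct) (auto simp: 0 1)
qed

section \<open>The sesquilinear form and its Cauchy-Schwarz inequality\<close>

lemma cinner_add_left: "cinner (x + y) z = cinner x z + cinner y z"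
  by (subst (1 2 3) cinner_commute) (simp add: cinner_add_right)

lemma cinner_scaleC_left: "cinner (a *\<^sub>C x) y = cnj a * cinner x y"
  by (subst (1 2) cinner_commute) (simp add: cinner_scaleC_right)

lemma cinner_zero_right [simp]: "cinner x 0 = 0"
  using cinner_add_right[of x 0 0] by simp

lemma cinner_zero_left [simp]: "cinner 0 x = 0"
  using cinner_add_left[of 0 0 x] by simp

lemma cinner_diff_right: "cinner x (y - z) = cinner x y - cinner x z"
  using cinner_add_right[of x "y - z" z] by simp

lemma cinner_diff_left: "cinner (x - y) z = cinner x z - cinner y z"
  using cinner_add_left[of "x - y" y z] by simp

lemma cinner_scaleR_right: "cinner x (r *\<^sub>R y) = of_real r * cinner x y"
  using cinner_scaleC_right[of x "complex_of_real r" y] by (simp add: scaleC_of_real)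

lemma cinner_scaleR_left: "cinner (r *\<^sub>R x) y = of_real r * cinner x y"
  using cinner_scaleC_left[of "complex_of_real r" x y] by (simp add: scaleC_of_real)

lemma cinner_sum_right: "cinner x (\<Sum>a\<in>A. f a) = (\<Sum>a\<in>A. cinner x (f a))"
  by (induction A rule: infinite_finite_induct) (auto simp: cinner_add_right)

lemma cinner_sum_left: "cinner (\<Sum>a\<in>A. f a) x = (\<Sum>a\<in>A. cinner (f a) x)"
  by (induction A rule: infinite_finite_induct) (auto simp: cinner_add_left)

text \<open>Upgrades an identity of real inner products, once it is known for all vectors, to the
  complex inner product.\<close>

lemma Im_cinner: "Im (cinner x y) = inner (\<i> *\<^sub>C x) y"
  by (simp add: inner_eq_Re_cinner cinner_scaleC_left)

lemma cinner_self: "cinner x x = complex_of_real ((norm x)\<^sup>2)"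
proof -
  have "cinner x x = cnj (cinner x x)" by (rule cinner_commute)
  then have "Im (cinner x x) = 0" by (simp add: complex_eq_iff)
  then show ?thesis
    by (simp add: complex_eq_iff power2_norm_eq_inner inner_eq_Re_cinner)
qed

lemma cinner_eqI: "(\<And>z. cinner x z = cinner y z) \<Longrightarrow> x = y"
  using cinner_self[of "x - y"] by (simp add: cinner_diff_left)

lemma norm_scaleC: "norm (c *\<^sub>C x) = cmod c * norm x"
proof -
  have "complex_of_real ((norm (c *\<^sub>C x))\<^sup>2) = (c * cnj c) * complex_of_real ((norm x)\<^sup>2)"
    by (simp only: cinner_self[symmetric] cinner_scaleC_left cinner_scaleC_right mult.assoc)
  also have "(c * cnj c) * complex_of_real ((norm x)\<^sup>2) = complex_of_real ((cmod c * norm x)\<^sup>2)"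
    by (simp only: complex_norm_square[symmetric] of_real_mult[symmetric] power_mult_distrib)
  finally have "(norm (c *\<^sub>C x))\<^sup>2 = (cmod c * norm x)\<^sup>2" by (simp only: of_real_eq_iff)
  then show ?thesis by (rule power2_eq_imp_eq) auto
qed

lemma cinner_cauchy_schwarz: "cmod (cinner x y) \<le> norm x * norm y"
proof (cases "cinner x y = 0")
  case False
  \<comment> \<open>A phase of modulus 1 that makes the inner product real and nonnegative, which
    reduces the claim to the real Cauchy-Schwarz inequality.\<close>
  define c where "c = cnj (cinner x y) / cmod (cinner x y)"
  have "c * cinner x y = of_real (cmod (cinner x y))"
    using False by (simp add: c_def mult.commute[of "cnj _"] complex_norm_square[symmetric]
        power2_eq_square[of "complex_of_real _"])
  then have "cmod (cinner x y) = inner x (c *\<^sub>C y)"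
    by (simp add: inner_eq_Re_cinner cinner_scaleC_right)
  also have "\<dots> \<le> norm x * norm (c *\<^sub>C y)" by (rule norm_cauchy_schwarz)
  also have "norm (c *\<^sub>C y) = norm y" using False by (simp add: norm_scaleC c_def norm_divide)
  finally show ?thesis .
qed simp

lemma scaleC_diff_right: "a *\<^sub>C (x - y) = a *\<^sub>C x - a *\<^sub>C y"
  using scaleC_add_right[of a "x - y" y] by (simp add: algebra_simps)

lemma scaleC_scaleR: "c *\<^sub>C r *\<^sub>R x = r *\<^sub>R c *\<^sub>C x"
  by (simp add: scaleC_scaleC mult.commute flip: scaleC_of_real)

lemma bounded_linear_cinner_right: "bounded_linear (cinner x)"
  by (rule bounded_linear_intro[where K = "norm x"])
     (auto simp: cinner_add_right cinner_scaleR_right scaleR_conv_of_real mult.commute[of _ "norm x"] cinner_cauchy_schwarz)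

lemma bounded_linear_cinner_left: "bounded_linear (\<lambda>x. cinner x y)"
  by (rule bounded_linear_intro[where K = "norm y"])
     (auto simp: cinner_add_left cinner_scaleR_left scaleR_conv_of_real cinner_cauchy_schwarz)

lemma bounded_linear_scaleC_right: "bounded_linear (\<lambda>x. c *\<^sub>C x)"
  by (rule bounded_linear_intro[where K = "cmod c"])
     (auto simp: scaleC_add_right norm_scaleC scaleC_scaleR)

lemma bounded_linear_scaleC_left: "bounded_linear (\<lambda>c. c *\<^sub>C x)"
  by (rule bounded_linear_intro[where K = "norm x"])
     (auto simp: scaleC_add_left norm_scaleC scaleR_conv_of_real scaleC_of_real simp flip: scaleC_scaleC)

lemmas tendsto_cinner_right = bounded_linear.tendsto[OF bounded_linear_cinner_right]
lemmas tendsto_cinner_left = bounded_linear.tendsto[OF bounded_linear_cinner_left]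
lemmas tendsto_scaleC_right = bounded_linear.tendsto[OF bounded_linear_scaleC_right]

lemma clinear_bounded_linear:
  assumes "clinear K" "\<And>x. norm (K x) \<le> C * norm x"
  shows "bounded_linear K"
  by (rule bounded_linear_intro[where K = C]) (use assms in \<open>auto simp: clinearD mult.commute\<close>)

text \<open>The representing vector minimises \<open>\<lambda>x. (norm x)\<^sup>2 / 2 - \<phi> x\<close>; by the parallelogram law
  minimising sequences are Cauchy.\<close>

theorem Riesz_representation:
  fixes \<phi> :: "'a::{real_inner,complete_space} \<Rightarrow> real"
  assumes "bounded_linear \<phi>"
  shows "\<exists>z. \<forall>y. \<phi> y = inner z y"
proof -
  interpret bounded_linear \<phi> by fact
  define J where "J x = (norm x)\<^sup>2 / 2 - \<phi> x" for x
  obtain B where B: "\<And>x. norm (\<phi> x) \<le> norm x * B" using bounded by blast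
  have J_bound: "- (B\<^sup>2) / 2 \<le> J x" for x
  proof -
    have "0 \<le> (norm x - B)\<^sup>2" by simp
    moreover have "\<phi> x \<le> norm x * B" using B[of x] by simp
    ultimately show ?thesis by (simp add: J_def power2_diff)
  qed
  define m where "m = (INF x. J x)"
  have bdd: "bdd_below (range J)" using J_bound by (intro bdd_belowI2)
  have m_le: "m \<le> J x" for x unfolding m_def by (rule cINF_lower[OF bdd]) simp
  have "\<exists>x. J x < m + 1 / real (Suc n)" for n
    using cINF_less_iff[OF _ bdd, of "m + 1 / real (Suc n)"] by (auto simp: m_def)
  then obtain X where X: "\<And>n. J (X n) < m + 1 / real (Suc n)" by metis
  \<comment> \<open>The linear part \<open>\<phi>\<close> cancels in this combination. As
    \<open>J\<close> is at least \<open>m\<close> at the midpoint, two almost minimal points must be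
    close.\<close>
  have par: "(norm (x - y))\<^sup>2 = 4 * (J x + J y - 2 * J ((1/2) *\<^sub>R (x + y)))" for x y
    by (simp add: J_def add scaleR power_mult_distrib)
       (simp add: power2_norm_eq_inner inner_simps inner_commute[of y x] field_simps)
  have close: "(norm (X i - X j))\<^sup>2 \<le> 8 / real (Suc n)" if "n \<le> i" "n \<le> j" for i j n
  proof -
    have "1 / real (Suc i) \<le> 1 / real (Suc n)" "1 / real (Suc j) \<le> 1 / real (Suc n)"
      using that by (auto simp: divide_simps)
    then show ?thesis
      using par[of "X i" "X j"] X[of i] X[of j] m_le[of "(1/2) *\<^sub>R (X i + X j)"] by simp
  qed
  have "Cauchy X"
  proof (rule CauchyI)
    fix e :: real assume "0 < e"
    then obtain n where n: "8 / e\<^sup>2 < real (Suc n)"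
      using reals_Archimedean2[of "8 / e\<^sup>2"] by (metis less_trans lessI of_nat_less_iff)
    then have "8 / real (Suc n) < e\<^sup>2" using \<open>0 < e\<close> by (simp add: divide_simps mult.commute)
    then have "norm (X i - X j) < e" if "n \<le> i" "n \<le> j" for i j
      using close[OF that] \<open>0 < e\<close> by (intro power2_less_imp_less[of _ e]) auto
    then show "\<exists>M. \<forall>i\<ge>M. \<forall>j\<ge>M. norm (X i - X j) < e" by blast
  qed
  then obtain z where z: "X \<longlonglongrightarrow> z" using Cauchy_convergent convergent_def by blast
  have "(\<lambda>n. J (X n)) \<longlonglongrightarrow> J z"
    unfolding J_def by (intro tendsto_diff tendsto_divide tendsto_power tendsto_norm tendsto_const z tendsto) simp
  moreover have "(\<lambda>n. m + 1 / real (Suc n)) \<longlonglongrightarrow> m + 0"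
    by (rule tendsto_add[OF tendsto_const LIMSEQ_Suc[OF lim_1_over_n]])
  ultimately have "J z \<le> m"
    using LIMSEQ_le[of "\<lambda>n. J (X n)" "J z" "\<lambda>n. m + 1 / real (Suc n)" "m + 0"] X
    by (simp add: less_imp_le)
  then have Jz: "J z \<le> J x" for x using m_le[of x] by simp
  have "\<phi> y = inner z y" for y
  proof (rule ccontr)
    define d where "d = inner z y - \<phi> y"
    assume "\<phi> y \<noteq> inner z y"
    then have d: "d \<noteq> 0" by (simp add: d_def)
    then have y: "y \<noteq> 0" by (auto simp: d_def zero)
    \<comment> \<open>The minimiser of the quadratic polynomial \<open>J (z + t *\<^sub>R y)\<close>
      in \<open>t\<close>.\<close>
    define t where "t = - d / (norm y)\<^sup>2"
    have "J (z + t *\<^sub>R y) = J z + t * d + t\<^sup>2 * (norm y)\<^sup>2 / 2"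
      by (simp add: J_def d_def add scaleR power2_norm_eq_inner inner_simps inner_commute[of y z])
         (simp add: field_simps power2_eq_square)
    also have "\<dots> = J z - d\<^sup>2 / (2 * (norm y)\<^sup>2)"
      using y by (simp add: t_def field_simps power2_eq_square)
    also have "\<dots> < J z" using d y by simp
    finally show False using Jz[of "z + t *\<^sub>R y"] by simp
  qed
  then show ?thesis by blast
qed

section \<open>Adjoints and positive operators\<close>

lemma bounded_clinear_adjoint:
  assumes K: "clinear K" "bounded_linear K"
  shows "\<exists>L. \<forall>x y. cinner (K x) y = cinner x (L y)"
proof -
  have "\<exists>z. \<forall>x. inner (K x) y = inner z x" for y
    by (rule Riesz_representation) (intro bounded_linear_compose[OF bounded_linear_inner_left K(2)])
  then obtain L where L: "\<And>x y. inner (K x) y = inner (L y) x" by metis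
  \<comment> \<open>Riesz representation has supplied \<open>L\<close> for the real inner product
    only; replacing \<open>x\<close> by \<open>\<i> *\<^sub>C x\<close> gives the imaginary
    part.\<close>
  have "cinner (K x) y = cinner x (L y)" for x y
  proof (rule complex_eqI)
    show "Re (cinner (K x) y) = Re (cinner x (L y))"
      using L[of x y] by (simp add: inner_commute flip: inner_eq_Re_cinner)
    show "Im (cinner (K x) y) = Im (cinner x (L y))"
      using L[of "\<i> *\<^sub>C x" y] K(1) by (simp add: Im_cinner clinearD inner_commute)
  qed
  then show ?thesis by blast
qed

lemma cinner_cadjoint:
  assumes "clinear K" "bounded_linear K"
  shows "cinner (K x) y = cinner x (cadjoint K y)"
proof -
  obtain L where L: "\<And>x y. cinner (K x) y = cinner x (L y)"
    using bounded_clinear_adjoint[OF assms] by blast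
  have "\<forall>x y. cinner (K x) y = cinner x (cadjoint K y)"
    unfolding cadjoint_def
  proof (rule theI[where P = "\<lambda>L. \<forall>x y. cinner (K x) y = cinner x (L y)"])
    fix L' assume "\<forall>x y. cinner (K x) y = cinner x (L' y)"
    then have "cinner x (L' y) = cinner x (L y)" for x y using L by metis
    then have "cinner (L' y) x = cinner (L y) x" for x y by (metis cinner_commute)
    then show "L' = L" by (intro ext cinner_eqI)
  qed (use L in blast)
  then show ?thesis by blast
qed

lemma positive_operator_cadjoint_comp:
  assumes K: "clinear K" "bounded_linear K"
  shows "positive_operator (cadjoint K \<circ> K)"
proof -
  interpret K: bounded_linear K by fact
  obtain B where B: "0 \<le> B" "\<And>x. norm (K x) \<le> norm x * B" using K.nonneg_bounded by blast
  let ?P = "cadjoint K \<circ> K"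
  have ip: "cinner x (?P y) = cinner (K x) (K y)" for x y
    using cinner_cadjoint[OF K] by simp
  have eqI: "u = v" if "\<And>x. cinner x u = cinner x v" for u v :: 'a
    by (rule cinner_eqI) (metis that cinner_commute)
  have lin: "clinear ?P"
    unfolding clinear_iff
    by (intro conjI allI; rule eqI; unfold ip cinner_add_right cinner_scaleC_right)
       (simp_all only: clinearD[OF K(1)] cinner_add_right cinner_scaleC_right)
  \<comment> \<open>The squared norm of \<open>P x\<close> equals \<open>|<K (P x), K x>|\<close>,
    which is at most \<open>B\<^sup>2 * norm (P x) * norm x\<close>; one factor
    \<open>norm (P x)\<close> cancels.\<close>
  have "norm (?P x) \<le> B\<^sup>2 * norm x" for x
  proof -
    have "(norm (?P x))\<^sup>2 = cmod (cinner (K (?P x)) (K x))"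
      unfolding ip[symmetric] cinner_self norm_of_real by simp
    also have "\<dots> \<le> norm (K (?P x)) * norm (K x)" by (rule cinner_cauchy_schwarz)
    also have "\<dots> \<le> (norm (?P x) * B) * (norm x * B)" by (intro mult_mono B) (use B in auto)
    finally have "norm (?P x) * norm (?P x) \<le> norm (?P x) * (B\<^sup>2 * norm x)"
      by (simp add: power2_eq_square mult_ac)
    then show ?thesis using B by (cases "norm (?P x) = 0") (auto simp: mult_le_cancel_left)
  qed
  then have "bounded_linear ?P" using lin by (intro clinear_bounded_linear)
  moreover have "cinner x (?P x) \<in> \<real>\<^sub>\<ge>\<^sub>0" for x unfolding ip cinner_self
    by (simp only: nonneg_Reals_of_real_iff zero_le_power2)
  ultimately show ?thesis using lin by (simp add: positive_operator_def)
qed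

text \<open>Complex polarisation: the defect \<open>D\<close> is sesquilinear and vanishes on the
  diagonal, so testing it on x + y and on x + i y shows that it vanishes everywhere.\<close>

lemma positive_operator_sym:
  assumes "positive_operator S"
  shows "cinner x (S y) = cinner (S x) y"
proof -
  have S: "clinear S" and pos: "\<And>x. cinner x (S x) \<in> \<real>\<^sub>\<ge>\<^sub>0"
    using assms by (auto simp: positive_operator_def)
  define D where "D x y = cinner x (S y) - cinner (S x) y" for x y
  have D0: "D x x = 0" for x
  proof -
    have "cinner (S x) x = cnj (cinner x (S x))" by (rule cinner_commute)
    then show ?thesis using pos[of x] by (auto simp: D_def complex_nonneg_Reals_iff complex_eq_iff)
  qed
  have 1: "D x y + D y x = 0"
    using D0[of "x + y"] D0[of x] D0[of y] S
    by (simp add: D_def clinearD cinner_add_left cinner_add_right algebra_simps)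
  have "\<i> * D x y - \<i> * D y x = 0"
    using D0[of "x + \<i> *\<^sub>C y"] D0[of x] D0[of y] S
    by (simp add: D_def clinearD cinner_add_left cinner_add_right cinner_scaleC_left cinner_scaleC_right
       algebra_simps)
  then have "D x y = D y x" by simp
  with 1 show ?thesis by (simp add: D_def)
qed

lemma positive_operator_inner:
  assumes "positive_operator S"
  shows "inner x (S y) = inner (S x) y" "0 \<le> inner x (S x)"
    "cinner x (S x) = of_real (inner x (S x))"
proof -
  show "inner x (S y) = inner (S x) y"
    using positive_operator_sym[OF assms] by (simp add: inner_eq_Re_cinner)
  have "cinner x (S x) \<in> \<real>\<^sub>\<ge>\<^sub>0" using assms by (simp add: positive_operator_def)
  then show "0 \<le> inner x (S x)" "cinner x (S x) = of_real (inner x (S x))"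
    by (auto simp: complex_nonneg_Reals_iff inner_eq_Re_cinner complex_eq_iff)
qed

text \<open>The form evaluated at x + t y is a quadratic polynomial in t that is never negative, so
  its discriminant is not positive.\<close>

lemma positive_form_cauchy_schwarz:
  fixes S :: "'a::real_inner \<Rightarrow> 'a"
  assumes S: "linear S" and sym: "\<And>x y. inner x (S y) = inner (S x) y"
    and pos: "\<And>x. 0 \<le> inner x (S x)"
  shows "(inner x (S y))\<^sup>2 \<le> inner x (S x) * inner y (S y)"
proof -
  interpret linear S by fact
  define a b c where "a = inner x (S x)" "b = inner x (S y)" "c = inner y (S y)"
  have q: "0 \<le> a + 2 * t * b + t\<^sup>2 * c" for t
    using pos[of "x + t *\<^sub>R y"] sym[of y x]
    by (simp add: a_b_c_def add scale inner_simps inner_commute[of "S y" x] inner_commute[of y "S x"]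
        power2_eq_square algebra_simps)
  have "b\<^sup>2 \<le> a * c"
  proof (cases "c = 0")
    case True
    have "b = 0"
    proof (rule ccontr)
      assume "b \<noteq> 0"
      \<comment> \<open>At this \<open>t\<close> the polynomial, here affine, has the value
        -1.\<close>
      then show False using q[of "- (a + 1) / (2 * b)"] True by (simp add: field_simps)
    qed
    then show ?thesis using True by simp
  next
    case False
    then have c: "c > 0" using pos[of y] by (simp add: a_b_c_def)
    have "0 \<le> a - b\<^sup>2 / c"
      using q[of "- b / c"] c by (simp add: field_simps power2_eq_square)
    then show ?thesis using c by (simp add: field_simps)
  qed
  then show ?thesis by (simp add: a_b_c_def)
qed

text \<open>Cauchy-Schwarz for the form of \<open>S\<close>, tested against the vector
  \<open>S y\<close> itself.\<close>

lemma positive_operator_zero: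
  assumes S: "positive_operator S" and y: "inner y (S y) = 0"
  shows "S y = 0"
proof -
  have "linear S" using S by (simp add: positive_operator_def bounded_linear.linear)
  from positive_form_cauchy_schwarz[OF this, of "S y" y] positive_operator_inner[OF S] y
  have "inner (S y) (S y) = 0" by (metis mult_zero_right power2_less_eq_zero_iff)
  then show ?thesis by simp
qed

text \<open>\<open>nonneg_poly B a T\<close>: \<open>T\<close> is \<open>p B\<close> for a polynomial \<open>p\<close> with coefficients \<open>\<ge> 0\<close> and
  \<open>p 1 = a\<close>. For a contraction \<open>B\<close> this gives \<open>norm (T x) \<le> a * norm x\<close>.\<close>

inductive nonneg_poly :: "('a::complex_hilbert_space \<Rightarrow> 'a) \<Rightarrow> real \<Rightarrow> ('a \<Rightarrow> 'a) \<Rightarrow> bool"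
  for B where
  zero: "nonneg_poly B 0 (\<lambda>x. 0)"
| base: "nonneg_poly B 1 B"
| add: "nonneg_poly B a S \<Longrightarrow> nonneg_poly B b T \<Longrightarrow> nonneg_poly B (a + b) (\<lambda>x. S x + T x)"
| comp: "nonneg_poly B a S \<Longrightarrow> nonneg_poly B b T \<Longrightarrow> nonneg_poly B (a * b) (\<lambda>x. S (T x))"
| scale: "nonneg_poly B a S \<Longrightarrow> 0 \<le> r \<Longrightarrow> nonneg_poly B (r * a) (\<lambda>x. r *\<^sub>R S x)"

lemma nonneg_poly_clinear: "nonneg_poly B a T \<Longrightarrow> clinear B \<Longrightarrow> clinear T"
  by (induction rule: nonneg_poly.induct)
     (simp_all add: clinear_iff scaleC_add_right scaleR_add_right scaleC_scaleR algebra_simps)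

lemma nonneg_poly_norm:
  assumes "nonneg_poly B a T" and "\<And>x. norm (B x) \<le> norm x"
  shows "0 \<le> a" "norm (T x) \<le> a * norm x"
proof -
  have "0 \<le> a \<and> (\<forall>x. norm (T x) \<le> a * norm x)"
    using assms(1)
  proof (induction rule: nonneg_poly.induct)
    case (add a S b T)
    then show ?case by (auto simp: distrib_right intro: order_trans[OF norm_triangle_ineq add_mono])
  next
    case (comp a S b T)
    then have "norm (S (T x)) \<le> a * (b * norm x)" for x
      by (meson mult_left_mono order_trans)
    then show ?case using comp by (simp add: mult_ac)
  next
    case (scale a S r)
    then show ?case by (auto simp: mult.assoc intro: mult_left_mono)
  qed (use assms(2) in auto)
  then show "0 \<le> a" "norm (T x) \<le> a * norm x" by auto
qed

lemma nonneg_poly_commute: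
  assumes "nonneg_poly B a T" and C: "clinear C" and CB: "\<And>x. C (B x) = B (C x)"
  shows "C (T x) = T (C x)"
proof -
  from assms(1) have "\<forall>x. C (T x) = T (C x)"
    by (induction rule: nonneg_poly.induct) (simp_all add: CB clinearD[OF C])
  then show ?thesis by simp
qed

lemma nonneg_poly_sym:
  assumes "nonneg_poly B a T" and B: "clinear B" and sym: "\<And>x y. cinner x (B y) = cinner (B x) y"
  shows "cinner x (T y) = cinner (T x) y"
proof -
  from assms(1) have "\<forall>x y. cinner x (T y) = cinner (T x) y"
  proof (induction rule: nonneg_poly.induct)
    case (comp a S b T)
    \<comment> \<open>A product of symmetric operators is symmetric only when they commute, as two
      polynomials in \<open>B\<close> do.\<close>
    have "B (S x) = S (B x)" for x by (rule nonneg_poly_commute[OF comp.hyps(1) B]) simp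
    then have "S (T x) = T (S x)" for x
      by (intro nonneg_poly_commute[OF comp.hyps(2) nonneg_poly_clinear[OF comp.hyps(1) B]]) simp
    then show ?case using comp by simp
  qed (simp_all add: sym cinner_add_left cinner_add_right cinner_scaleR_left cinner_scaleR_right)
  then show ?thesis by simp
qed

text \<open>\<open>sqrt_iter B n\<close> increases to a solution \<open>R\<close> of \<open>R = (B + R\<^sup>2) / 2\<close>, so that
  \<open>(1 - R)\<^sup>2 = 1 - B\<close>; \<open>sqrt_iter_val\<close> is the same iteration for \<open>B = 1\<close>.\<close>

fun sqrt_iter :: "('a::real_vector \<Rightarrow> 'a) \<Rightarrow> nat \<Rightarrow> 'a \<Rightarrow> 'a" where
  "sqrt_iter B 0 x = 0"
| "sqrt_iter B (Suc n) x = (1/2) *\<^sub>R (B x + sqrt_iter B n (sqrt_iter B n x))"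

fun sqrt_iter_val :: "nat \<Rightarrow> real" where
  "sqrt_iter_val 0 = 0"
| "sqrt_iter_val (Suc n) = (1/2) * (1 + sqrt_iter_val n * sqrt_iter_val n)"

lemma nonneg_poly_sqrt_iter: "nonneg_poly B (sqrt_iter_val n) (sqrt_iter B n)"
proof (induction n)
  case 0
  then show ?case using nonneg_poly.zero by (simp add: fun_eq_iff[symmetric] eta_contract_eq)
next
  case (Suc n)
  have "nonneg_poly B (1/2 * (1 + sqrt_iter_val n * sqrt_iter_val n))
     (\<lambda>x. (1/2) *\<^sub>R (B x + sqrt_iter B n (sqrt_iter B n x)))"
    by (intro nonneg_poly.intros Suc) auto
  then show ?case by simp
qed

text \<open>Monotonicity at the level of coefficients. The iterates commute, so each increment is
  half the product of the previous increment and the sum of two consecutive iterates, and both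
  factors have nonnegative coefficients.\<close>

lemma nonneg_poly_sqrt_iter_Suc_diff:
  assumes B: "clinear B"
  shows "nonneg_poly B (sqrt_iter_val (Suc n) - sqrt_iter_val n) (\<lambda>x. sqrt_iter B (Suc n) x - sqrt_iter B n x)"
proof (induction n)
  case 0
  have "nonneg_poly B (1/2 * 1) (\<lambda>x. (1/2) *\<^sub>R B x)" by (intro nonneg_poly.intros) auto
  then show ?case by simp
next
  case (Suc n)
  let ?R = "sqrt_iter B" and ?r = sqrt_iter_val
  have lin: "clinear (?R n)" for n using nonneg_poly_sqrt_iter B by (rule nonneg_poly_clinear)
  have com: "?R n (?R m x) = ?R m (?R n x)" for n m x
    by (rule nonneg_poly_commute[OF nonneg_poly_sqrt_iter lin])
       (rule nonneg_poly_commute[OF nonneg_poly_sqrt_iter B, symmetric], simp)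
  have "nonneg_poly B (1/2 * ((?r (Suc n) - ?r n) * (?r (Suc n) + ?r n)))
     (\<lambda>x. (1/2) *\<^sub>R (\<lambda>x. ?R (Suc n) x - ?R n x) (?R (Suc n) x + ?R n x))"
    by (intro nonneg_poly.add nonneg_poly.scale nonneg_poly.comp[of B _ "\<lambda>x. ?R (Suc n) x - ?R n x"]
       Suc nonneg_poly_sqrt_iter) auto
  also have "1/2 * ((?r (Suc n) - ?r n) * (?r (Suc n) + ?r n)) = ?r (Suc (Suc n)) - ?r (Suc n)"
  proof -
    have "1/2 * ((a - b) * (a + b)) = 1/2 * (1 + a * a) - 1/2 * (1 + b * b)" for a b :: real
      by (simp add: algebra_simps)
    from this[of "?r (Suc n)" "?r n"] show ?thesis by (simp only: sqrt_iter_val.simps)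
  qed
  also have "(\<lambda>x. (1/2) *\<^sub>R (\<lambda>x. ?R (Suc n) x - ?R n x) (?R (Suc n) x + ?R n x))
      = (\<lambda>x. ?R (Suc (Suc n)) x - ?R (Suc n) x)"
  proof
    fix x
    have "?R (Suc (Suc n)) x - ?R (Suc n) x
        = (1/2) *\<^sub>R (B x + ?R (Suc n) (?R (Suc n) x)) - (1/2) *\<^sub>R (B x + ?R n (?R n x))"
      by (simp only: sqrt_iter.simps)
    also have "\<dots> = (1/2) *\<^sub>R (?R (Suc n) (?R (Suc n) x) - ?R n (?R n x))"
      by (simp only: scaleR_diff_right[symmetric]) simp
    also have "\<dots> = (1/2) *\<^sub>R (\<lambda>x. ?R (Suc n) x - ?R n x) (?R (Suc n) x + ?R n x)"
      by (simp only: clinearD[OF lin] com[of n "Suc n"]) (simp del: sqrt_iter.simps)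
    finally show "(1/2) *\<^sub>R (\<lambda>x. ?R (Suc n) x - ?R n x) (?R (Suc n) x + ?R n x)
        = ?R (Suc (Suc n)) x - ?R (Suc n) x" by (rule sym)
  qed
  finally show ?case .
qed

lemma nonneg_poly_sqrt_iter_diff:
  assumes B: "clinear B" and "m \<le> n"
  shows "nonneg_poly B (sqrt_iter_val n - sqrt_iter_val m) (\<lambda>x. sqrt_iter B n x - sqrt_iter B m x)"
  using assms(2)
proof (induction n rule: dec_induct)
  case base
  show ?case using nonneg_poly.zero by simp
next
  case (step n)
  from nonneg_poly.add[OF nonneg_poly_sqrt_iter_Suc_diff[OF B, of n] step.IH] show ?case
    by (simp del: sqrt_iter.simps sqrt_iter_val.simps)
qed

lemma Cauchy_sqrt_iter_val: "Cauchy sqrt_iter_val" and sqrt_iter_val_le_1: "sqrt_iter_val n \<le> 1"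
proof -
  have b: "0 \<le> sqrt_iter_val n \<and> sqrt_iter_val n \<le> 1" for n
    by (induction n) (auto simp: mult_le_one)
  then show "sqrt_iter_val n \<le> 1" by simp
  have "incseq sqrt_iter_val"
  proof (rule incseq_SucI)
    fix n
    have "0 \<le> (sqrt_iter_val n - 1)\<^sup>2" by simp
    then show "sqrt_iter_val n \<le> sqrt_iter_val (Suc n)" by (simp add: power2_eq_square algebra_simps)
  qed
  then show "Cauchy sqrt_iter_val"
    using incseq_convergent[of sqrt_iter_val 1] b by (metis LIMSEQ_imp_Cauchy)
qed

lemma contraction_sqrt_limit:
  assumes B: "clinear B" "\<And>x. norm (B x) \<le> norm x" and sym: "\<And>x y. cinner x (B y) = cinner (B x) y"
  obtains R where "clinear R" "\<forall>x. norm (R x) \<le> norm x" "\<forall>x y. cinner x (R y) = cinner (R x) y"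
    "\<forall>x. 2 *\<^sub>R R x = B x + R (R x)"
    "\<forall>C. clinear C \<longrightarrow> bounded_linear C \<longrightarrow> (\<forall>x. C (B x) = B (C x)) \<longrightarrow> (\<forall>x. C (R x) = R (C x))"
proof -
  let ?R = "sqrt_iter B"
  note np = nonneg_poly_sqrt_iter[of B]
  have lin: "clinear (?R n)" for n using np B(1) by (rule nonneg_poly_clinear)
  have bd: "norm (?R n x) \<le> norm x" for n x
    using nonneg_poly_norm(2)[OF np B(2)] sqrt_iter_val_le_1[of n]
    by (meson mult_left_le_one_le norm_ge_zero nonneg_poly_norm(1)[OF np B(2)] order_trans)
  \<comment> \<open>The operator iteration is dominated by the scalar one: differences of iterates
    have nonnegative coefficients whose sum is the scalar difference. Convergence of the scalar
    sequence thus gives convergence of the operators.\<close>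
  have diff: "norm (?R n x - ?R m x) \<le> \<bar>sqrt_iter_val n - sqrt_iter_val m\<bar> * norm x" for n m x
  proof (induction n m rule: linorder_wlog)
    case (le m n)
    have "norm (?R n x - ?R m x) \<le> (sqrt_iter_val n - sqrt_iter_val m) * norm x"
      using nonneg_poly_norm(2)[OF nonneg_poly_sqrt_iter_diff[OF B(1) le] B(2)] .
    then show ?case
      by (metis abs_ge_self abs_minus_commute mult_right_mono norm_ge_zero norm_minus_commute order_trans)
  qed (simp add: norm_minus_commute abs_minus_commute)
  have "Cauchy (\<lambda>n. ?R n x)" for x
  proof (rule CauchyI)
    fix e :: real assume "0 < e"
    then have "0 < e / (norm x + 1)" by (simp add: add_nonneg_pos)
    then obtain M where M: "\<And>m n. m \<ge> M \<Longrightarrow> n \<ge> M \<Longrightarrow> \<bar>sqrt_iter_val m - sqrt_iter_val n\<bar> < e / (norm x + 1)"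
      using Cauchy_sqrt_iter_val unfolding Cauchy_iff by (metis real_norm_def)
    have "norm (?R m x - ?R n x) < e" if "m \<ge> M" "n \<ge> M" for m n
    proof -
      have "norm (?R m x - ?R n x) \<le> \<bar>sqrt_iter_val m - sqrt_iter_val n\<bar> * norm x" by (rule diff)
      also have "\<dots> \<le> \<bar>sqrt_iter_val m - sqrt_iter_val n\<bar> * (norm x + 1)" by (rule mult_left_mono) auto
      also have "\<dots> < e" using M[OF that] by (simp add: pos_less_divide_eq add_nonneg_pos)
      finally show ?thesis .
    qed
    then show "\<exists>M. \<forall>m\<ge>M. \<forall>n\<ge>M. norm (?R m x - ?R n x) < e" by blast
  qed
  then have "\<exists>y. (\<lambda>n. ?R n x) \<longlonglongrightarrow> y" for x using Cauchy_convergent convergent_def by blast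
  then obtain R where R: "\<And>x. (\<lambda>n. ?R n x) \<longlonglongrightarrow> R x" by metis
  show thesis
  proof
    show "clinear R" unfolding clinear_iff
    proof (intro conjI allI)
      fix x y c
      have "(\<lambda>n. ?R n (x + y)) \<longlonglongrightarrow> R x + R y"
        unfolding clinearD[OF lin] by (intro tendsto_intros R)
      then show "R (x + y) = R x + R y" by (rule LIMSEQ_unique[OF R])
      have "(\<lambda>n. ?R n (c *\<^sub>C x)) \<longlonglongrightarrow> c *\<^sub>C R x"
        unfolding clinearD[OF lin] by (intro tendsto_scaleC_right R)
      then show "R (c *\<^sub>C x) = c *\<^sub>C R x" by (rule LIMSEQ_unique[OF R])
    qed
    show "\<forall>x. norm (R x) \<le> norm x"
      by (rule allI, rule LIMSEQ_le_const2[OF tendsto_norm[OF R]]) (use bd in auto)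
    show "\<forall>x y. cinner x (R y) = cinner (R x) y"
    proof (intro allI, rule LIMSEQ_unique)
      fix x y
      show "(\<lambda>n. cinner x (?R n y)) \<longlonglongrightarrow> cinner x (R y)" by (intro tendsto_cinner_right R)
      show "(\<lambda>n. cinner x (?R n y)) \<longlonglongrightarrow> cinner (R x) y"
        unfolding nonneg_poly_sym[OF np B(1) sym] by (intro tendsto_cinner_left R)
    qed
    show "\<forall>x. 2 *\<^sub>R R x = B x + R (R x)"
    proof
      fix x
      \<comment> \<open>Both the operator and its argument vary. As every iterate is a contraction,
        the argument may be replaced by its limit \<open>R x\<close>.\<close>
      have "(\<lambda>n. ?R n (?R n x)) \<longlonglongrightarrow> R (R x)"
      proof -
        have "(\<lambda>n. norm (?R n x - R x)) \<longlonglongrightarrow> 0"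
          using R[of x] by (simp add: LIM_zero tendsto_norm_zero)
        then have "(\<lambda>n. ?R n (?R n x - R x)) \<longlonglongrightarrow> 0"
          by (rule Lim_null_comparison[rotated]) (use bd in auto)
        from tendsto_add[OF this R[of "R x"]] show ?thesis by (simp add: clinearD[OF lin])
      qed
      then have "(\<lambda>n. (1/2) *\<^sub>R (B x + ?R n (?R n x))) \<longlonglongrightarrow> (1/2) *\<^sub>R (B x + R (R x))"
        by (intro tendsto_intros)
      then have "(\<lambda>n. ?R (Suc n) x) \<longlonglongrightarrow> (1/2) *\<^sub>R (B x + R (R x))" by simp
      then have "R x = (1/2) *\<^sub>R (B x + R (R x))"
        by (rule LIMSEQ_unique[OF LIMSEQ_Suc[OF R]])
      then have "2 *\<^sub>R R x = 2 *\<^sub>R (1/2) *\<^sub>R (B x + R (R x))" by (rule arg_cong)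
      then show "2 *\<^sub>R R x = B x + R (R x)" by simp
    qed
    show "\<forall>C. clinear C \<longrightarrow> bounded_linear C \<longrightarrow> (\<forall>x. C (B x) = B (C x)) \<longrightarrow> (\<forall>x. C (R x) = R (C x))"
    proof (intro allI impI, rule LIMSEQ_unique)
      fix C x assume C: "clinear C" "bounded_linear C" "\<forall>x. C (B x) = B (C x)"
      note C = C(1,2) C(3)[rule_format]
      show "(\<lambda>n. C (?R n x)) \<longlonglongrightarrow> C (R x)" by (intro bounded_linear.tendsto[OF C(2)] R)
      show "(\<lambda>n. C (?R n x)) \<longlonglongrightarrow> R (C x)"
        unfolding nonneg_poly_commute[OF np C(1,3)] by (rule R)
    qed
  qed
qed

text \<open>The commutation clause prepares uniqueness: any other root of \<open>P\<close> commutes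
  with \<open>P\<close>, hence with the \<open>S\<close> found here.\<close>

lemma positive_operator_sqrt_exists:
  assumes P: "positive_operator P"
  obtains S where "positive_operator S" "\<forall>x. S (S x) = P x"
    "\<forall>C. clinear C \<longrightarrow> bounded_linear C \<longrightarrow> (\<forall>x. C (P x) = P (C x)) \<longrightarrow> (\<forall>x. C (S x) = S (C x))"
proof -
  have lin: "clinear P" and "bounded_linear P" using P by (auto simp: positive_operator_def)
  then obtain c where c: "0 < c" "\<And>x. norm (P x) \<le> norm x * c"
    using bounded_linear.pos_bounded by blast
  note sym = positive_operator_sym[OF P] and inn = positive_operator_inner[OF P]
  \<comment> \<open>As \<open>c\<close> bounds \<open>P\<close>, the operator \<open>B\<close> lies
    between 0 and 1, and \<open>P = c (1 - B)\<close> has the root \<open>sqrt c (1 - R)\<close>,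
    where \<open>R\<close> is the limit of the iteration for \<open>B\<close>.\<close>
  define B where "B x = x - (1 / c) *\<^sub>R P x" for x
  have Blin: "clinear B" using lin
    by (simp add: B_def clinear_iff scaleC_diff_right scaleC_scaleR algebra_simps)
  have Bsym: "cinner x (B y) = cinner (B x) y" for x y
    by (simp add: B_def cinner_diff_left cinner_diff_right cinner_scaleR_left cinner_scaleR_right sym)
  have Bpos: "0 \<le> inner x (B x)" for x
  proof -
    have "inner x (P x) \<le> norm x * norm (P x)" by (rule norm_cauchy_schwarz)
    also have "\<dots> \<le> norm x * (norm x * c)" by (intro mult_left_mono c) auto
    finally show ?thesis using c
      by (simp add: B_def inner_diff_right power2_norm_eq_inner[symmetric] power2_eq_square field_simps)
  qed
  have Ble: "inner x (B x) \<le> (norm x)\<^sup>2" for x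
    using inn(2)[of x] c by (simp add: B_def inner_diff_right power2_norm_eq_inner)
  \<comment> \<open>Cauchy-Schwarz for the form of \<open>B\<close>, applied to \<open>B x\<close>
    and \<open>x\<close>, turns the bound on the quadratic form into a bound on the norm.\<close>
  have Bnorm: "norm (B x) \<le> norm x" for x
  proof -
    have "((norm (B x))\<^sup>2)\<^sup>2 = (inner (B x) (B x))\<^sup>2" by (simp add: power2_norm_eq_inner)
    also have "\<dots> \<le> inner (B x) (B (B x)) * inner x (B x)"
      by (rule positive_form_cauchy_schwarz)
         (use Bsym Bpos Blin in \<open>auto simp: inner_eq_Re_cinner clinearD intro!: linearI\<close>)
    also have "\<dots> \<le> (norm (B x))\<^sup>2 * (norm x)\<^sup>2"
      by (intro mult_mono Ble Bpos) auto
    finally have "(norm (B x))\<^sup>2 * (norm (B x))\<^sup>2 \<le> (norm (B x))\<^sup>2 * (norm x)\<^sup>2"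
      by (simp add: power2_eq_square)
    then have "(norm (B x))\<^sup>2 \<le> (norm x)\<^sup>2" if "B x \<noteq> 0"
      using that by (subst (asm) mult_le_cancel_left_pos) auto
    then show ?thesis by (cases "B x = 0") (auto dest: power2_le_imp_le)
  qed
  obtain R where R: "clinear R" "\<forall>x. norm (R x) \<le> norm x" "\<forall>x y. cinner x (R y) = cinner (R x) y"
    "\<forall>x. 2 *\<^sub>R R x = B x + R (R x)"
    "\<forall>C. clinear C \<longrightarrow> bounded_linear C \<longrightarrow> (\<forall>x. C (B x) = B (C x)) \<longrightarrow> (\<forall>x. C (R x) = R (C x))"
    by (rule contraction_sqrt_limit[OF Blin Bnorm Bsym])
  note R = R[rule_format]
  define S where "S x = sqrt c *\<^sub>R (x - R x)" for x
  show thesis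
  proof
    have Slin: "clinear S" using R(1)
      by (simp add: S_def clinear_iff scaleC_diff_right scaleC_scaleR algebra_simps)
    have "norm (S x) \<le> sqrt c * 2 * norm x" for x
      using c norm_triangle_ineq4[of x "R x"] R(2)[of x] by (simp add: S_def)
    then have "bounded_linear S" by (rule clinear_bounded_linear[OF Slin])
    moreover have "cinner x (S x) \<in> \<real>\<^sub>\<ge>\<^sub>0" for x
    proof -
      have "cinner x (R x) = cnj (cinner x (R x))" by (metis R(3) cinner_commute)
      then have "Im (cinner x (R x)) = 0" by (simp add: complex_eq_iff)
      moreover have "Re (cinner x (R x)) \<le> (norm x)\<^sup>2"
      proof -
        have "Re (cinner x (R x)) \<le> norm x * norm (R x)"
          unfolding inner_eq_Re_cinner[symmetric] by (rule norm_cauchy_schwarz)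
        also have "\<dots> \<le> norm x * norm x" by (intro mult_left_mono R) auto
        finally show ?thesis by (simp add: power2_eq_square)
      qed
      ultimately show ?thesis using c
        by (simp add: S_def cinner_scaleR_right cinner_diff_right cinner_self complex_nonneg_Reals_iff del: of_real_power)
    qed
    ultimately show "positive_operator S" using Slin by (simp add: positive_operator_def)
    show "\<forall>x. S (S x) = P x"
    proof
      fix x
      have "S (S x) = c *\<^sub>R ((x - R x) - R (x - R x))"
        using c by (simp add: S_def clinearD[OF R(1)] flip: scaleR_diff_right)
      also have "(x - R x) - R (x - R x) = x - (2 *\<^sub>R R x - R (R x))"
        by (simp add: clinearD[OF R(1)] scaleR_2)
      also have "\<dots> = (1 / c) *\<^sub>R P x" by (simp add: R(4) B_def)
      finally show "S (S x) = P x" using c by simp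
    qed
    show "\<forall>C. clinear C \<longrightarrow> bounded_linear C \<longrightarrow> (\<forall>x. C (P x) = P (C x)) \<longrightarrow> (\<forall>x. C (S x) = S (C x))"
      using R(5) by (auto simp: S_def B_def clinearD)
  qed
qed

theorem sqrt_operator:
  assumes P: "positive_operator P"
  shows "positive_operator (sqrt_operator P)" "sqrt_operator P \<circ> sqrt_operator P = P"
proof -
  obtain S where S: "positive_operator S" "\<forall>x. S (S x) = P x"
    and com: "\<forall>C. clinear C \<longrightarrow> bounded_linear C \<longrightarrow> (\<forall>x. C (P x) = P (C x)) \<longrightarrow> (\<forall>x. C (S x) = S (C x))"
    by (rule positive_operator_sqrt_exists[OF P])
  note S = S[rule_format] and com = com[rule_format]
  have "positive_operator (sqrt_operator P) \<and> sqrt_operator P \<circ> sqrt_operator P = P"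
    unfolding sqrt_operator_def
  proof (rule theI[where P = "\<lambda>S. positive_operator S \<and> S \<circ> S = P"])
    show "positive_operator S \<and> S \<circ> S = P" using S by auto
  next
    fix T assume "positive_operator T \<and> T \<circ> T = P"
    then have T: "positive_operator T" and TP: "\<And>x. T (T x) = P x" by auto
    have Tlin: "clinear T" "bounded_linear T" and Slin: "clinear S"
      using T S by (auto simp: positive_operator_def)
    \<comment> \<open>\<open>T\<close> commutes with its square \<open>P\<close>, hence with
      \<open>S\<close>, so \<open>(S + T) (S - T) = 0\<close>. For \<open>y = (S - T) x\<close>
      positivity makes both \<open>S y\<close> and \<open>T y\<close> vanish, and by symmetry
      \<open><y, y> = <y, S x - T x> = 0\<close>.\<close>
    have "T (S x) = S (T x)" for x by (rule com[OF Tlin]) (simp only: TP[symmetric])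
    then have eq: "S (S x - T x) + T (S x - T x) = 0" for x
      by (simp add: clinearD[OF Tlin(1)] clinearD[OF Slin] S TP)
    show "T = S"
    proof
      fix x
      define y where "y = S x - T x"
      have "inner y (S y) + inner y (T y) = 0"
        using arg_cong[OF eq[of x], of "inner y"] by (simp add: inner_add_right y_def)
      with positive_operator_inner(2)[OF S(1), of y] positive_operator_inner(2)[OF T, of y]
      have "inner y (S y) = 0" "inner y (T y) = 0" by linarith+
      then have "S y = 0" "T y = 0"
        using positive_operator_zero S(1) T by blast+
      then have "inner y (S x - T x) = 0"
        using positive_operator_inner(1)[OF S(1), of y x] positive_operator_inner(1)[OF T, of y x]
        by (simp add: inner_diff_right)
      then have "inner y y = 0" by (simp only: y_def[symmetric])
      then show "T x = S x" by (simp add: y_def)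
    qed
  qed
  then show "positive_operator (sqrt_operator P)" "sqrt_operator P \<circ> sqrt_operator P = P" by auto
qed

section \<open>Orthonormal sets, Bessel's inequality and compactness\<close>

definition corthonormal :: "'a::complex_hilbert_space set \<Rightarrow> bool" where
  "corthonormal \<Phi> \<longleftrightarrow> (\<forall>x\<in>\<Phi>. \<forall>y\<in>\<Phi>. cinner x y = of_bool (x = y))"

definition cproj :: "'a::complex_hilbert_space set \<Rightarrow> 'a \<Rightarrow> 'a" where
  "cproj \<Phi> x = (\<Sum>\<phi>\<in>\<Phi>. cinner \<phi> x *\<^sub>C \<phi>)"

lemma corthonormal_norm: "corthonormal \<Phi> \<Longrightarrow> \<phi> \<in> \<Phi> \<Longrightarrow> norm \<phi> = 1"
  using cinner_self[of \<phi>] norm_ge_zero[of \<phi>] by (auto simp: corthonormal_def power2_eq_1_iff simp del: of_real_power)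

lemma cinner_cproj:
  assumes "finite \<Phi>" "corthonormal \<Phi>" "\<phi> \<in> \<Phi>"
  shows "cinner \<phi> (cproj \<Phi> x) = cinner \<phi> x"
proof -
  have "cinner \<phi> (cproj \<Phi> x) = (\<Sum>\<psi>\<in>\<Phi>. cinner \<psi> x * cinner \<phi> \<psi>)"
    by (simp add: cproj_def cinner_sum_right cinner_scaleC_right)
  also have "\<dots> = (\<Sum>\<psi>\<in>\<Phi>. if \<phi> = \<psi> then cinner \<psi> x else 0)"
    using assms by (intro sum.cong) (auto simp: corthonormal_def)
  finally show ?thesis using assms by simp
qed

lemma cinner_cproj_orthogonal:
  assumes "finite \<Phi>" "corthonormal \<Phi>"
  shows "cinner (cproj \<Phi> y) (x - cproj \<Phi> x) = 0"
  using cinner_cproj[OF assms, of _ x]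
  by (simp add: cproj_def[of \<Phi> y] cinner_sum_left cinner_scaleC_left cinner_diff_right)

lemma norm_cproj:
  assumes "finite \<Phi>" "corthonormal \<Phi>"
  shows "(norm x)\<^sup>2 = (\<Sum>\<phi>\<in>\<Phi>. (cmod (cinner \<phi> x))\<^sup>2) + (norm (x - cproj \<Phi> x))\<^sup>2"
proof -
  let ?p = "cproj \<Phi> x"
  have 1: "cinner ?p (x - ?p) = 0" by (rule cinner_cproj_orthogonal[OF assms])
  then have 2: "cinner (x - ?p) ?p = 0" by (subst cinner_commute) simp
  have pp: "cinner ?p ?p = of_real (\<Sum>\<phi>\<in>\<Phi>. (cmod (cinner \<phi> x))\<^sup>2)"
    using cinner_cproj[OF assms, of _ x]
    by (simp add: cproj_def[of \<Phi> x, THEN arg_cong[of _ _ "\<lambda>y. cinner y _"]] cinner_sum_left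
        cinner_scaleC_left complex_norm_square mult.commute del: of_real_power)
  have "cinner x x = cinner (?p + (x - ?p)) (?p + (x - ?p))" by simp
  also have "\<dots> = cinner ?p ?p + cinner (x - ?p) (x - ?p)"
    unfolding cinner_add_left cinner_add_right 1 2 by simp
  also have "\<dots> = of_real ((\<Sum>\<phi>\<in>\<Phi>. (cmod (cinner \<phi> x))\<^sup>2) + (norm (x - ?p))\<^sup>2)"
    unfolding pp cinner_self[of "x - ?p"] by simp
  finally show ?thesis unfolding cinner_self of_real_eq_iff .
qed

lemma Bessel_inequality:
  assumes "finite \<Phi>" "corthonormal \<Phi>"
  shows "(\<Sum>\<phi>\<in>\<Phi>. (cmod (cinner \<phi> x))\<^sup>2) \<le> (norm x)\<^sup>2"
  using norm_cproj[OF assms, of x] by simp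

lemma corthonormal_insert:
  assumes "corthonormal \<Phi>" "w \<noteq> 0" "\<And>\<phi>. \<phi> \<in> \<Phi> \<Longrightarrow> cinner \<phi> w = 0"
  defines "e \<equiv> (1 / norm w) *\<^sub>R w"
  shows "corthonormal (insert e \<Phi>)" "e \<notin> \<Phi>"
proof -
  have 0: "cinner \<phi> e = 0" "cinner e \<phi> = 0" if "\<phi> \<in> \<Phi>" for \<phi>
  proof -
    show *: "cinner \<phi> e = 0" using assms(3)[OF that] by (simp add: e_def cinner_scaleR_right)
    show "cinner e \<phi> = 0" by (subst cinner_commute) (simp add: *)
  qed
  have 1: "cinner e e = 1" unfolding cinner_self using assms(2) by (simp add: e_def)
  show "e \<notin> \<Phi>" using 0 1 by force
  then show "corthonormal (insert e \<Phi>)" using assms(1) 0 1 by (auto simp: corthonormal_def)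
qed

text \<open>Gram-Schmidt without an enumeration of \<open>B\<close>: while \<open>\<Phi>\<close> has
  fewer elements than \<open>B\<close>, the exchange lemma yields a vector of \<open>B\<close>
  outside the span of \<open>\<Phi>\<close>, and its component orthogonal to \<open>\<Phi>\<close>
  is normalised and added.\<close>

lemma corthonormal_exists:
  assumes V: "complex_vector.subspace V" and B: "B \<subseteq> V" "finite B" "\<not> complex_vector.dependent B"
    and "n \<le> card B"
  shows "\<exists>\<Phi>. \<Phi> \<subseteq> V \<and> finite \<Phi> \<and> corthonormal \<Phi> \<and> card \<Phi> = n"
  using assms(5)
proof (induction n)
  case 0
  show ?case by (rule exI[of _ "{}"]) (simp add: corthonormal_def)
next
  case (Suc n)
  then obtain \<Phi> where \<Phi>: "\<Phi> \<subseteq> V" "finite \<Phi>" "corthonormal \<Phi>" "card \<Phi> = n" by auto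
  have "\<not> B \<subseteq> complex_vector.span \<Phi>"
    using complex_vector.independent_span_bound[OF \<Phi>(2) B(3)] \<Phi>(4) Suc.prems by auto
  then obtain v where v: "v \<in> B" "v \<notin> complex_vector.span \<Phi>" by auto
  define w where "w = v - cproj \<Phi> v"
  have span: "cproj \<Phi> v \<in> complex_vector.span \<Phi>"
    unfolding cproj_def
    by (intro complex_vector.span_sum complex_vector.span_scale complex_vector.span_base)
  have w0: "w \<noteq> 0" using v(2) span by (auto simp: w_def)
  have "cproj \<Phi> v \<in> V"
    using span complex_vector.span_minimal[OF \<Phi>(1) V] by auto
  then have "w \<in> V" unfolding w_def using v(1) B(1) V by (intro complex_vector.subspace_diff) auto
  then have e: "(1 / norm w) *\<^sub>R w \<in> V"
    using complex_vector.subspace_scale[OF V, of w "complex_of_real (1 / norm w)"]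
    by (simp only: scaleC_of_real)
  have "cinner \<phi> w = 0" if "\<phi> \<in> \<Phi>" for \<phi>
    using cinner_cproj[OF \<Phi>(2,3) that, of v] by (simp add: w_def cinner_diff_right)
  note ins = corthonormal_insert[OF \<Phi>(3) w0 this]
  show ?case
    by (rule exI[of _ "insert ((1 / norm w) *\<^sub>R w) \<Phi>"]) (use ins e \<Phi> in simp)
qed

text \<open>With \<open>v = K\<close> and \<open>\<Phi>\<close> orthonormal, this set contains the
  image of the unit ball under \<open>K \<circ> cproj \<Phi>\<close>, the finite-rank part of
  \<open>K\<close>. It is a finite Minkowski sum of images of the unit disc.\<close>

lemma compact_cproj_image: "finite \<Phi> \<Longrightarrow> compact {\<Sum>\<phi>\<in>\<Phi>. c \<phi> *\<^sub>C v \<phi> |c. \<forall>\<phi>\<in>\<Phi>. cmod (c \<phi>) \<le> 1}"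
proof (induction \<Phi> rule: finite_induct)
  case (insert \<psi> \<Phi>)
  have "{\<Sum>\<phi>\<in>insert \<psi> \<Phi>. c \<phi> *\<^sub>C v \<phi> |c. \<forall>\<phi>\<in>insert \<psi> \<Phi>. cmod (c \<phi>) \<le> 1}
      = {x + y |x y. x \<in> (\<lambda>c. c *\<^sub>C v \<psi>) ` cball 0 1 \<and> y \<in> {\<Sum>\<phi>\<in>\<Phi>. c \<phi> *\<^sub>C v \<phi> |c. \<forall>\<phi>\<in>\<Phi>. cmod (c \<phi>) \<le> 1}}"
    (is "?L = ?R")
  proof (intro equalityI subsetI)
    fix z assume "z \<in> ?L"
    then obtain c where c: "\<forall>\<phi>\<in>insert \<psi> \<Phi>. cmod (c \<phi>) \<le> 1"
      and z: "z = (\<Sum>\<phi>\<in>insert \<psi> \<Phi>. c \<phi> *\<^sub>C v \<phi>)" by auto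
    show "z \<in> ?R"
      by (intro CollectI exI[of _ "c \<psi> *\<^sub>C v \<psi>"] exI[of _ "\<Sum>\<phi>\<in>\<Phi>. c \<phi> *\<^sub>C v \<phi>"])
         (use c z insert.hyps in auto)
  next
    fix z assume "z \<in> ?R"
    then obtain a c where a: "cmod a \<le> 1" and c: "\<forall>\<phi>\<in>\<Phi>. cmod (c \<phi>) \<le> 1"
      and z: "z = a *\<^sub>C v \<psi> + (\<Sum>\<phi>\<in>\<Phi>. c \<phi> *\<^sub>C v \<phi>)" by auto
    have "(\<Sum>\<phi>\<in>\<Phi>. c \<phi> *\<^sub>C v \<phi>) = (\<Sum>\<phi>\<in>\<Phi>. (c(\<psi> := a)) \<phi> *\<^sub>C v \<phi>)"
      using insert.hyps by (intro sum.cong) auto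
    then show "z \<in> ?L"
      using a c z insert.hyps by (intro CollectI exI[of _ "c(\<psi> := a)"]) auto
  qed
  also have "compact \<dots>"
    by (intro compact_sums insert.IH compact_continuous_image compact_cball linear_continuous_on
        bounded_linear_scaleC_left)
  finally show ?case .
qed simp

text \<open>If \<open>\<Phi>\<close> is a maximal orthonormal set on which \<open>norm (K \<phi>) > \<kappa>\<close>, then \<open>K\<close> has norm at most \<open>\<kappa>\<close>
  on the orthogonal complement of \<open>\<Phi>\<close>.\<close>

lemma compact_operatorI:
  assumes K: "clinear K"
    and bnd: "\<And>\<kappa>. \<kappa> > 0 \<Longrightarrow>
      \<exists>N. \<forall>\<Phi>. finite \<Phi> \<and> corthonormal \<Phi> \<and> (\<forall>\<phi>\<in>\<Phi>. \<kappa> < norm (K \<phi>)) \<longrightarrow> card \<Phi> \<le> N"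
  shows "compact_operator K"
proof -
  have "\<exists>F. finite F \<and> closure (K ` cball 0 1) \<subseteq> (\<Union>x\<in>F. ball x e)" if "0 < e" for e
  proof -
    \<comment> \<open>Two errors of size \<open>\<kappa>\<close> occur, one from the part orthogonal
      to \<open>\<Phi>\<close> and one from the finite net. That \<open>2 * \<kappa>\<close> is
      strictly below \<open>e\<close> leaves room to pass to the closure through closed
      balls.\<close>
    define \<kappa> where "\<kappa> = e / 4"
    have \<kappa>: "0 < \<kappa>" using that by (simp add: \<kappa>_def)
    define Q where "Q \<Phi> \<longleftrightarrow> finite \<Phi> \<and> corthonormal \<Phi> \<and> (\<forall>\<phi>\<in>\<Phi>. \<kappa> < norm (K \<phi>))" for \<Phi>
    obtain N where N: "\<forall>\<Phi>. Q \<Phi> \<longrightarrow> card \<Phi> \<le> N" using bnd[OF \<kappa>] by (auto simp: Q_def)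
    have "Q {}" by (simp add: Q_def corthonormal_def)
    then obtain \<Phi> where \<Phi>: "Q \<Phi>" and max: "\<And>\<Psi>. Q \<Psi> \<Longrightarrow> card \<Psi> \<le> card \<Phi>"
      using ex_has_greatest_nat[of Q "{}" card "Suc N"] N by (auto simp: less_Suc_eq_le)
    have fin: "finite \<Phi>" "corthonormal \<Phi>" using \<Phi> by (auto simp: Q_def)
    have small: "norm (K (x - cproj \<Phi> x)) \<le> \<kappa>" if x: "norm x \<le> 1" for x
    proof (cases "x - cproj \<Phi> x = 0")
      case True
      then show ?thesis using \<kappa> clinearD(5)[OF K] by simp
    next
      case False
      define w where "w = x - cproj \<Phi> x"
      define u where "u = (1 / norm w) *\<^sub>R w"
      have "cinner \<phi> w = 0" if "\<phi> \<in> \<Phi>" for \<phi>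
        using cinner_cproj[OF fin that, of x] by (simp add: w_def cinner_diff_right)
      from corthonormal_insert[OF fin(2) False[folded w_def] this, folded u_def]
      have ins: "corthonormal (insert u \<Phi>)" "u \<notin> \<Phi>" by simp_all
      have "norm (K u) \<le> \<kappa>"
      proof (rule ccontr)
        assume "\<not> norm (K u) \<le> \<kappa>"
        then have "Q (insert u \<Phi>)" using \<Phi> ins by (auto simp: Q_def)
        from max[OF this] show False using fin ins by simp
      qed
      moreover have "K u = (1 / norm w) *\<^sub>R K w" by (simp add: u_def clinearD(3)[OF K])
      moreover have "0 < norm w" using False by (simp add: w_def)
      moreover have "(norm w)\<^sup>2 \<le> (norm x)\<^sup>2"
        using norm_cproj[OF fin, of x] by (simp add: w_def sum_nonneg)
      then have "norm w \<le> 1" using x by (meson norm_ge_zero order_trans power2_le_imp_le)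
      ultimately have "norm (K w) \<le> \<kappa> * norm w" by (simp add: divide_simps mult.commute)
      also have "\<dots> \<le> \<kappa>" using \<open>norm w \<le> 1\<close> \<kappa> by (simp add: mult_left_le)
      finally show ?thesis by (simp add: w_def)
    qed
    let ?C = "{\<Sum>\<phi>\<in>\<Phi>. c \<phi> *\<^sub>C K \<phi> |c. \<forall>\<phi>\<in>\<Phi>. cmod (c \<phi>) \<le> 1}"
    have "compact ?C" by (rule compact_cproj_image[OF fin(1)])
    then obtain F where F: "finite F" "?C \<subseteq> (\<Union>x\<in>F. ball x \<kappa>)"
      using \<kappa> unfolding compact_eq_totally_bounded by blast
    have "K ` cball 0 1 \<subseteq> (\<Union>x\<in>F. cball x (2 * \<kappa>))"
    proof
      fix y assume "y \<in> K ` cball 0 1"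
      then obtain x where x: "norm x \<le> 1" "y = K x" by auto
      have le1: "cmod (cinner \<phi> x) \<le> 1" if "\<phi> \<in> \<Phi>" for \<phi>
        using cinner_cauchy_schwarz[of \<phi> x] corthonormal_norm[OF fin(2) that] x(1) by simp
      have "K (cproj \<Phi> x) = (\<Sum>\<phi>\<in>\<Phi>. cinner \<phi> x *\<^sub>C K \<phi>)"
        by (simp add: cproj_def clinearD[OF K])
      then have "K (cproj \<Phi> x) \<in> ?C" using le1 by auto
      then obtain z where z: "z \<in> F" "dist z (K (cproj \<Phi> x)) < \<kappa>" using F by auto
      have "dist (K (cproj \<Phi> x)) y \<le> \<kappa>"
        using small[OF x(1)] by (simp add: x(2) dist_norm norm_minus_commute clinearD[OF K])
      then have "dist z y \<le> 2 * \<kappa>"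
        using z(2) dist_triangle[of z y "K (cproj \<Phi> x)"] by simp
      then show "y \<in> (\<Union>x\<in>F. cball x (2 * \<kappa>))" using z(1) by auto
    qed
    then have "closure (K ` cball 0 1) \<subseteq> (\<Union>x\<in>F. cball x (2 * \<kappa>))"
      by (rule closure_minimal) (auto intro: F(1))
    also have "\<dots> \<subseteq> (\<Union>x\<in>F. ball x e)" using \<kappa> by (auto simp: \<kappa>_def)
    finally show ?thesis using F(1) by blast
  qed
  then have "compact (closure (K ` cball 0 1))"
    unfolding compact_eq_totally_bounded by (auto simp: complete_eq_closed)
  then show ?thesis using K by (simp add: compact_operator_def)
qed

section \<open>Counting the eigenvalues of the absolute value\<close>

lemma ecdim_attained:
  assumes "\<And>B. B \<subseteq> V \<Longrightarrow> finite B \<Longrightarrow> \<not> complex_vector.dependent B \<Longrightarrow> card B \<le> N"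
  shows "\<exists>B. B \<subseteq> V \<and> finite B \<and> \<not> complex_vector.dependent B \<and> ecdim V = of_nat (card B)"
proof -
  let ?Q = "\<lambda>B. B \<subseteq> V \<and> finite B \<and> \<not> complex_vector.dependent B"
  have "?Q {}" by (simp add: complex_vector.dependent_def)
  then obtain B where B: "?Q B" and max: "\<And>D. ?Q D \<Longrightarrow> card D \<le> card B"
    using ex_has_greatest_nat[of ?Q "{}" card "Suc N"] assms by (auto simp: less_Suc_eq_le)
  have "ecdim V = of_nat (card B)"
    unfolding ecdim_def
  proof (rule antisym)
    show "(SUP B\<in>{B. ?Q B}. of_nat (card B)) \<le> (of_nat (card B) :: ennreal)"
      by (rule SUP_least) (use max in auto)
    show "of_nat (card B) \<le> (SUP B\<in>{B. ?Q B}. of_nat (card B) :: ennreal)"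
      by (rule SUP_upper) (use B in auto)
  qed
  then show ?thesis using B by blast
qed

text \<open>On an eigenvector of |K| for the eigenvalue \<open>l > 0\<close>, \<open>K\<close>
  stretches the norm exactly by \<open>l\<close>, and different eigenspaces are orthogonal.
  Orthonormal sets chosen in finitely many eigenspaces above \<open>\<kappa>\<close> therefore unite
  to a set covered by the hypothesis.\<close>

theorem weak_schatten_criterion:
  assumes K: "clinear K" "bounded_linear K"
    and bnd: "\<And>\<kappa> \<Phi>. 0 < \<kappa> \<Longrightarrow> finite \<Phi> \<Longrightarrow> corthonormal \<Phi> \<Longrightarrow> (\<forall>\<phi>\<in>\<Phi>. \<kappa> < norm (K \<phi>)) \<Longrightarrow>
      \<kappa> powr q * real (card \<Phi>) \<le> C"
  shows "compact_operator K" "weak_schatten_sup q K \<le> ennreal C"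
proof -
  have card_le: "real (card \<Phi>) \<le> C / \<kappa> powr q"
    if "0 < \<kappa>" "finite \<Phi>" "corthonormal \<Phi>" "\<forall>\<phi>\<in>\<Phi>. \<kappa> < norm (K \<phi>)" for \<kappa> \<Phi>
    using bnd[OF that] that(1) by (simp add: field_simps)
  have card_le': "card \<Phi> \<le> nat \<lfloor>C / \<kappa> powr q\<rfloor>"
    if "0 < \<kappa>" "finite \<Phi>" "corthonormal \<Phi>" "\<forall>\<phi>\<in>\<Phi>. \<kappa> < norm (K \<phi>)" for \<kappa> \<Phi>
    using card_le[OF that] by (simp add: le_nat_floor)
  show "compact_operator K"
    by (rule compact_operatorI[OF K(1)]) (use card_le' in blast)
  define S where "S = abs_operator K"
  note P = positive_operator_cadjoint_comp[OF K]
  have S: "positive_operator S" and "S \<circ> S = cadjoint K \<circ> K"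
    using sqrt_operator[OF P] by (auto simp: S_def abs_operator_def)
  then have SS: "S (S x) = cadjoint K (K x)" for x by (simp add: fun_eq_iff)
  have Slin: "clinear S" using S by (simp add: positive_operator_def)
  have eig_norm: "norm (K \<phi>) = \<bar>l\<bar> * norm \<phi>" if "\<phi> \<in> eigenspace S l" for \<phi> l
  proof -
    have "complex_of_real ((norm (K \<phi>))\<^sup>2) = cinner \<phi> (S (S \<phi>))"
      by (simp only: cinner_self[symmetric] cinner_cadjoint[OF K] SS)
    also have "\<dots> = cinner (S \<phi>) (S \<phi>)" by (rule positive_operator_sym[OF S])
    also have "\<dots> = of_real ((\<bar>l\<bar> * norm \<phi>)\<^sup>2)"
      unfolding cinner_self using that by (simp add: eigenspace_def norm_scaleC)
    finally have "(norm (K \<phi>))\<^sup>2 = (\<bar>l\<bar> * norm \<phi>)\<^sup>2" unfolding of_real_eq_iff .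
    then show ?thesis by (rule power2_eq_imp_eq) auto
  qed
  have eig_orth: "cinner u v = 0" if "u \<in> eigenspace S l" "v \<in> eigenspace S l'" "l \<noteq> l'" for u v l l'
  proof -
    have "of_real l' * cinner u v = cinner u (S v)"
      using that by (simp add: eigenspace_def cinner_scaleC_right)
    also have "\<dots> = cinner (S u) v" by (rule positive_operator_sym[OF S])
    also have "\<dots> = of_real l * cinner u v"
      using that by (simp add: eigenspace_def cinner_scaleC_left)
    finally show ?thesis using that(3) by simp
  qed
  have sub: "complex_vector.subspace (eigenspace S l)" for l
    unfolding complex_vector.subspace_def
    by (auto simp: eigenspace_def clinearD[OF Slin] scaleC_add_right scaleC_scaleC mult.commute)
  have main: "real (\<Sum>l\<in>F. card (B l)) \<le> C / \<kappa> powr q"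
    if \<kappa>: "0 < \<kappa>" and F: "finite F" "F \<subseteq> {\<kappa><..}"
      and B: "\<And>l. l \<in> F \<Longrightarrow> B l \<subseteq> eigenspace S l \<and> finite (B l) \<and> \<not> complex_vector.dependent (B l)"
    for \<kappa> F B
  proof -
    have "\<exists>\<Phi>. \<Phi> \<subseteq> eigenspace S l \<and> finite \<Phi> \<and> corthonormal \<Phi> \<and> card \<Phi> = card (B l)" if "l \<in> F" for l
      using corthonormal_exists[OF sub[of l], of "B l" "card (B l)"] B[OF that] by blast
    then obtain \<Phi> where \<Phi>: "\<And>l. l \<in> F \<Longrightarrow> \<Phi> l \<subseteq> eigenspace S l \<and> finite (\<Phi> l) \<and> corthonormal (\<Phi> l)
        \<and> card (\<Phi> l) = card (B l)" by metis
    have orth: "cinner x y = 0" if "l \<in> F" "l' \<in> F" "x \<in> \<Phi> l" "y \<in> \<Phi> l'" "l \<noteq> l'" for l l' x y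
      using eig_orth[of x l y l'] \<Phi> that by blast
    have one: "cinner x x = 1" if "l \<in> F" "x \<in> \<Phi> l" for l x
      using \<Phi>[OF that(1)] that(2) by (simp add: corthonormal_def)
    have "corthonormal (\<Union>l\<in>F. \<Phi> l)"
      unfolding corthonormal_def
    proof (intro ballI)
      fix x y assume "x \<in> (\<Union>l\<in>F. \<Phi> l)" "y \<in> (\<Union>l\<in>F. \<Phi> l)"
      then obtain l l' where l: "l \<in> F" "x \<in> \<Phi> l" "l' \<in> F" "y \<in> \<Phi> l'" by auto
      show "cinner x y = of_bool (x = y)"
      proof (cases "l = l'")
        case True
        then show ?thesis using \<Phi>[OF l(1)] l by (simp add: corthonormal_def)
      next
        case False
        then show ?thesis using orth[of l l' x y] one[of l x] l by auto
      qed
    qed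
    moreover have "\<forall>\<phi>\<in>(\<Union>l\<in>F. \<Phi> l). \<kappa> < norm (K \<phi>)"
    proof
      fix \<phi> assume "\<phi> \<in> (\<Union>l\<in>F. \<Phi> l)"
      then obtain l where l: "l \<in> F" "\<phi> \<in> \<Phi> l" by auto
      then have "norm (K \<phi>) = \<bar>l\<bar> * 1"
        using eig_norm[of \<phi> l] corthonormal_norm[of "\<Phi> l" \<phi>] \<Phi>[OF l(1)] by (metis subsetD)
      then show "\<kappa> < norm (K \<phi>)" using F(2) l(1) \<kappa> by auto
    qed
    moreover have "finite (\<Union>l\<in>F. \<Phi> l)" using F(1) \<Phi> by auto
    ultimately have "real (card (\<Union>l\<in>F. \<Phi> l)) \<le> C / \<kappa> powr q" by (intro card_le[OF \<kappa>])
    also have "card (\<Union>l\<in>F. \<Phi> l) = (\<Sum>l\<in>F. card (\<Phi> l))"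
    proof (rule card_UN_disjoint[OF F(1)])
      show "\<forall>l\<in>F. \<forall>l'\<in>F. l \<noteq> l' \<longrightarrow> \<Phi> l \<inter> \<Phi> l' = {}"
        using orth one by (metis disjoint_iff zero_neq_one)
    qed (use \<Phi> in auto)
    also have "\<dots> = (\<Sum>l\<in>F. card (B l))" using \<Phi> by simp
    finally show ?thesis .
  qed
  show "weak_schatten_sup q K \<le> ennreal C"
    unfolding weak_schatten_sup_def
  proof (rule SUP_least)
    fix \<kappa> :: real assume "\<kappa> \<in> {0<..}"
    then have \<kappa>: "0 < \<kappa>" by simp
    \<comment> \<open>The sum over uncountably many \<open>l\<close> is the supremum of its finite
      partial sums, so finitely many eigenvalues at a time suffice.\<close>
    have "n_eigenvalues \<kappa> S \<le> ennreal (C / \<kappa> powr q)"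
      unfolding n_eigenvalues_def
    proof (subst nonneg_infsum_complete, simp, rule SUP_least)
      fix F assume "F \<in> {F. finite F \<and> F \<subseteq> {\<kappa><..}}"
      then have F: "finite F" "F \<subseteq> {\<kappa><..}" by auto
      have "\<exists>B. B \<subseteq> eigenspace S l \<and> finite B \<and> \<not> complex_vector.dependent B
          \<and> ecdim (eigenspace S l) = of_nat (card B)" if "l \<in> F" for l
      proof (rule ecdim_attained)
        fix B assume "B \<subseteq> eigenspace S l" "finite B" "\<not> complex_vector.dependent B"
        \<comment> \<open>The single eigenvalue \<open>l\<close> comes first: its eigenspace is
          finite-dimensional, so the supremum in \<open>ecdim\<close> is attained by one independent
          set.\<close>
        then show "card B \<le> nat \<lfloor>C / \<kappa> powr q\<rfloor>"
          using main[OF \<kappa>, of "{l}" "\<lambda>_. B"] F that by (auto simp: le_nat_floor)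
      qed
      then obtain B where B: "\<And>l. l \<in> F \<Longrightarrow> B l \<subseteq> eigenspace S l \<and> finite (B l) \<and>
          \<not> complex_vector.dependent (B l) \<and> ecdim (eigenspace S l) = of_nat (card (B l))" by metis
      have "(\<Sum>l\<in>F. ecdim (eigenspace S l)) = of_nat (\<Sum>l\<in>F. card (B l))" using B by simp
      also have "\<dots> = ennreal (real (\<Sum>l\<in>F. card (B l)))" by (rule ennreal_of_nat_eq_real_of_nat)
      also have "\<dots> \<le> ennreal (C / \<kappa> powr q)"
        using main[OF \<kappa> F, of B] B by (intro ennreal_leI) auto
      finally show "(\<Sum>l\<in>F. ecdim (eigenspace S l)) \<le> ennreal (C / \<kappa> powr q)" .
    qed
    then have "ennreal (\<kappa> powr q) * n_eigenvalues \<kappa> S \<le> ennreal (\<kappa> powr q) * ennreal (C / \<kappa> powr q)"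
      by (intro mult_left_mono) auto
    also have "\<dots> = ennreal C" using \<kappa> by (simp flip: ennreal_mult')
    finally show "ennreal (\<kappa> powr q) * n_eigenvalues \<kappa> (abs_operator K) \<le> ennreal C"
      by (simp add: S_def)
  qed
qed

section \<open>Gaussian integrals\<close>

lemma lborel_nn_integral_affine:
  fixes t :: "'a::euclidean_space"
  assumes [measurable]: "f \<in> borel_measurable borel" and c: "c \<noteq> 0"
  shows "(\<integral>\<^sup>+x. f x \<partial>lborel) = ennreal (\<bar>c\<bar> ^ DIM('a)) * (\<integral>\<^sup>+x. f (t + c *\<^sub>R x) \<partial>lborel)"
  by (subst lborel_affine[OF c, of t])
     (simp add: nn_integral_density nn_integral_distr nn_integral_cmult)

lemma lborel_integral_affine:
  fixes t :: "'a::euclidean_space" and f :: "'a \<Rightarrow> complex"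
  assumes [measurable]: "f \<in> borel_measurable borel" and c: "c \<noteq> 0"
  shows "(\<integral>x. f x \<partial>lborel) = complex_of_real (\<bar>c\<bar> ^ DIM('a)) * (\<integral>x. f (t + c *\<^sub>R x) \<partial>lborel)"
  by (subst lborel_affine[OF c, of t])
     (simp add: integral_density integral_distr scaleR_conv_of_real)

lemma integrable_prod_lborel:
  fixes f :: "'a::euclidean_space \<Rightarrow> complex" and g :: "'b::euclidean_space \<Rightarrow> complex"
  assumes f: "integrable lborel f" and g: "integrable lborel g"
  shows "integrable (lborel \<Otimes>\<^sub>M lborel) (\<lambda>z. f (fst z) * g (snd z))"
proof (rule lborel_pair.Fubini_integrable)
  show "(\<lambda>z. f (fst z) * g (snd z)) \<in> borel_measurable (lborel \<Otimes>\<^sub>M lborel)"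
    using f g by measurable
  show "integrable lborel (\<lambda>x. \<integral>y. norm (f (fst (x, y)) * g (snd (x, y))) \<partial>lborel)"
    using f by (simp add: norm_mult)
  show "AE x in lborel. integrable lborel (\<lambda>y. f (fst (x, y)) * g (snd (x, y)))"
    using g by simp
qed

lemma norm_square_Basis: "(norm x)\<^sup>2 = (\<Sum>b\<in>Basis. (x \<bullet> b)\<^sup>2)"
  unfolding power2_norm_eq_inner euclidean_inner[of x x] by (simp add: power2_eq_square)

lemma sum_neg_half_squares: "(\<Sum>b\<in>Basis. - (x \<bullet> b)\<^sup>2 / 2) = - (norm x)\<^sup>2 / 2"
  unfolding norm_square_Basis sum_divide_distrib[symmetric] sum_negf ..

definition gauss :: "'a::euclidean_space \<Rightarrow> real" where
  "gauss x = (2 * pi) powr (- real DIM('a) / 2) * exp (- (norm x)\<^sup>2 / 2)"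

lemma gauss_nonneg: "0 \<le> gauss x" by (simp add: gauss_def)

lemma gauss_measurable [measurable]: "gauss \<in> borel_measurable borel"
  unfolding gauss_def by measurable

lemma gauss_prod: "gauss x = (\<Prod>b\<in>Basis. std_normal_density (x \<bullet> b))"
proof -
  have "(\<Prod>b\<in>Basis. std_normal_density (x \<bullet> b)) =
      (\<Prod>b\<in>(Basis::'a set). 1 / sqrt (2 * pi)) * exp (\<Sum>b\<in>Basis. - (x \<bullet> b)\<^sup>2 / 2)"
    unfolding std_normal_density_def by (subst prod.distrib) (simp add: exp_sum)
  also have "(\<Sum>b\<in>Basis. - (x \<bullet> b)\<^sup>2 / 2) = - (norm x)\<^sup>2 / 2"
    by (rule sum_neg_half_squares)
  also have "(\<Prod>b\<in>(Basis::'a set). 1 / sqrt (2 * pi)) = (2 * pi) powr (- real DIM('a) / 2)"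
  proof -
    have "1 / sqrt (2 * pi) = (2 * pi) powr (- (1 / 2))"
      by (simp add: powr_minus_divide powr_half_sqrt)
    then show ?thesis by (simp add: powr_power)
  qed
  finally show ?thesis by (simp add: gauss_def)
qed

lemma nn_integral_gauss: "(\<integral>\<^sup>+x. ennreal (gauss (x::'a::euclidean_space)) \<partial>lborel) = 1"
proof -
  have "(\<integral>\<^sup>+x. ennreal (std_normal_density x) \<partial>lborel) = 1"
    using prob_space.emeasure_space_1[OF prob_space_normal_density[of 1 0]] by (simp add: emeasure_density)
  moreover have "(\<integral>\<^sup>+x. ennreal (gauss (x::'a)) \<partial>lborel)
      = (\<integral>\<^sup>+x. (\<Prod>b\<in>Basis. ennreal (std_normal_density (x \<bullet> b))) \<partial>(lborel::'a measure))"
    by (simp add: gauss_prod prod_ennreal)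
  ultimately show ?thesis by (subst (asm) nn_integral_lborel_prod) auto
qed

lemma gauss_scale_integral:
  fixes x :: "'a::euclidean_space"
  assumes "0 < s"
  shows "(\<integral>\<^sup>+y. ennreal (s ^ DIM('a) * gauss (s *\<^sub>R (x - y))) \<partial>lborel) = 1"
    and "(\<integral>\<^sup>+y. ennreal (s ^ DIM('a) * gauss (s *\<^sub>R (y - x))) \<partial>lborel) = 1"
proof -
  have *: "ennreal (s ^ DIM('a)) * (\<integral>\<^sup>+y. ennreal (gauss (- s *\<^sub>R x + s *\<^sub>R y)) \<partial>(lborel::'a measure)) = 1"
    using lborel_nn_integral_affine[of "\<lambda>y. ennreal (gauss y)" s "- s *\<^sub>R x"] assms
    by (simp add: nn_integral_gauss)
  show 1: "(\<integral>\<^sup>+y. ennreal (s ^ DIM('a) * gauss (s *\<^sub>R (y - x))) \<partial>lborel) = 1"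
    using * assms by (simp add: ennreal_mult' nn_integral_cmult algebra_simps)
  have "gauss (s *\<^sub>R (x - y)) = gauss (s *\<^sub>R (y - x))" for y
    by (simp add: gauss_def norm_minus_commute)
  then show "(\<integral>\<^sup>+y. ennreal (s ^ DIM('a) * gauss (s *\<^sub>R (x - y))) \<partial>lborel) = 1"
    using 1 by simp
qed

lemma cis_measurable [measurable]: "cis \<in> borel_measurable borel"
  by (intro borel_measurable_continuous_onI continuous_intros)

text \<open>The integral factorises over the coordinates into characteristic functions of the
  standard normal distribution.\<close>

lemma fourier_gauss:
  "(\<integral>p. cis (p \<bullet> z) * gauss p \<partial>lborel) = exp (- (norm (z::'a::euclidean_space))\<^sup>2 / 2)"
proof -
  interpret product_sigma_finite "\<lambda>_::'a. lborel :: real measure" ..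
  have one: "(\<integral>x. cis (x * t) * std_normal_density x \<partial>lborel) = exp (- t\<^sup>2 / 2)" for t
  proof -
    have "char std_normal_distribution t = (\<integral>x. std_normal_density x *\<^sub>R iexp (t * x) \<partial>lborel)"
      unfolding char_def by (subst integral_density) (auto simp: normal_density_nonneg)
    also have "\<dots> = (\<integral>x. cis (x * t) * std_normal_density x \<partial>lborel)"
      by (simp add: cis_conv_exp scaleR_conv_of_real mult.commute)
    finally show ?thesis by (simp add: char_std_normal_distribution exp_of_real)
  qed
  have int: "integrable lborel (\<lambda>x. cis (x * t) * std_normal_density x)" for t
    by (rule Bochner_Integration.integrable_bound[of _ "\<lambda>x. std_normal_density x"])
       (auto simp: norm_mult)
  have "(\<integral>p. cis (p \<bullet> z) * gauss p \<partial>lborel)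
      = (\<integral>p. (\<Prod>b\<in>Basis. cis ((p \<bullet> b) * (z \<bullet> b)) * std_normal_density (p \<bullet> b)) \<partial>lborel)"
    by (simp add: gauss_prod prod.distrib euclidean_inner[of _ z] cis_conv_exp exp_sum sum_distrib_left)
  also have "\<dots> = (\<integral>f. (\<Prod>b\<in>Basis. cis (f b * (z \<bullet> b)) * std_normal_density (f b)) \<partial>(\<Pi>\<^sub>M b\<in>Basis. lborel))"
    unfolding lborel_eq[where 'a='a]
    by (subst integral_distr) (auto intro!: Bochner_Integration.integral_cong)
  also have "\<dots> = (\<Prod>b\<in>Basis. (\<integral>x. cis (x * (z \<bullet> b)) * std_normal_density x \<partial>lborel))"
    by (rule product_integral_prod) (auto intro: int)
  also have "\<dots> = of_real (exp (\<Sum>b\<in>Basis. - (z \<bullet> b)\<^sup>2 / 2))"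
    by (simp add: one exp_sum flip: of_real_prod)
  also have "(\<Sum>b\<in>Basis. - (z \<bullet> b)\<^sup>2 / 2) = - (norm z)\<^sup>2 / 2"
    by (rule sum_neg_half_squares)
  finally show ?thesis .
qed

text \<open>A momentum cutoff that tends to 1 as \<open>s\<close> grows. Up to a constant its
  Fourier transform is a probability density concentrating at 0, namely \<open>gkernel s\<close>
  below.\<close>

definition gweight :: "real \<Rightarrow> 'a::euclidean_space \<Rightarrow> real" where
  "gweight s p = exp (- (norm (p /\<^sub>R s))\<^sup>2 / 2)"

lemma gweight_measurable [measurable]: "gweight s \<in> borel_measurable borel"
  unfolding gweight_def by measurable

lemma gweight_gauss: "gweight s (p::'a::euclidean_space) = (2 * pi) powr (real DIM('a) / 2) * gauss (p /\<^sub>R s)"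
  by (simp add: gweight_def gauss_def powr_minus field_simps)

lemma fourier_gweight:
  fixes z :: "'a::euclidean_space"
  assumes s: "0 < s"
  shows "(\<integral>p. cis (p \<bullet> z) * gweight s p \<partial>lborel) = of_real ((2 * pi) powr (real DIM('a)) * (s ^ DIM('a) * gauss (s *\<^sub>R z)))"
proof -
  have "(\<integral>p. cis (p \<bullet> z) * gweight s p \<partial>lborel)
     = complex_of_real (s ^ DIM('a)) * (\<integral>p. cis (p \<bullet> (s *\<^sub>R z)) * of_real ((2 * pi) powr (real DIM('a) / 2) * gauss p) \<partial>lborel)"
    using s by (subst lborel_integral_affine[of _ s 0]) (simp_all add: gweight_gauss)
  also have "(\<integral>p. cis (p \<bullet> (s *\<^sub>R z)) * of_real ((2 * pi) powr (real DIM('a) / 2) * gauss p) \<partial>lborel)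
      = (\<integral>p. of_real ((2 * pi) powr (real DIM('a) / 2)) * (cis (p \<bullet> (s *\<^sub>R z)) * of_real (gauss p)) \<partial>lborel)"
    by (rule Bochner_Integration.integral_cong) (simp_all only: of_real_mult mult_ac)
  also have "\<dots> = of_real ((2 * pi) powr (real DIM('a) / 2) * exp (- (norm (s *\<^sub>R z))\<^sup>2 / 2))"
    unfolding integral_mult_right_zero fourier_gauss of_real_mult ..
  also have "(2 * pi) powr (real DIM('a) / 2) * exp (- (norm (s *\<^sub>R z))\<^sup>2 / 2)
      = (2 * pi) powr (real DIM('a)) * gauss (s *\<^sub>R z)"
  proof -
    have "(2 * pi) powr (real DIM('a)) * (2 * pi) powr (- real DIM('a) / 2) = (2 * pi) powr (real DIM('a) / 2)"
      by (simp add: powr_add[symmetric])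
    then show ?thesis unfolding gauss_def mult.assoc[symmetric] by simp
  qed
  finally show ?thesis by (simp only: of_real_mult mult_ac)
qed

lemma integrable_gweight:
  assumes "0 < s" shows "integrable lborel (gweight s :: 'a::euclidean_space \<Rightarrow> real)"
proof -
  have "(\<integral>\<^sup>+p. ennreal (gweight s (p::'a)) \<partial>lborel)
     = ennreal (s ^ DIM('a)) * (\<integral>\<^sup>+p. ennreal ((2 * pi) powr (real DIM('a) / 2) * gauss (p::'a)) \<partial>lborel)"
    using assms by (subst lborel_nn_integral_affine[of _ s 0]) (simp_all add: gweight_gauss)
  also have "\<dots> < \<infinity>"
    by (simp add: ennreal_mult' nn_integral_cmult nn_integral_gauss ennreal_mult_less_top)
  finally show ?thesis by (intro integrableI_nonneg) (auto simp: gweight_def)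
qed

section \<open>Plancherel theorem\<close>

text \<open>\<open>\<sigma> = -1\<close> is the Fourier transform and \<open>\<sigma> = 1\<close> its inverse.\<close>

definition ft :: "real \<Rightarrow> ('a::euclidean_space \<Rightarrow> complex) \<Rightarrow> 'a \<Rightarrow> complex" where
  "ft \<sigma> u p = complex_of_real ((2 * pi) powr (- real DIM('a) / 2)) *
     (LINT x|lebesgue. cis (\<sigma> * (p \<bullet> x)) * u x)"

text \<open>Fubini's theorem for the transform is applied on products of \<open>lborel\<close>, so
  Lebesgue measurable functions are first replaced by Borel representatives.\<close>

lemma completion_ex_borel_measurable_complex:
  fixes g :: "'a \<Rightarrow> complex"
  assumes "g \<in> borel_measurable (completion M)"
  obtains g' where "g' \<in> borel_measurable M" "AE x in M. g x = g' x"
proof -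
  have m: "(\<lambda>x. Re (g x)) \<in> borel_measurable (completion M)" "(\<lambda>x. Im (g x)) \<in> borel_measurable (completion M)"
    using assms by simp_all
  obtain r i where "r \<in> borel_measurable M" "AE x in M. Re (g x) = r x"
      "i \<in> borel_measurable M" "AE x in M. Im (g x) = i x"
    using m[THEN completion_ex_borel_measurable_real] by blast
  then show thesis
    by (intro that[of "\<lambda>x. Complex (r x) (i x)"]) (auto simp: complex_eq_iff borel_measurable_complex_iff)
qed

lemma ft_cong_AE:
  assumes "u \<in> borel_measurable lebesgue" "v \<in> borel_measurable lebesgue" "AE x in lebesgue. u x = v x"
  shows "ft \<sigma> u = ft \<sigma> v"
proof
  fix p :: 'a
  have [measurable]: "(\<lambda>x. cis (\<sigma> * (p \<bullet> x))) \<in> borel_measurable lebesgue"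
    by (intro measurable_completion) simp
  show "ft \<sigma> u p = ft \<sigma> v p"
    unfolding ft_def using assms
    by (intro arg_cong2[where f = "(*)"] refl integral_cong_AE) (auto elim: AE_mp)
qed

lemma ft_borel:
  fixes u :: "'a::euclidean_space \<Rightarrow> complex"
  assumes [measurable]: "u \<in> borel_measurable borel"
  shows "ft \<sigma> u p = complex_of_real ((2 * pi) powr (- real DIM('a) / 2)) *
     (LINT x|lborel. cis (\<sigma> * (p \<bullet> x)) * u x)"
  unfolding ft_def by (subst integral_completion) simp_all

lemma ft_measurable_borel [measurable]:
  assumes [measurable]: "u \<in> borel_measurable borel"
  shows "ft \<sigma> u \<in> borel_measurable borel"
proof -
  have "(\<lambda>p. LINT x|lborel. cis (\<sigma> * (p \<bullet> x)) * u x) \<in> borel_measurable lborel"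
    by measurable
  then show ?thesis unfolding ft_borel[OF assms, abs_def] by measurable
qed

lemma integrable_cis_mult:
  assumes "integrable M u" "f \<in> borel_measurable M"
  shows "integrable M (\<lambda>x. cis (f x) * u x)"
  by (rule Bochner_Integration.integrable_bound[OF assms(1)])
     (use assms in \<open>auto simp: norm_mult intro!: borel_measurable_times measurable_compose[OF _ cis_measurable]\<close>)

definition gkernel :: "real \<Rightarrow> 'a::euclidean_space \<Rightarrow> real" where
  "gkernel s w = s ^ DIM('a) * gauss (s *\<^sub>R w)"

lemma gkernel_measurable [measurable]: "gkernel s \<in> borel_measurable borel"
  unfolding gkernel_def by measurable

lemma gkernel_nonneg: "0 \<le> s \<Longrightarrow> 0 \<le> gkernel s w"
  by (simp add: gkernel_def gauss_nonneg)

text \<open>A regularised Plancherel identity. The squared modulus is a double integral of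
  \<open>u\<close>; the Gaussian weight makes the triple integral with \<open>p\<close> absolutely
  convergent, and integrating over \<open>p\<close> first produces the kernel.\<close>

lemma ft_gweight_identity:
  fixes u :: "'a::euclidean_space \<Rightarrow> complex"
  assumes u: "u \<in> borel_measurable borel" "integrable lborel u"
    and s: "0 < s" and \<sigma>: "\<sigma> = 1 \<or> \<sigma> = -1"
  shows "integrable lborel (\<lambda>p. (norm (ft \<sigma> u p))\<^sup>2 * gweight s p)"
    and "complex_of_real (\<integral>p. (norm (ft \<sigma> u p))\<^sup>2 * gweight s p \<partial>lborel)
      = (\<integral>z. u (fst z) * cnj (u (snd z)) * gkernel s (fst z - snd z) \<partial>(lborel \<Otimes>\<^sub>M lborel))"
proof -
  note [measurable] = u(1)
  have cnj_meas [measurable]: "cnj \<in> borel_measurable borel"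
    by (intro borel_measurable_continuous_onI continuous_intros)
  define c where "c = (2 * pi) powr (- real DIM('a) / 2)"
  define A where "A p = (LINT x|lborel. cis (\<sigma> * (p \<bullet> x)) * u x)" for p :: 'a
  define P where "P z = u (fst z) * cnj (u (snd z))" for z :: "'a \<times> 'a"
  have P_int: "integrable lborel P"
    unfolding P_def lborel_prod[symmetric] by (intro integrable_prod_lborel u(2)) (use u in simp)
  have [measurable]: "P \<in> borel_measurable borel"
    using P_int by (auto dest: borel_measurable_integrable)
  define F where "F p z = cis (\<sigma> * (p \<bullet> (fst z - snd z))) * (gweight s p * P z)" for p z
  have gP: "integrable (lborel \<Otimes>\<^sub>M lborel) (\<lambda>y. complex_of_real (gweight s (fst y)) * P (snd y))"
    by (intro integrable_prod_lborel P_int integrable_of_real integrable_gweight s)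
  have F_int: "integrable (lborel \<Otimes>\<^sub>M lborel) (\<lambda>(p, z). F p z)"
    unfolding F_def split_beta
  proof (intro integrable_cis_mult gP)
    show "(\<lambda>y. \<sigma> * (fst y \<bullet> (fst (snd y) - snd (snd y)))) \<in> borel_measurable (lborel \<Otimes>\<^sub>M lborel)"
      unfolding lborel_prod by (simp, intro borel_measurable_continuous_onI continuous_intros)
  qed
  have inner: "(\<integral>z. F p z \<partial>lborel) = of_real ((norm (A p))\<^sup>2 * gweight s p)" for p
  proof -
    have int: "integrable lborel (\<lambda>x. cis (\<sigma> * (p \<bullet> x)) * u x)"
      by (intro integrable_cis_mult u) measurable
    have int2: "integrable (lborel \<Otimes>\<^sub>M lborel) (\<lambda>z. (cis (\<sigma> * (p \<bullet> fst z)) * u (fst z)) * cnj (cis (\<sigma> * (p \<bullet> snd z)) * u (snd z)))"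
      by (intro integrable_prod_lborel int integrable_bounded_linear[OF bounded_linear_cnj])
    have "F p z = gweight s p * ((cis (\<sigma> * (p \<bullet> fst z)) * u (fst z)) * cnj (cis (\<sigma> * (p \<bullet> snd z)) * u (snd z)))" for z
      by (simp add: F_def P_def inner_diff_right right_diff_distrib cis_divide[symmetric] cis_cnj
          divide_inverse cis_inverse mult_ac)
    then have "(\<integral>z. F p z \<partial>lborel) = gweight s p *
       (\<integral>z. ((cis (\<sigma> * (p \<bullet> fst z)) * u (fst z)) * cnj (cis (\<sigma> * (p \<bullet> snd z)) * u (snd z))) \<partial>(lborel \<Otimes>\<^sub>M lborel))"
      by (simp add: lborel_prod)
    also have "(\<integral>z. ((cis (\<sigma> * (p \<bullet> fst z)) * u (fst z)) * cnj (cis (\<sigma> * (p \<bullet> snd z)) * u (snd z))) \<partial>(lborel \<Otimes>\<^sub>M lborel))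
       = (\<integral>x. \<integral>y. (cis (\<sigma> * (p \<bullet> x)) * u x) * cnj (cis (\<sigma> * (p \<bullet> y)) * u y) \<partial>lborel \<partial>lborel)"
      using lborel_pair.integral_fst'[OF int2] by simp
    also have "\<dots> = A p * cnj (A p)"
      unfolding integral_mult_right_zero integral_mult_left_zero Bochner_Integration.integral_cnj A_def ..
    finally show ?thesis by (simp only: complex_norm_square[symmetric] of_real_mult mult.commute)
  qed
  have outer: "(\<integral>p. F p z \<partial>lborel) = of_real ((2 * pi) powr (real DIM('a))) * (P z * gkernel s (fst z - snd z))" for z
  proof -
    have "(\<integral>p. F p z \<partial>lborel) = (\<integral>p. (cis (p \<bullet> (\<sigma> *\<^sub>R (fst z - snd z))) * gweight s p) * P z \<partial>lborel)"
      by (simp add: F_def mult.assoc)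
    also have "\<dots> = (\<integral>p. cis (p \<bullet> (\<sigma> *\<^sub>R (fst z - snd z))) * gweight s p \<partial>lborel) * P z"
      by (rule integral_mult_left_zero)
    \<comment> \<open>The Gaussian is even, so the sign \<open>\<sigma>\<close> disappears and one
      identity serves the transform and its inverse.\<close>
    also have "gauss (s *\<^sub>R (\<sigma> *\<^sub>R (fst z - snd z))) = gauss (s *\<^sub>R (fst z - snd z))"
      using \<sigma> by (auto simp: gauss_def norm_minus_commute)
    then have "(\<integral>p. cis (p \<bullet> (\<sigma> *\<^sub>R (fst z - snd z))) * gweight s p \<partial>lborel) = of_real ((2 * pi) powr (real DIM('a)) * gkernel s (fst z - snd z))"
      unfolding fourier_gweight[OF s] gkernel_def by simp
    finally show ?thesis by (simp add: mult_ac)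
  qed
  have nf: "(norm (ft \<sigma> u p))\<^sup>2 = c\<^sup>2 * (norm (A p))\<^sup>2" for p
    by (simp add: ft_borel[OF u(1)] norm_mult power_mult_distrib A_def c_def)
  have "integrable lborel (\<lambda>p. complex_of_real ((norm (A p))\<^sup>2 * gweight s p))"
    using lborel_pair.integrable_fst'[OF F_int] by (simp add: inner)
  from integrable_bounded_linear[OF bounded_linear_Re this]
  have "integrable lborel (\<lambda>p. (norm (A p))\<^sup>2 * gweight s p)"
    by (simp only: Re_complex_of_real)
  then show "integrable lborel (\<lambda>p. (norm (ft \<sigma> u p))\<^sup>2 * gweight s p)"
    by (simp add: nf mult.assoc)
  have "complex_of_real (\<integral>p. (norm (ft \<sigma> u p))\<^sup>2 * gweight s p \<partial>lborel)
      = complex_of_real (c\<^sup>2) * (\<integral>p. complex_of_real ((norm (A p))\<^sup>2 * gweight s p) \<partial>lborel)"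
    unfolding nf mult.assoc integral_mult_right_zero integral_complex_of_real by (rule of_real_mult)
  also have "(\<integral>p. complex_of_real ((norm (A p))\<^sup>2 * gweight s p) \<partial>lborel) = (\<integral>p. \<integral>z. F p z \<partial>lborel \<partial>lborel)"
    by (simp only: inner)
  also have "\<dots> = (\<integral>z. \<integral>p. F p z \<partial>lborel \<partial>lborel)"
    by (rule lborel_pair.Fubini_integral[OF F_int, symmetric])
  also have "\<dots> = of_real ((2 * pi) powr (real DIM('a))) * (\<integral>z. P z * gkernel s (fst z - snd z) \<partial>lborel)"
    unfolding outer integral_mult_right_zero ..
  also have "c\<^sup>2 * (of_real ((2 * pi) powr (real DIM('a))) * (\<integral>z. P z * gkernel s (fst z - snd z) \<partial>lborel))
     = (\<integral>z. P z * gkernel s (fst z - snd z) \<partial>lborel)"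
  proof -
    have "c\<^sup>2 * (2 * pi) powr (real DIM('a)) = 1"
      by (simp add: c_def powr_power powr_add[symmetric])
    then show ?thesis by (simp only: mult.assoc[symmetric] of_real_mult[symmetric] of_real_1 mult_1)
  qed
  finally show "complex_of_real (\<integral>p. (norm (ft \<sigma> u p))\<^sup>2 * gweight s p \<partial>lborel)
      = (\<integral>z. u (fst z) * cnj (u (snd z)) * gkernel s (fst z - snd z) \<partial>(lborel \<Otimes>\<^sub>M lborel))"
    by (simp add: lborel_prod P_def)
qed

text \<open>Schur's test: bound the product of the two values of |u| by half the sum of their
  squares, and use that the kernel has integral 1 in each variable separately.\<close>

lemma gkernel_double_integral_le:
  fixes u :: "'a::euclidean_space \<Rightarrow> complex"
  assumes [measurable]: "u \<in> borel_measurable borel" and s: "0 < s"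
  shows "(\<integral>\<^sup>+z. ennreal (norm (u (fst z)) * norm (u (snd z)) * gkernel s (fst z - snd z)) \<partial>(lborel \<Otimes>\<^sub>M lborel))
    \<le> (\<integral>\<^sup>+x. ennreal ((norm (u x))\<^sup>2) \<partial>lborel)"
proof -
  let ?k = "\<lambda>x y. gkernel s (x - y :: 'a)"
  let ?n = "\<lambda>x. ennreal ((norm (u x))\<^sup>2)"
  let ?I = "\<integral>\<^sup>+x. ?n x \<partial>lborel"
  have k1: "(\<integral>\<^sup>+y. ennreal (?k x y) \<partial>lborel) = 1" "(\<integral>\<^sup>+x. ennreal (?k x y) \<partial>lborel) = 1" for x y
    using gauss_scale_integral[OF s] by (simp_all add: gkernel_def)
  have k0: "0 \<le> ?k x y" for x y using s by (simp add: gkernel_nonneg)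
  have "(\<integral>\<^sup>+z. ennreal (norm (u (fst z)) * norm (u (snd z)) * ?k (fst z) (snd z)) \<partial>(lborel \<Otimes>\<^sub>M lborel))
     \<le> (\<integral>\<^sup>+z. ennreal (1/2) * (?n (fst z) * ennreal (?k (fst z) (snd z))) + ennreal (1/2) * (?n (snd z) * ennreal (?k (fst z) (snd z))) \<partial>(lborel \<Otimes>\<^sub>M lborel))"
  proof (rule nn_integral_mono)
    fix z :: "'a \<times> 'a"
    let ?a = "norm (u (fst z))" and ?b = "norm (u (snd z))" and ?q = "?k (fst z) (snd z)"
    have "0 \<le> (?a - ?b)\<^sup>2" by simp
    then have "?a * ?b \<le> (1/2) * ?a\<^sup>2 + (1/2) * ?b\<^sup>2" by (simp add: power2_diff)
    then have "?a * ?b * ?q \<le> ((1/2) * ?a\<^sup>2 + (1/2) * ?b\<^sup>2) * ?q" by (rule mult_right_mono) (rule k0)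
    then have "ennreal (?a * ?b * ?q) \<le> ennreal ((1/2) * (?a\<^sup>2 * ?q) + (1/2) * (?b\<^sup>2 * ?q))"
      by (intro ennreal_leI) (simp add: algebra_simps)
    also have "\<dots> = ennreal (1/2) * (?n (fst z) * ennreal ?q) + ennreal (1/2) * (?n (snd z) * ennreal ?q)"
    proof -
      have "ennreal ((1/2) * (x * ?q)) = ennreal (1/2) * (ennreal x * ennreal ?q)" if "0 \<le> x" for x
        using that by (simp only: ennreal_mult' zero_le_divide_1_iff zero_le_numeral)
      then show ?thesis using k0[of "fst z" "snd z"] by (subst ennreal_plus) simp_all
    qed
    finally show "ennreal (?a * ?b * ?q) \<le> \<dots>" .
  qed
  also have "\<dots> = ennreal (1/2) * (\<integral>\<^sup>+z. ?n (fst z) * ennreal (?k (fst z) (snd z)) \<partial>(lborel \<Otimes>\<^sub>M lborel))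
     + ennreal (1/2) * (\<integral>\<^sup>+z. ?n (snd z) * ennreal (?k (fst z) (snd z)) \<partial>(lborel \<Otimes>\<^sub>M lborel))"
    by (subst nn_integral_add) (simp_all add: nn_integral_cmult)
  also have "(\<integral>\<^sup>+z. ?n (fst z) * ennreal (?k (fst z) (snd z)) \<partial>(lborel \<Otimes>\<^sub>M lborel)) = ?I"
    by (subst lborel.nn_integral_fst[symmetric]) (simp_all add: nn_integral_cmult k1)
  also have "(\<integral>\<^sup>+z. ?n (snd z) * ennreal (?k (fst z) (snd z)) \<partial>(lborel \<Otimes>\<^sub>M lborel)) = ?I"
    by (subst lborel_pair.nn_integral_snd[symmetric]) (simp_all add: nn_integral_cmult k1)
  also have "ennreal (1/2) * ?I + ennreal (1/2) * ?I = ?I"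
    by (simp add: distrib_right[symmetric] ennreal_plus[symmetric] del: ennreal_half ennreal_plus)
  finally show ?thesis .
qed

lemma ft_contraction_borel:
  fixes u :: "'a::euclidean_space \<Rightarrow> complex"
  assumes u[measurable]: "u \<in> borel_measurable borel" and "integrable lborel u" and \<sigma>: "\<sigma> = 1 \<or> \<sigma> = -1"
  shows "(\<integral>\<^sup>+p. ennreal ((norm (ft \<sigma> u p))\<^sup>2) \<partial>lborel) \<le> (\<integral>\<^sup>+x. ennreal ((norm (u x))\<^sup>2) \<partial>lborel)"
proof -
  let ?I = "\<integral>\<^sup>+x. ennreal ((norm (u x))\<^sup>2) \<partial>lborel"
  let ?g = "\<lambda>n p. ennreal ((norm (ft \<sigma> u p))\<^sup>2 * gweight (real (Suc n)) p)"
  have [measurable]: "cnj \<in> borel_measurable borel"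
    by (intro borel_measurable_continuous_onI continuous_intros)
  have bound: "(\<integral>\<^sup>+p. ?g n p \<partial>lborel) \<le> ?I" for n
  proof -
    define s where "s = real (Suc n)"
    have s: "0 < s" by (simp add: s_def)
    note id = ft_gweight_identity[OF assms(1,2) s \<sigma>]
    have w0: "0 \<le> (norm (ft \<sigma> u p))\<^sup>2 * gweight s p" for p by (simp add: gweight_def)
    have "(\<integral>\<^sup>+p. ?g n p \<partial>lborel) = ennreal (\<integral>p. (norm (ft \<sigma> u p))\<^sup>2 * gweight s p \<partial>lborel)"
      unfolding s_def[symmetric] by (rule nn_integral_eq_integral[OF id(1)]) (use w0 in auto)
    also have "(\<integral>p. (norm (ft \<sigma> u p))\<^sup>2 * gweight s p \<partial>lborel)
      = norm (complex_of_real (\<integral>p. (norm (ft \<sigma> u p))\<^sup>2 * gweight s p \<partial>lborel))"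
      using w0 by (simp add: integral_nonneg_AE)
    \<comment> \<open>If the integrand is not integrable, its Bochner integral is 0 by convention
      and the bound is trivial.\<close>
    also have "ennreal \<dots> \<le> (\<integral>\<^sup>+z. ennreal (norm (u (fst z) * cnj (u (snd z)) * gkernel s (fst z - snd z))) \<partial>(lborel \<Otimes>\<^sub>M lborel))"
      unfolding id(2)
      by (cases "integrable (lborel \<Otimes>\<^sub>M lborel) (\<lambda>z. u (fst z) * cnj (u (snd z)) * gkernel s (fst z - snd z))")
         (simp_all add: integral_norm_bound_ennreal not_integrable_integral_eq)
    also have "\<dots> = (\<integral>\<^sup>+z. ennreal (norm (u (fst z)) * norm (u (snd z)) * gkernel s (fst z - snd z)) \<partial>(lborel \<Otimes>\<^sub>M lborel))"
      using s by (simp add: norm_mult gkernel_nonneg)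
    also have "\<dots> \<le> ?I" by (rule gkernel_double_integral_le[OF u s])
    finally show ?thesis .
  qed
  have "(\<integral>\<^sup>+p. ennreal ((norm (ft \<sigma> u p))\<^sup>2) \<partial>lborel) = (\<integral>\<^sup>+p. liminf (\<lambda>n. ?g n p) \<partial>lborel)"
  proof (rule nn_integral_cong)
    fix p :: 'a
    have "(\<lambda>n. (norm (ft \<sigma> u p))\<^sup>2 * gweight (real (Suc n)) p) \<longlonglongrightarrow> (norm (ft \<sigma> u p))\<^sup>2 * exp (- (norm ((0::real) *\<^sub>R p))\<^sup>2 / 2)"
      unfolding gweight_def using LIMSEQ_inverse_real_of_nat by (intro tendsto_intros) simp_all
    then have "(\<lambda>n. ?g n p) \<longlonglongrightarrow> ennreal ((norm (ft \<sigma> u p))\<^sup>2)"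
      by (intro tendsto_ennrealI) simp
    then show "ennreal ((norm (ft \<sigma> u p))\<^sup>2) = liminf (\<lambda>n. ?g n p)"
      by (intro lim_imp_Liminf[symmetric]) auto
  qed
  \<comment> \<open>The weights tend to 1 pointwise, so Fatou's lemma removes them from the uniform
    bound.\<close>
  also have "\<dots> \<le> liminf (\<lambda>n. \<integral>\<^sup>+p. ?g n p \<partial>lborel)"
    by (rule nn_integral_liminf) measurable
  also have "\<dots> \<le> ?I"
    using Liminf_mono[OF always_eventually, of "\<lambda>n. \<integral>\<^sup>+p. ?g n p \<partial>lborel" "\<lambda>_. ?I" sequentially] bound
    by (simp add: Liminf_const)
  finally show ?thesis .
qed

text \<open>Fatou's lemma suffices here: for open \<open>U\<close> the shifted points \<open>x - z / s\<close> eventually enter \<open>U\<close>.\<close>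

lemma ft_indicator_lower:
  fixes U :: "'a::euclidean_space set"
  assumes U: "open U" "bounded U" and \<sigma>: "\<sigma> = 1 \<or> \<sigma> = -1"
  shows "emeasure lborel U \<le> (\<integral>\<^sup>+p. ennreal ((norm (ft \<sigma> (indicator U) p))\<^sup>2) \<partial>lborel)"
proof -
  let ?u = "indicator U :: 'a \<Rightarrow> complex"
  let ?N = "\<integral>\<^sup>+p. ennreal ((norm (ft \<sigma> ?u p))\<^sup>2) \<partial>lborel"
  have [measurable]: "U \<in> sets borel" using U by simp
  have u: "?u \<in> borel_measurable borel" by measurable
  have "emeasure lborel U < \<infinity>" using emeasure_bounded_finite[OF U(2)] .
  then have u_int: "integrable lborel ?u" using integrable_of_real[OF integrable_real_indicator[of U lborel], where 'a=complex] by (simp add: of_real_indicator)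
  let ?h = "\<lambda>n (x::'a) (z::'a). indicator U x * indicator U (x - z /\<^sub>R real (Suc n)) * ennreal (gauss z)"
  have bound: "(\<integral>\<^sup>+x. \<integral>\<^sup>+z. ?h n x z \<partial>lborel \<partial>lborel) \<le> ?N" for n
  proof -
    define s where "s = real (Suc n)"
    have s: "0 < s" by (simp add: s_def)
    note id = ft_gweight_identity[OF u u_int s \<sigma>]
    \<comment> \<open>The substitution \<open>y = x - z / s\<close> moves the dependence on
      \<open>s\<close> from the kernel, which has no pointwise limit, into the indicator, which has
      one.\<close>
    have inner: "(\<integral>\<^sup>+z. ?h n x z \<partial>lborel) = (\<integral>\<^sup>+y. ennreal (indicator U x * indicator U y * gkernel s (x - y)) \<partial>lborel)" for x
    proof -
      have "(\<integral>\<^sup>+y. ennreal (indicator U x * indicator U y * gkernel s (x - y)) \<partial>lborel)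
        = ennreal (\<bar>- 1 / s\<bar> ^ DIM('a)) * (\<integral>\<^sup>+z. ennreal (indicator U x * indicator U (x + (- 1 / s) *\<^sub>R z) * gkernel s (x - (x + (- 1 / s) *\<^sub>R z))) \<partial>lborel)"
        using s by (intro lborel_nn_integral_affine) auto
      also have "\<dots> = (\<integral>\<^sup>+z. ennreal (\<bar>- 1 / s\<bar> ^ DIM('a)) * ennreal (indicator U x * indicator U (x + (- 1 / s) *\<^sub>R z) * gkernel s (x - (x + (- 1 / s) *\<^sub>R z))) \<partial>lborel)"
        by (rule nn_integral_cmult[symmetric]) measurable
      also have "\<dots> = (\<integral>\<^sup>+z. ?h n x z \<partial>lborel)"
      proof (intro nn_integral_cong)
        fix z :: 'a
        have "inverse s ^ DIM('a) * s ^ DIM('a) = 1"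
          using s by (simp add: field_simps)
        then show "ennreal (\<bar>- 1 / s\<bar> ^ DIM('a)) * ennreal (indicator U x * indicator U (x + (- 1 / s) *\<^sub>R z) * gkernel s (x - (x + (- 1 / s) *\<^sub>R z))) = ?h n x z"
          unfolding s_def[symmetric] using s
          by (simp add: gkernel_def ennreal_mult'[symmetric] divide_inverse_commute indicator_def mult.assoc[symmetric])
      qed
      finally show ?thesis by (rule sym)
    qed
    have w0: "0 \<le> (norm (ft \<sigma> ?u p))\<^sup>2 * gweight s p" for p by (simp add: gweight_def)
    have P0: "0 \<le> indicator U x * indicator U y * gkernel s (x - y)" for x y :: 'a
      using s by (simp add: gkernel_nonneg)
    have nm: "norm (?u x) = indicator U x" for x by (simp add: indicator_def)
    let ?P = "\<lambda>z. indicator U (fst z) * indicator U (snd z) * gkernel s (fst z - snd z)"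
    have "(\<integral>\<^sup>+z. ennreal (?P z) \<partial>(lborel \<Otimes>\<^sub>M lborel)) \<le> (\<integral>\<^sup>+x. ennreal ((norm (?u x))\<^sup>2) \<partial>lborel)"
      using gkernel_double_integral_le[OF u s] by (simp add: nm)
    also have "\<dots> < \<infinity>"
    proof -
      have "(\<integral>\<^sup>+x. ennreal ((norm (?u x))\<^sup>2) \<partial>lborel) = (\<integral>\<^sup>+x. indicator U x \<partial>lborel)"
        by (intro nn_integral_cong) (simp add: indicator_def)
      then show ?thesis using \<open>emeasure lborel U < \<infinity>\<close> by simp
    qed
    finally have P_int: "integrable (lborel \<Otimes>\<^sub>M lborel) ?P"
      by (intro integrableI_nonneg) (use P0 in auto)
    have "(\<integral>\<^sup>+x. \<integral>\<^sup>+z. ?h n x z \<partial>lborel \<partial>lborel) = (\<integral>\<^sup>+z. ennreal (?P z) \<partial>(lborel \<Otimes>\<^sub>M lborel))"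
      unfolding inner by (subst lborel.nn_integral_fst[symmetric]) simp_all
    also have "\<dots> = ennreal (\<integral>z. ?P z \<partial>(lborel \<Otimes>\<^sub>M lborel))"
      by (rule nn_integral_eq_integral[OF P_int]) (use P0 in auto)
    also have "(\<integral>z. ?P z \<partial>(lborel \<Otimes>\<^sub>M lborel)) = (\<integral>p. (norm (ft \<sigma> ?u p))\<^sup>2 * gweight s p \<partial>lborel)"
    proof -
      have "complex_of_real (\<integral>z. ?P z \<partial>(lborel \<Otimes>\<^sub>M lborel)) = (\<integral>z. complex_of_real (?P z) \<partial>(lborel \<Otimes>\<^sub>M lborel))"
        by (rule integral_complex_of_real[symmetric])
      also have "\<dots> = (\<integral>z. ?u (fst z) * cnj (?u (snd z)) * gkernel s (fst z - snd z) \<partial>(lborel \<Otimes>\<^sub>M lborel))"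
        by (intro Bochner_Integration.integral_cong) (auto simp: indicator_def)
      finally show ?thesis unfolding id(2)[symmetric] of_real_eq_iff .
    qed
    also have "ennreal \<dots> = (\<integral>\<^sup>+p. ennreal ((norm (ft \<sigma> ?u p))\<^sup>2 * gweight s p) \<partial>lborel)"
      by (rule nn_integral_eq_integral[OF id(1), symmetric]) (use w0 in auto)
    also have "\<dots> \<le> ?N"
      by (intro nn_integral_mono ennreal_leI mult_left_le) (auto simp: gweight_def)
    finally show ?thesis .
  qed
  have lim: "indicator U x * ennreal (gauss z) \<le> liminf (\<lambda>n. ?h n x z)" for x z
  proof (cases "x \<in> U")
    case True
    have "(\<lambda>n. x - z /\<^sub>R real (Suc n)) \<longlonglongrightarrow> x - (0::real) *\<^sub>R z"
      using LIMSEQ_inverse_real_of_nat by (intro tendsto_intros) simp_all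
    then have "\<forall>\<^sub>F n in sequentially. x - z /\<^sub>R real (Suc n) \<in> U"
      using True U(1) by (intro topological_tendstoD[of _ x]) simp_all
    then have "\<forall>\<^sub>F n in sequentially. indicator U x * ennreal (gauss z) \<le> ?h n x z"
      by eventually_elim (use True in simp)
    then show ?thesis by (rule Liminf_bounded)
  qed simp
  have "emeasure lborel U = (\<integral>\<^sup>+x. indicator U x * (\<integral>\<^sup>+z. ennreal (gauss (z::'a)) \<partial>lborel) \<partial>lborel)"
    by (simp add: nn_integral_gauss)
  also have "\<dots> = (\<integral>\<^sup>+x. \<integral>\<^sup>+z. indicator U x * ennreal (gauss (z::'a)) \<partial>lborel \<partial>lborel)"
    by (simp add: nn_integral_cmult)
  also have "\<dots> \<le> (\<integral>\<^sup>+x. \<integral>\<^sup>+z. liminf (\<lambda>n. ?h n x z) \<partial>lborel \<partial>lborel)"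
    by (intro nn_integral_mono lim)
  also have "\<dots> \<le> (\<integral>\<^sup>+x. liminf (\<lambda>n. \<integral>\<^sup>+z. ?h n x z \<partial>lborel) \<partial>lborel)"
    by (intro nn_integral_mono nn_integral_liminf) measurable
  also have "\<dots> \<le> liminf (\<lambda>n. \<integral>\<^sup>+x. \<integral>\<^sup>+z. ?h n x z \<partial>lborel \<partial>lborel)"
    by (intro nn_integral_liminf) measurable
  also have "\<dots> \<le> ?N"
    using Liminf_mono[OF always_eventually, of "\<lambda>n. \<integral>\<^sup>+x. \<integral>\<^sup>+z. ?h n x z \<partial>lborel \<partial>lborel" "\<lambda>_. ?N" sequentially] bound
    by (simp add: Liminf_const)
  finally show ?thesis .
qed

section \<open>Square-integrable functions and their classes\<close>

lemma L2_rel_refl: "square_integrable u \<Longrightarrow> L2_rel u u"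
  by (simp add: L2_rel_def)

lemma abs_L2_eqI:
  "square_integrable u \<Longrightarrow> square_integrable v \<Longrightarrow> AE x in lebesgue. u x = v x \<Longrightarrow> abs_L2 u = abs_L2 v"
  by (rule Quotient3_rel_abs[OF Quotient3_L2]) (simp add: L2_rel_def)

lemma rep_abs_L2:
  assumes "square_integrable u"
  shows "AE x in lebesgue. rep_L2 (abs_L2 u) x = u x"
proof -
  have "L2_rel (rep_L2 (abs_L2 u)) u"
    using Quotient3_rel[OF Quotient3_L2, of "rep_L2 (abs_L2 u)" u] assms
    by (simp add: L2_rel_refl square_integrable_rep_L2 abs_rep_L2)
  then show ?thesis by (simp add: L2_rel_def)
qed

lemma abs_L2_add:
  "square_integrable u \<Longrightarrow> square_integrable v \<Longrightarrow> abs_L2 u + abs_L2 v = abs_L2 (\<lambda>x. u x + v x)"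
  by (simp add: plus_L2.abs_eq L2_rel_refl)

lemma abs_L2_diff:
  "square_integrable u \<Longrightarrow> square_integrable v \<Longrightarrow> abs_L2 u - abs_L2 v = abs_L2 (\<lambda>x. u x - v x)"
  by (simp add: minus_L2.abs_eq L2_rel_refl)

lemma abs_L2_scaleC: "square_integrable u \<Longrightarrow> c *\<^sub>C abs_L2 u = abs_L2 (\<lambda>x. c * u x)"
  by (simp add: scaleC_L2.abs_eq L2_rel_refl)

lemma cinner_abs_L2:
  "square_integrable u \<Longrightarrow> square_integrable v \<Longrightarrow>
     cinner (abs_L2 u) (abs_L2 v) = (LINT x|lebesgue. cnj (u x) * v x)"
  by (simp add: cinner_L2.abs_eq L2_rel_refl)

lemma abs_L2_zero: "abs_L2 (\<lambda>x. 0) = 0"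
  by (simp add: zero_L2_def)

lemma norm_abs_L2:
  assumes "square_integrable u"
  shows "ennreal ((norm (abs_L2 u))\<^sup>2) = (\<integral>\<^sup>+x. ennreal ((norm (u x))\<^sup>2) \<partial>lebesgue)"
  using norm_abs_L2_diff[OF assms square_integrable_0] by (simp add: abs_L2_zero)

lemma norm_L2_eq: "ennreal ((norm u)\<^sup>2) = (\<integral>\<^sup>+x. ennreal ((norm (rep_L2 u x))\<^sup>2) \<partial>lebesgue)"
  using norm_abs_L2[OF square_integrable_rep_L2, of u] by (simp add: abs_rep_L2)

lemma square_integrableI:
  assumes "u \<in> borel_measurable lebesgue" "(\<integral>\<^sup>+x. ennreal ((norm (u x))\<^sup>2) \<partial>lebesgue) < \<infinity>"
  shows "square_integrable u"
  using assms unfolding square_integrable_def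
  by (auto intro!: integrableI_bounded)

lemma square_integrable_bound:
  assumes v: "square_integrable v" and u: "u \<in> borel_measurable lebesgue"
    and le: "\<And>x. norm (u x) \<le> norm (v x)"
  shows "square_integrable u"
proof (rule square_integrableI[OF u])
  have "(\<integral>\<^sup>+x. ennreal ((norm (u x))\<^sup>2) \<partial>lebesgue) \<le> (\<integral>\<^sup>+x. ennreal ((norm (v x))\<^sup>2) \<partial>lebesgue)"
    by (intro nn_integral_mono ennreal_leI power_mono le) auto
  also have "\<dots> < \<infinity>" by (simp add: norm_abs_L2[OF v, symmetric])
  finally show "(\<integral>\<^sup>+x. ennreal ((norm (u x))\<^sup>2) \<partial>lebesgue) < \<infinity>" .
qed

lemma square_integrable_indicator_mult:
  assumes "square_integrable u" "A \<in> sets lebesgue"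
  shows "square_integrable (\<lambda>x. indicator A x * u x)"
  by (rule square_integrable_bound[OF assms(1)])
     (use assms in \<open>auto simp: norm_mult indicator_def intro!: borel_measurable_times square_integrable_measurable\<close>)

text \<open>Dominated convergence. It serves two truncations: to balls in \<open>trunc\<close>, and
  to sublevel sets of \<open>g\<close> in the density argument for the domain.\<close>

lemma L2_indicator_tendsto:
  fixes u :: "'a::euclidean_space \<Rightarrow> complex"
  assumes u: "square_integrable u" and A: "\<And>n. A n \<in> sets lebesgue"
    and ev: "\<And>x. \<forall>\<^sub>F n in sequentially. x \<in> A n"
  shows "(\<lambda>n. abs_L2 (\<lambda>x. indicator (A n) x * u x)) \<longlonglongrightarrow> abs_L2 u"
proof -
  note [measurable] = square_integrable_measurable[OF u] A
  have eq: "ennreal ((norm (abs_L2 (\<lambda>x. indicator (A n) x * u x) - abs_L2 u))\<^sup>2)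
      = (\<integral>\<^sup>+x. ennreal ((norm (indicator (A n) x * u x - u x))\<^sup>2) \<partial>lebesgue)" for n
    by (rule norm_abs_L2_diff[OF square_integrable_indicator_mult[OF u A] u])
  have "(\<lambda>n. \<integral>\<^sup>+x. ennreal ((norm (indicator (A n) x * u x - u x))\<^sup>2) \<partial>lebesgue)
      \<longlonglongrightarrow> (\<integral>\<^sup>+x. 0 \<partial>(lebesgue :: 'a measure))"
  proof (rule nn_integral_dominated_convergence[where w = "\<lambda>x. ennreal ((norm (u x))\<^sup>2)"])
    show "(\<integral>\<^sup>+x. ennreal ((norm (u x))\<^sup>2) \<partial>lebesgue) < \<infinity>" by (simp add: norm_abs_L2[OF u, symmetric])
    show "AE x in lebesgue. ennreal ((norm (indicator (A n) x * u x - u x))\<^sup>2) \<le> ennreal ((norm (u x))\<^sup>2)" for n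
      by (rule AE_I2) (auto simp: indicator_def)
    show "AE x in lebesgue. (\<lambda>n. ennreal ((norm (indicator (A n) x * u x - u x))\<^sup>2)) \<longlonglongrightarrow> 0"
    proof (rule AE_I2)
      fix x
      show "(\<lambda>n. ennreal ((norm (indicator (A n) x * u x - u x))\<^sup>2)) \<longlonglongrightarrow> 0"
        by (rule tendsto_eventually) (use ev[of x] in eventually_elim, simp)
    qed
  qed measurable
  then have "(\<lambda>n. ennreal ((norm (abs_L2 (\<lambda>x. indicator (A n) x * u x) - abs_L2 u))\<^sup>2)) \<longlonglongrightarrow> ennreal 0"
    by (simp add: eq)
  then have "(\<lambda>n. (norm (abs_L2 (\<lambda>x. indicator (A n) x * u x) - abs_L2 u))\<^sup>2) \<longlonglongrightarrow> 0"
    by (subst (asm) tendsto_ennreal_iff) auto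
  then have "(\<lambda>n. sqrt ((norm (abs_L2 (\<lambda>x. indicator (A n) x * u x) - abs_L2 u))\<^sup>2)) \<longlonglongrightarrow> sqrt 0"
    by (rule tendsto_real_sqrt)
  then show ?thesis by (simp add: tendsto_norm_zero_iff LIM_zero_iff)
qed

definition L12 :: "('a::euclidean_space \<Rightarrow> complex) \<Rightarrow> bool" where
  "L12 u \<longleftrightarrow> square_integrable u \<and> integrable lebesgue u"

lemma cis_inner_measurable_lebesgue:
  "(\<lambda>x::'a::euclidean_space. \<sigma> * (p \<bullet> x)) \<in> borel_measurable lebesgue"
  by (intro measurable_completion) simp

lemma ft_add: "integrable lebesgue u \<Longrightarrow> integrable lebesgue v \<Longrightarrow> ft \<sigma> (\<lambda>x. u x + v x) p = ft \<sigma> u p + ft \<sigma> v p"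
  by (simp add: ft_def distrib_left integrable_cis_mult cis_inner_measurable_lebesgue)

lemma ft_diff: "integrable lebesgue u \<Longrightarrow> integrable lebesgue v \<Longrightarrow> ft \<sigma> (\<lambda>x. u x - v x) p = ft \<sigma> u p - ft \<sigma> v p"
  by (simp add: ft_def right_diff_distrib integrable_cis_mult cis_inner_measurable_lebesgue)

lemma ft_scale: "ft \<sigma> (\<lambda>x. c * u x) p = c * ft \<sigma> u p"
  unfolding ft_def mult.left_commute[of _ c] integral_mult_right_zero ..

lemma L12_diff: "L12 u \<Longrightarrow> L12 v \<Longrightarrow> L12 (\<lambda>x. u x - v x)"
  and L12_add: "L12 u \<Longrightarrow> L12 v \<Longrightarrow> L12 (\<lambda>x. u x + v x)"
  and L12_scale: "L12 u \<Longrightarrow> L12 (\<lambda>x. c * u x)"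
  by (auto simp: L12_def intro: square_integrable_diff square_integrable_add square_integrable_scale)

lemma L12_borel:
  fixes u :: "'a::euclidean_space \<Rightarrow> complex"
  assumes u: "L12 u"
  obtains v where "v \<in> borel_measurable borel" "integrable lborel v" "L12 v" "AE x in lebesgue. u x = v x"
    "\<And>\<sigma>. ft \<sigma> u = ft \<sigma> v"
proof -
  have um: "u \<in> borel_measurable lebesgue" using u by (auto simp: L12_def square_integrable_def)
  obtain v where v: "v \<in> borel_measurable lborel" "AE x in lborel. u x = v x"
    using completion_ex_borel_measurable_complex[OF um] .
  have vl: "v \<in> borel_measurable lebesgue" using v(1) by (rule measurable_completion)
  have ae: "AE x in lebesgue. u x = v x" using v(2) by (rule AE_completion)
  have "integrable lebesgue v"
    using u integrable_cong_AE[OF um vl ae] by (simp add: L12_def)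
  moreover have "integrable lebesgue (\<lambda>x. (norm (v x))\<^sup>2)"
    using u ae um vl by (subst integrable_cong_AE[of _ _ "\<lambda>x. (norm (u x))\<^sup>2"])
      (auto simp: L12_def square_integrable_def elim: AE_mp)
  ultimately have "L12 v" using vl by (simp add: L12_def square_integrable_def)
  moreover have "integrable lborel v"
    using \<open>integrable lebesgue v\<close> v(1) by (simp add: integrable_completion)
  ultimately show thesis
    using that[of v] v(1) ae ft_cong_AE[OF um vl ae] by simp
qed

lemma ft_L12:
  assumes u: "L12 u" and \<sigma>: "\<sigma> = 1 \<or> \<sigma> = -1"
  shows "square_integrable (ft \<sigma> u)" "norm (abs_L2 (ft \<sigma> u)) \<le> norm (abs_L2 u)"
proof -
  obtain v where v: "v \<in> borel_measurable borel" "integrable lborel v" "L12 v" "AE x in lebesgue. u x = v x"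
    and ftv: "\<And>\<sigma>. ft \<sigma> u = ft \<sigma> v"
    by (rule L12_borel[OF u]) blast
  have m: "ft \<sigma> v \<in> borel_measurable lebesgue"
    using ft_measurable_borel[OF v(1)] by (intro measurable_completion) simp
  have "abs_L2 u = abs_L2 v"
    using u v(3,4) by (intro abs_L2_eqI) (auto simp: L12_def)
  have le: "(\<integral>\<^sup>+p. ennreal ((norm (ft \<sigma> v p))\<^sup>2) \<partial>lebesgue) \<le> ennreal ((norm (abs_L2 u))\<^sup>2)"
    using ft_contraction_borel[OF v(1,2) \<sigma>] v(3)
    by (simp add: \<open>abs_L2 u = abs_L2 v\<close> norm_abs_L2 L12_def nn_integral_completion)
  show sq: "square_integrable (ft \<sigma> u)"
    unfolding ftv by (rule square_integrableI[OF m]) (use le in \<open>auto intro: le_less_trans\<close>)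
  have "ennreal ((norm (abs_L2 (ft \<sigma> u)))\<^sup>2) \<le> ennreal ((norm (abs_L2 u))\<^sup>2)"
    unfolding norm_abs_L2[OF sq] using le by (simp add: ftv)
  then have "(norm (abs_L2 (ft \<sigma> u)))\<^sup>2 \<le> (norm (abs_L2 u))\<^sup>2" by simp
  then show "norm (abs_L2 (ft \<sigma> u)) \<le> norm (abs_L2 u)" by (rule power2_le_imp_le) simp
qed

lemma ft_L12_diff_le:
  assumes u: "L12 u" and v: "L12 v" and \<sigma>: "\<sigma> = 1 \<or> \<sigma> = -1"
  shows "norm (abs_L2 (ft \<sigma> u) - abs_L2 (ft \<sigma> v)) \<le> norm (abs_L2 u - abs_L2 v)"
proof -
  have "ft \<sigma> (\<lambda>x. u x - v x) = (\<lambda>p. ft \<sigma> u p - ft \<sigma> v p)"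
    using u v by (intro ext ft_diff) (auto simp: L12_def)
  then show ?thesis
    using ft_L12(2)[OF L12_diff[OF u v] \<sigma>] ft_L12(1)[OF u \<sigma>] ft_L12(1)[OF v \<sigma>] u v
    by (simp add: abs_L2_diff L12_def)
qed

section \<open>Extension of the transform from integrable functions to all of L2\<close>

definition trunc :: "nat \<Rightarrow> ('a::euclidean_space \<Rightarrow> complex) \<Rightarrow> 'a \<Rightarrow> complex" where
  "trunc n u x = indicator (cball 0 (real n)) x * u x"

lemma L12_trunc:
  fixes u :: "'a::euclidean_space \<Rightarrow> complex"
  assumes u: "square_integrable u"
  shows "L12 (trunc n u)"
proof -
  note [measurable] = square_integrable_measurable[OF u]
  have [measurable]: "cball 0 (real n) \<in> sets (lebesgue :: 'a measure)" by simp
  have "square_integrable (trunc n u)"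
    unfolding trunc_def[abs_def] by (intro square_integrable_indicator_mult u) simp
  moreover have "integrable lebesgue (trunc n u)"
  proof (rule Bochner_Integration.integrable_bound)
    show "integrable lebesgue (\<lambda>x. indicator (cball 0 (real n)) x + (norm (u x))\<^sup>2)"
      using u by (intro Bochner_Integration.integrable_add integrable_real_indicator)
        (auto simp: square_integrable_def emeasure_bounded_finite[OF bounded_cball, simplified])
    show "trunc n u \<in> borel_measurable lebesgue"
      unfolding trunc_def[abs_def] by measurable
    show "AE x in lebesgue. norm (trunc n u x) \<le> norm (indicator (cball 0 (real n)) x + (norm (u x))\<^sup>2)"
    proof (rule AE_I2)
      fix x
      have "2 * norm (u x) \<le> 1 + (norm (u x))\<^sup>2"
        using zero_le_power2[of "norm (u x) - 1"] by (simp add: power2_diff)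
      then have "norm (u x) \<le> 1 + (norm (u x))\<^sup>2" using norm_ge_zero[of "u x"] by linarith
      then show "norm (trunc n u x) \<le> norm (indicator (cball 0 (real n)) x + (norm (u x))\<^sup>2)"
        by (auto simp: trunc_def indicator_def)
    qed
  qed
  ultimately show ?thesis by (simp add: L12_def)
qed

lemma trunc_tendsto:
  assumes "square_integrable u"
  shows "(\<lambda>n. abs_L2 (trunc n u)) \<longlonglongrightarrow> abs_L2 u"
  unfolding trunc_def[abs_def]
proof (rule L2_indicator_tendsto[OF assms])
  fix x :: 'a
  obtain N where "norm x \<le> real N" using real_arch_simple by blast
  then show "\<forall>\<^sub>F n in sequentially. x \<in> cball 0 (real n)"
    by (auto simp: eventually_sequentially intro!: exI[of _ N])
qed simp

definition ftL2 :: "real \<Rightarrow> 'a::euclidean_space L2 \<Rightarrow> 'a L2" where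
  "ftL2 \<sigma> u = lim (\<lambda>n. abs_L2 (ft \<sigma> (trunc n (rep_L2 u))))"

lemma fourier_eq_ftL2: "fourier = ftL2 (-1)"
proof
  fix u :: "'a L2"
  have "(\<lambda>p. complex_of_real ((2 * pi) powr (- real DIM('a) / 2)) *
     (LINT x:cball 0 (real n)|lebesgue. exp (- \<i> * complex_of_real (inner p x)) * rep_L2 u x))
     = ft (-1) (trunc n (rep_L2 u))" for n
    unfolding ft_def trunc_def[abs_def] set_lebesgue_integral_def
    by (intro ext arg_cong2[where f = "(*)"] refl Bochner_Integration.integral_cong)
       (auto simp: cis_conv_exp indicator_def)
  then show "fourier u = ftL2 (-1) u" by (simp add: fourier_def ftL2_def)
qed

context
  fixes \<sigma> :: real
  assumes \<sigma>: "\<sigma> = 1 \<or> \<sigma> = -1"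
begin

text \<open>The limit does not depend on the approximating sequence, because the transform is
  contractive on differences. Linearity, the norm bound and the adjoint relation can then be read
  off from any convenient approximation.\<close>

lemma ftL2_tendsto:
  fixes v :: "nat \<Rightarrow> 'a::euclidean_space \<Rightarrow> complex"
  assumes v: "\<And>n. L12 (v n)" and lim: "(\<lambda>n. abs_L2 (v n)) \<longlonglongrightarrow> u"
  shows "(\<lambda>n. abs_L2 (ft \<sigma> (v n))) \<longlonglongrightarrow> ftL2 \<sigma> u"
proof -
  let ?t = "\<lambda>n. trunc n (rep_L2 u)"
  have t: "L12 (?t n)" for n by (intro L12_trunc square_integrable_rep_L2)
  have tl: "(\<lambda>n. abs_L2 (?t n)) \<longlonglongrightarrow> u"
    using trunc_tendsto[OF square_integrable_rep_L2, of u] by (simp add: abs_rep_L2)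
  have "Cauchy (\<lambda>n. abs_L2 (ft \<sigma> (?t n)))"
  proof (rule CauchyI)
    fix e :: real assume "0 < e"
    then obtain M where "\<And>m n. m \<ge> M \<Longrightarrow> n \<ge> M \<Longrightarrow> norm (abs_L2 (?t m) - abs_L2 (?t n)) < e"
      using LIMSEQ_imp_Cauchy[OF tl] unfolding Cauchy_iff by metis
    then show "\<exists>M. \<forall>m\<ge>M. \<forall>n\<ge>M. norm (abs_L2 (ft \<sigma> (?t m)) - abs_L2 (ft \<sigma> (?t n))) < e"
      using ft_L12_diff_le[OF t t \<sigma>] le_less_trans by blast
  qed
  then have conv: "(\<lambda>n. abs_L2 (ft \<sigma> (?t n))) \<longlonglongrightarrow> ftL2 \<sigma> u"
    unfolding ftL2_def by (simp add: Cauchy_convergent_iff convergent_LIMSEQ_iff)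
  have "(\<lambda>n. abs_L2 (v n) - abs_L2 (?t n)) \<longlonglongrightarrow> u - u" by (intro tendsto_diff lim tl)
  then have "(\<lambda>n. norm (abs_L2 (v n) - abs_L2 (?t n))) \<longlonglongrightarrow> 0" by (simp add: tendsto_norm_zero)
  then have "(\<lambda>n. abs_L2 (ft \<sigma> (v n)) - abs_L2 (ft \<sigma> (?t n))) \<longlonglongrightarrow> 0"
    by (rule Lim_null_comparison[rotated]) (use ft_L12_diff_le[OF v t \<sigma>] in auto)
  from tendsto_add[OF this conv] show ?thesis by simp
qed

lemma ftL2_abs:
  assumes "L12 u" shows "ftL2 \<sigma> (abs_L2 u) = abs_L2 (ft \<sigma> u)"
  using ftL2_tendsto[of "\<lambda>_. u" "abs_L2 u"] assms LIMSEQ_unique tendsto_const by blast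

lemma L2_approx: "\<exists>v. (\<forall>n. L12 (v n)) \<and> (\<lambda>n. abs_L2 (v n)) \<longlonglongrightarrow> u"
  using trunc_tendsto[OF square_integrable_rep_L2, of u]
  by (intro exI[of _ "\<lambda>n. trunc n (rep_L2 u)"]) (simp add: abs_rep_L2 L12_trunc square_integrable_rep_L2)

lemma clinear_ftL2: "clinear (ftL2 \<sigma> :: 'a::euclidean_space L2 \<Rightarrow> 'a L2)"
  unfolding clinear_iff
proof (intro conjI allI)
  fix x y :: "'a L2" and c
  obtain u v where u: "\<And>n. L12 (u n)" "(\<lambda>n. abs_L2 (u n)) \<longlonglongrightarrow> x"
    and v: "\<And>n. L12 (v n)" "(\<lambda>n. abs_L2 (v n)) \<longlonglongrightarrow> y" using L2_approx by metis
  have sq: "square_integrable (u n)" "square_integrable (v n)" for n using u v by (auto simp: L12_def)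
  note fsq = ft_L12(1)[OF u(1) \<sigma>] ft_L12(1)[OF v(1) \<sigma>]
  have "(\<lambda>n. abs_L2 (\<lambda>x. u n x + v n x)) \<longlonglongrightarrow> x + y"
    using tendsto_add[OF u(2) v(2)] sq by (simp add: abs_L2_add)
  from ftL2_tendsto[OF L12_add[OF u(1) v(1)] this]
  have "(\<lambda>n. abs_L2 (ft \<sigma> (\<lambda>x. u n x + v n x))) \<longlonglongrightarrow> ftL2 \<sigma> (x + y)" .
  moreover have "ft \<sigma> (\<lambda>x. u n x + v n x) = (\<lambda>p. ft \<sigma> (u n) p + ft \<sigma> (v n) p)" for n
    using u v by (intro ext ft_add) (auto simp: L12_def)
  ultimately have "(\<lambda>n. abs_L2 (ft \<sigma> (u n)) + abs_L2 (ft \<sigma> (v n))) \<longlonglongrightarrow> ftL2 \<sigma> (x + y)"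
    using fsq by (simp add: abs_L2_add)
  then show "ftL2 \<sigma> (x + y) = ftL2 \<sigma> x + ftL2 \<sigma> y"
    using LIMSEQ_unique tendsto_add[OF ftL2_tendsto[OF u] ftL2_tendsto[OF v]] by blast
  have "(\<lambda>n. abs_L2 (\<lambda>x. c * u n x)) \<longlonglongrightarrow> c *\<^sub>C x"
    using tendsto_scaleC_right[OF u(2)] sq by (simp add: abs_L2_scaleC)
  from ftL2_tendsto[OF L12_scale[OF u(1)] this]
  have "(\<lambda>n. abs_L2 (ft \<sigma> (\<lambda>x. c * u n x))) \<longlonglongrightarrow> ftL2 \<sigma> (c *\<^sub>C x)" .
  moreover have "ft \<sigma> (\<lambda>x. c * u n x) = (\<lambda>p. c * ft \<sigma> (u n) p)" for n
    by (intro ext ft_scale)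
  ultimately have "(\<lambda>n. c *\<^sub>C abs_L2 (ft \<sigma> (u n))) \<longlonglongrightarrow> ftL2 \<sigma> (c *\<^sub>C x)"
    using fsq by (simp add: abs_L2_scaleC)
  then show "ftL2 \<sigma> (c *\<^sub>C x) = c *\<^sub>C ftL2 \<sigma> x"
    using LIMSEQ_unique tendsto_scaleC_right[OF ftL2_tendsto[OF u]] by blast
qed

lemma norm_ftL2_le: "norm (ftL2 \<sigma> u) \<le> norm u"
proof -
  obtain v where v: "\<And>n. L12 (v n)" "(\<lambda>n. abs_L2 (v n)) \<longlonglongrightarrow> u" using L2_approx by metis
  show ?thesis
    by (rule LIMSEQ_le[OF tendsto_norm[OF ftL2_tendsto[OF v]] tendsto_norm[OF v(2)]])
       (use ft_L12(2)[OF v(1) \<sigma>] in auto)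
qed

end

text \<open>Fubini's theorem, which applies because both functions are integrable; conjugation
  reverses the sign of the phase.\<close>

lemma ft_adjoint_L12:
  fixes u v :: "'a::euclidean_space \<Rightarrow> complex"
  assumes u: "L12 u" and v: "L12 v" and \<sigma>: "\<sigma> = 1 \<or> \<sigma> = -1"
  shows "cinner (abs_L2 (ft \<sigma> u)) (abs_L2 v) = cinner (abs_L2 u) (abs_L2 (ft (- \<sigma>) v))"
proof -
  obtain u' where u': "u' \<in> borel_measurable borel" "integrable lborel u'" "L12 u'" "AE x in lebesgue. u x = u' x"
    and ftu: "\<And>\<sigma>. ft \<sigma> u = ft \<sigma> u'" by (rule L12_borel[OF u]) blast
  obtain v' where v': "v' \<in> borel_measurable borel" "integrable lborel v'" "L12 v'" "AE x in lebesgue. v x = v' x"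
    and ftv: "\<And>\<sigma>. ft \<sigma> v = ft \<sigma> v'" by (rule L12_borel[OF v]) blast
  note [measurable] = u'(1) v'(1)
  have [measurable]: "cnj \<in> borel_measurable borel"
    by (intro borel_measurable_continuous_onI continuous_intros)
  have \<sigma>': "- \<sigma> = 1 \<or> - \<sigma> = -1" using \<sigma> by auto
  have abs: "abs_L2 u = abs_L2 u'" "abs_L2 v = abs_L2 v'"
    using u v u' v' by (auto intro!: abs_L2_eqI simp: L12_def)
  define c where "c = (2 * pi) powr (- real DIM('a) / 2)"
  define H where "H p x = cis (- \<sigma> * (p \<bullet> x)) * (v' p * cnj (u' x))" for p x
  have H_int: "integrable (lborel \<Otimes>\<^sub>M lborel) (\<lambda>(p, x). H p x)"
    unfolding H_def split_beta
  proof (intro integrable_cis_mult)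
    show "integrable (lborel \<Otimes>\<^sub>M lborel) (\<lambda>z. v' (fst z) * cnj (u' (snd z)))"
      by (intro integrable_prod_lborel v' integrable_bounded_linear[OF bounded_linear_cnj] u')
    show "(\<lambda>z. - \<sigma> * (fst z \<bullet> snd z)) \<in> borel_measurable (lborel \<Otimes>\<^sub>M lborel)"
      unfolding lborel_prod by (simp, intro borel_measurable_continuous_onI continuous_intros)
  qed
  have "cinner (abs_L2 (ft \<sigma> u)) (abs_L2 v) = (LINT p|lebesgue. cnj (ft \<sigma> u' p) * v' p)"
    unfolding abs ftu using ft_L12(1)[OF u'(3) \<sigma>] v'(3) by (intro cinner_abs_L2) (auto simp: L12_def)
  also have "\<dots> = (LINT p|lborel. cnj (ft \<sigma> u' p) * v' p)"
    by (rule integral_completion) simp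
  also have "\<dots> = (LINT p|lborel. c * (LINT x|lborel. H p x))"
  proof (rule Bochner_Integration.integral_cong[OF refl])
    fix p
    have "cnj (ft \<sigma> u' p) * v' p = c * ((LINT x|lborel. cnj (cis (\<sigma> * (p \<bullet> x)) * u' x)) * v' p)"
      unfolding ft_borel[OF u'(1)] Bochner_Integration.integral_cnj c_def by simp
    also have "(LINT x|lborel. cnj (cis (\<sigma> * (p \<bullet> x)) * u' x)) * v' p = (LINT x|lborel. cnj (cis (\<sigma> * (p \<bullet> x)) * u' x) * v' p)"
      by (rule integral_mult_left_zero[symmetric])
    also have "\<dots> = (LINT x|lborel. H p x)"
      by (intro Bochner_Integration.integral_cong) (simp_all add: H_def cis_cnj mult_ac)
    finally show "cnj (ft \<sigma> u' p) * v' p = c * (LINT x|lborel. H p x)" .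
  qed
  also have "\<dots> = c * (LINT p|lborel. LINT x|lborel. H p x)" by (rule integral_mult_right_zero)
  also have "(LINT p|lborel. LINT x|lborel. H p x) = (LINT x|lborel. LINT p|lborel. H p x)"
    by (rule lborel_pair.Fubini_integral[OF H_int, symmetric])
  also have "c * \<dots> = (LINT x|lborel. c * (LINT p|lborel. H p x))" by (rule integral_mult_right_zero[symmetric])
  also have "\<dots> = (LINT x|lborel. cnj (u' x) * ft (- \<sigma>) v' x)"
  proof (rule Bochner_Integration.integral_cong[OF refl])
    fix x
    have "(LINT p|lborel. H p x) = (LINT p|lborel. cis (- \<sigma> * (x \<bullet> p)) * v' p * cnj (u' x))"
      by (intro Bochner_Integration.integral_cong) (simp_all add: H_def inner_commute mult_ac)
    also have "\<dots> = (LINT p|lborel. cis (- \<sigma> * (x \<bullet> p)) * v' p) * cnj (u' x)" by (rule integral_mult_left_zero)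
    finally show "c * (LINT p|lborel. H p x) = cnj (u' x) * ft (- \<sigma>) v' x"
      unfolding ft_borel[OF v'(1)] c_def by (simp add: mult_ac)
  qed
  also have "\<dots> = (LINT x|lebesgue. cnj (u' x) * ft (- \<sigma>) v' x)"
    by (rule integral_completion[symmetric]) simp
  also have "\<dots> = cinner (abs_L2 u) (abs_L2 (ft (- \<sigma>) v))"
    unfolding abs ftv using ft_L12(1)[OF v'(3) \<sigma>'] u'(3)
    by (intro cinner_abs_L2[symmetric]) (auto simp: L12_def)
  finally show ?thesis .
qed

lemma ftL2_adjoint:
  assumes \<sigma>: "\<sigma> = 1 \<or> \<sigma> = -1"
  shows "cinner (ftL2 \<sigma> x) y = cinner x (ftL2 (- \<sigma>) y)"
proof -
  have \<sigma>': "- \<sigma> = 1 \<or> - \<sigma> = -1" using \<sigma> by auto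
  obtain u where u: "\<And>n. L12 (u n)" "(\<lambda>n. abs_L2 (u n)) \<longlonglongrightarrow> x" using L2_approx by metis
  obtain v where v: "\<And>n. L12 (v n)" "(\<lambda>n. abs_L2 (v n)) \<longlonglongrightarrow> y" using L2_approx by metis
  have 1: "cinner (ftL2 \<sigma> x) (abs_L2 (v m)) = cinner x (abs_L2 (ft (- \<sigma>) (v m)))" for m
    using tendsto_cinner_left[OF ftL2_tendsto[OF \<sigma> u], of "abs_L2 (v m)"]
      tendsto_cinner_left[OF u(2), of "abs_L2 (ft (- \<sigma>) (v m))"]
    by (simp add: ft_adjoint_L12[OF u(1) v(1) \<sigma>] LIMSEQ_unique)
  show ?thesis
    using tendsto_cinner_right[OF v(2), of "ftL2 \<sigma> x"]
      tendsto_cinner_right[OF ftL2_tendsto[OF \<sigma>' v], of x]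
    by (simp add: 1 LIMSEQ_unique)
qed

section \<open>Totality of indicator functions and Fourier inversion\<close>

lemma AE_zero_if_set_integrals_zero:
  fixes r :: "'a \<Rightarrow> real"
  assumes r: "integrable M r" and 0: "\<And>A. A \<in> sets M \<Longrightarrow> (LINT x|M. indicator A x * r x) = 0"
  shows "AE x in M. r x = 0"
proof -
  have [measurable]: "r \<in> borel_measurable M" using r by simp
  have *: "AE x in M. max 0 (s * r x) = 0" if "s = 1 \<or> s = -1" for s :: real
  proof -
    \<comment> \<open>Testing with this set gives the integral of the positive part of
      \<open>s * r\<close>; the two signs of \<open>s\<close> cover both parts of
      \<open>r\<close>.\<close>
    let ?A = "{x \<in> space M. 0 < s * r x}"
    have "(LINT x|M. max 0 (s * r x)) = (LINT x|M. s * (indicator ?A x * r x))"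
      by (intro Bochner_Integration.integral_cong) (auto simp: indicator_def)
    also have "\<dots> = 0" using 0[of ?A] by simp
    finally show ?thesis
      using r by (subst (asm) integral_nonneg_eq_0_iff_AE) (auto intro!: integrable_max)
  qed
  from *[of 1] *[of "-1"] show ?thesis by (auto elim!: AE_mp simp: max_def split: if_splits)
qed

text \<open>Truncation to a ball makes \<open>w\<close> integrable. The sets over which its integral
  vanishes then form a Dynkin system containing the open sets, which are stable under intersection
  and generate the Borel sets.\<close>

lemma AE_zero_if_open_integrals_zero:
  fixes w :: "'a::euclidean_space \<Rightarrow> complex"
  assumes w: "square_integrable w"
    and 0: "\<And>U. open U \<Longrightarrow> bounded U \<Longrightarrow> (LINT x|lebesgue. indicator U x * w x) = 0"
  shows "AE x in lebesgue. w x = 0"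
proof -
  have wm: "w \<in> borel_measurable lebesgue" by (rule square_integrable_measurable[OF w])
  have *: "AE x in lborel. trunc n w x = 0" for n
  proof -
    obtain v where v: "v \<in> borel_measurable borel" "integrable lborel v" "L12 v" "AE x in lebesgue. trunc n w x = v x"
      by (rule L12_borel[OF L12_trunc[OF w, of n]]) blast
    note [measurable] = v(1)
    have v_ball: "(LINT x|lborel. indicator U x * v x) = 0" if U: "open U" for U
    proof -
      have [measurable]: "U \<in> sets borel" using U by simp
      have "(LINT x|lborel. indicator U x * v x) = (LINT x|lebesgue. indicator U x * v x)"
        by (rule integral_completion[symmetric]) simp
      also have "\<dots> = (LINT x|lebesgue. indicator (U \<inter> ball 0 (real n)) x * w x)"
      proof (rule integral_cong_AE)
        \<comment> \<open>\<open>trunc\<close> restricts to closed balls while the test sets must be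
          open; the difference lies in a sphere, a null set.\<close>
        have "sphere 0 (real n) \<in> null_sets (lebesgue :: 'a measure)"
          using negligible_sphere negligible_iff_null_sets by blast
        then have "AE x in lebesgue. (x::'a) \<notin> sphere 0 (real n)" by (rule AE_not_in)
        with v(4) show "AE x in lebesgue. indicator U x * v x = indicator (U \<inter> ball 0 (real n)) x * w x"
          by eventually_elim (auto simp: trunc_def indicator_def split: if_splits)
        show "(\<lambda>x. indicator U x * v x) \<in> borel_measurable lebesgue"
          by (intro measurable_completion) simp
        show "(\<lambda>x. indicator (U \<inter> ball 0 (real n)) x * w x) \<in> borel_measurable lebesgue"
          using wm by (intro borel_measurable_times borel_measurable_indicator) (auto simp: U)
      qed
      also have "\<dots> = 0" using U by (intro 0) auto
      finally show ?thesis .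
    qed
    have eq: "indicator A x *\<^sub>R v x = indicator A x * v x" for A x by (simp add: indicator_def)
    have v_all: "(LINT x:A|lborel. v x) = 0" if "A \<in> sets borel" for A
    proof -
      have set_int: "set_integrable lborel A v" if "A \<in> sets borel" for A
        using integrable_mult_indicator[of A lborel v] v(2) that by (simp add: set_integrable_def)
      have "A \<in> sigma_sets UNIV {S. open S}" using that by (simp add: borel_def)
      then show ?thesis
      proof (rule sigma_sets_induct_disjoint[rotated 2])
        show "Int_stable {S::'a set. open S}" by (auto simp: Int_stable_def)
      next
        fix A :: "'a set" assume "A \<in> {S. open S}"
        then show "(LINT x:A|lborel. v x) = 0"
          using v_ball[of A] by (simp add: set_lebesgue_integral_def eq)
      next
        fix A :: "'a set" assume A: "A \<in> sigma_sets UNIV {S. open S}" "(LINT x:A|lborel. v x) = 0"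
        then have "A \<in> sets borel" by (simp add: borel_def)
        then have "(LINT x:A \<union> (UNIV - A)|lborel. v x) = (LINT x:A|lborel. v x) + (LINT x:(UNIV - A)|lborel. v x)"
          by (intro set_integral_Un set_int) auto
        moreover have "(LINT x:UNIV|lborel. v x) = 0" using v_ball[of UNIV] by (simp add: set_lebesgue_integral_def)
        ultimately show "(LINT x:(UNIV - A)|lborel. v x) = 0" using A(2) by simp
      next
        fix A :: "nat \<Rightarrow> 'a set"
        assume A: "disjoint_family A" "range A \<subseteq> sigma_sets UNIV {S. open S}" "\<And>i. (LINT x:A i|lborel. v x) = 0"
        then have "A i \<in> sets borel" for i by (auto simp: borel_def)
        then have "(LINT x:(\<Union>i. A i)|lborel. v x) = (\<Sum>i. LINT x:A i|lborel. v x)"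
          using A(1) by (intro lebesgue_integral_countable_add set_int)
            (auto simp: disjoint_family_on_def)
        then show "(LINT x:(\<Union>i. A i)|lborel. v x) = 0" using A(3) by simp
      qed (auto simp: set_lebesgue_integral_def)
    qed
    have int: "(LINT x|lborel. indicator A x * v x) = 0" "integrable lborel (\<lambda>x. indicator A x * v x)"
      if "A \<in> sets borel" for A
    proof -
      show "(LINT x|lborel. indicator A x * v x) = 0"
        using v_all[OF that] by (simp add: set_lebesgue_integral_def eq)
      show "integrable lborel (\<lambda>x. indicator A x * v x)"
        using integrable_mult_indicator[of A lborel v] v(2) that by (simp add: eq)
    qed
    have "AE x in lborel. Re (v x) = 0"
    proof (rule AE_zero_if_set_integrals_zero)
      fix A :: "'a set" assume A: "A \<in> sets lborel"
      have "(LINT x|lborel. indicator A x * Re (v x)) = (LINT x|lborel. Re (indicator A x * v x))"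
        by (intro Bochner_Integration.integral_cong) (auto simp: indicator_def)
      also have "\<dots> = Re (LINT x|lborel. indicator A x * v x)"
        using int(2)[of A] A by (intro integral_bounded_linear[OF bounded_linear_Re]) simp
      finally show "(LINT x|lborel. indicator A x * Re (v x)) = 0" using int(1)[of A] A by simp
    qed (rule integrable_bounded_linear[OF bounded_linear_Re v(2)])
    moreover have "AE x in lborel. Im (v x) = 0"
    proof (rule AE_zero_if_set_integrals_zero)
      fix A :: "'a set" assume A: "A \<in> sets lborel"
      have "(LINT x|lborel. indicator A x * Im (v x)) = (LINT x|lborel. Im (indicator A x * v x))"
        by (intro Bochner_Integration.integral_cong) (auto simp: indicator_def)
      also have "\<dots> = Im (LINT x|lborel. indicator A x * v x)"
        using int(2)[of A] A by (intro integral_bounded_linear[OF bounded_linear_Im]) simp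
      finally show "(LINT x|lborel. indicator A x * Im (v x)) = 0" using int(1)[of A] A by simp
    qed (rule integrable_bounded_linear[OF bounded_linear_Im v(2)])
    ultimately have "AE x in lborel. v x = 0" by eventually_elim (simp add: complex_eq_iff)
    moreover have "AE x in lborel. trunc n w x = v x" using v(4) by (simp add: AE_completion_iff)
    ultimately show ?thesis by eventually_elim simp
  qed
  then have "AE x in lborel. \<forall>n. trunc n w x = 0" by (simp add: AE_all_countable)
  then have "AE x in lborel. w x = 0"
  proof eventually_elim
    fix x assume x: "\<forall>n. trunc n w x = 0"
    obtain N where "norm x \<le> real N" using real_arch_simple by blast
    then show "w x = 0" using x[rule_format, of N] by (simp add: trunc_def)
  qed
  then show ?thesis by (rule AE_completion)
qed

lemma cnj_indicator: "cnj (indicator A x) = indicator A x"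
  by (simp add: indicator_def)

text \<open>Write F and G for the transforms with signs \<sigma> and -\<sigma>. Preservation of the
  norm is not a linear condition, so for an indicator e it is first turned into the linear equation
  G F e = e: the squared norm of G F e - e equals that of G F e, minus twice that of F e, plus that
  of e, hence is at most 0. For general u, self-adjointness of G F shows that G F u - u is
  orthogonal to every such e, and the e are total.\<close>

theorem ftL2_inverse:
  fixes u :: "'a::euclidean_space L2"
  assumes \<sigma>: "\<sigma> = 1 \<or> \<sigma> = -1"
  shows "ftL2 (- \<sigma>) (ftL2 \<sigma> u) = u"
proof -
  have \<sigma>': "- \<sigma> = 1 \<or> - \<sigma> = -1" using \<sigma> by auto
  let ?F = "ftL2 \<sigma>" and ?G = "ftL2 (- \<sigma>)"
  have indic: "?G (?F (abs_L2 (indicator U))) = abs_L2 (indicator U)" "square_integrable (indicator U :: 'a \<Rightarrow> complex)"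
    if U: "open U" "bounded U" for U :: "'a set"
  proof -
    have fin: "emeasure lborel U < \<infinity>" using emeasure_bounded_finite[OF U(2)] .
    have Ub: "U \<in> sets borel" using U by simp
    then have m: "(indicator U :: 'a \<Rightarrow> complex) \<in> borel_measurable lebesgue"
      by (intro measurable_completion) simp
    have int: "integrable lebesgue (indicator U :: 'a \<Rightarrow> real)"
      using fin Ub by (intro integrable_real_indicator) auto
    have nm: "(norm (indicator U x :: complex))\<^sup>2 = indicator U x" for x by (simp add: indicator_def)
    show sq: "square_integrable (indicator U :: 'a \<Rightarrow> complex)"
      unfolding square_integrable_def nm using m int by simp
    have "integrable lebesgue (indicator U :: 'a \<Rightarrow> complex)"
      using integrable_of_real[OF int, where 'a=complex] by (simp add: of_real_indicator)
    then have L: "L12 (indicator U :: 'a \<Rightarrow> complex)" using sq by (simp add: L12_def)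
    define e where "e = abs_L2 (indicator U :: 'a \<Rightarrow> complex)"
    have Fe: "?F e = abs_L2 (ft \<sigma> (indicator U))" unfolding e_def by (rule ftL2_abs[OF \<sigma> L])
    have "ennreal ((norm e)\<^sup>2) = emeasure lborel U"
      unfolding e_def norm_abs_L2[OF sq] using Ub by (simp add: nn_integral_completion nm ennreal_indicator)
    also have "\<dots> \<le> ennreal ((norm (?F e))\<^sup>2)"
      using ft_indicator_lower[OF U \<sigma>] by (simp add: Fe norm_abs_L2[OF ft_L12(1)[OF L \<sigma>]] nn_integral_completion)
    finally have ge: "(norm e)\<^sup>2 \<le> (norm (?F e))\<^sup>2" by simp
    have GF: "inner (?G (?F e)) e = (norm (?F e))\<^sup>2"
      using ftL2_adjoint[OF \<sigma>', of "?F e" e] by (simp add: inner_eq_Re_cinner cinner_self)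
    have "norm (?G (?F e)) \<le> norm e"
      using norm_ftL2_le[OF \<sigma>', of "?F e"] norm_ftL2_le[OF \<sigma>, of e] by simp
    then have "(norm (?G (?F e)))\<^sup>2 \<le> (norm e)\<^sup>2" by (intro power_mono) auto
    moreover have "(norm (?G (?F e) - e))\<^sup>2 = (norm (?G (?F e)))\<^sup>2 - 2 * inner (?G (?F e)) e + (norm e)\<^sup>2"
      by (simp add: power2_norm_eq_inner inner_diff inner_commute)
    ultimately have "(norm (?G (?F e) - e))\<^sup>2 \<le> 0" using GF ge by linarith
    then show "?G (?F (abs_L2 (indicator U))) = abs_L2 (indicator U)" by (simp add: e_def)
  qed
  define w where "w = ?G (?F u) - u"
  have "cinner (abs_L2 (indicator U)) w = 0" if U: "open U" "bounded U" for U
  proof -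
    have "cinner (abs_L2 (indicator U)) (?G (?F u)) = cinner (?G (?F (abs_L2 (indicator U)))) u"
      using ftL2_adjoint[OF \<sigma>, of "abs_L2 (indicator U)" "?F u"] ftL2_adjoint[OF \<sigma>', of "?F (abs_L2 (indicator U))" u]
      by simp
    then show ?thesis by (simp add: w_def cinner_diff_right indic[OF U])
  qed
  then have "(LINT x|lebesgue. indicator U x * rep_L2 w x) = 0" if U: "open U" "bounded U" for U
    using cinner_abs_L2[OF indic(2)[OF U] square_integrable_rep_L2, of w] U
    by (simp add: abs_rep_L2 cnj_indicator)
  then have "AE x in lebesgue. rep_L2 w x = 0"
    by (intro AE_zero_if_open_integrals_zero square_integrable_rep_L2)
  then have "abs_L2 (rep_L2 w) = abs_L2 (\<lambda>x. 0)"
    by (intro abs_L2_eqI square_integrable_rep_L2 square_integrable_0)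
  then have "w = 0" by (simp add: abs_rep_L2 abs_L2_zero)
  then show ?thesis by (simp add: w_def)
qed

section \<open>Rumin's inequality for weak-type weights\<close>

text \<open>Used for Tonelli's theorem between levels, measured by \<open>lborel\<close>, and space
  or momentum, measured by \<open>lebesgue\<close>.\<close>

lemma sigma_finite_lebesgue: "sigma_finite_measure (lebesgue :: 'a::euclidean_space measure)"
proof
  obtain A :: "'a set set" where A: "countable A" "A \<subseteq> sets lborel" "\<Union>A = space lborel"
      "\<forall>a\<in>A. emeasure lborel a \<noteq> \<infinity>"
    using lborel.sigma_finite_countable by blast
  then show "\<exists>A. countable A \<and> A \<subseteq> sets (lebesgue :: 'a measure) \<and> \<Union>A = space lebesgue \<and> (\<forall>a\<in>A. emeasure lebesgue a \<noteq> \<infinity>)"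
    by (intro exI[of _ A]) (auto simp: sets_completionI_sets)
qed

interpretation lebesgue: sigma_finite_measure "lebesgue :: 'a::euclidean_space measure"
  by (rule sigma_finite_lebesgue)

interpretation lborel_lebesgue: pair_sigma_finite "lborel :: 'b::euclidean_space measure" "lebesgue :: 'a::euclidean_space measure" ..

section \<open>Layer cake integrals\<close>

lemma nn_integral_powr_tail:
  assumes "q > (2::real)" "0 < \<tau>" "0 \<le> W"
  shows "(\<integral>\<^sup>+s. (if \<tau> \<le> s then ennreal (2 * W * s powr (1 - q)) else 0) \<partial>lborel)
    = ennreal (2 * W / (q - 2) * \<tau> powr (2 - q))"
proof -
  let ?F = "\<lambda>s. - (2 * W / (q - 2)) * s powr (2 - q)"
  have "(\<integral>\<^sup>+s. ennreal (2 * W * s powr (1 - q)) * indicator {\<tau> ..} s \<partial>lborel) = ennreal (0 - ?F \<tau>)"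
  proof (rule nn_integral_FTC_atLeast)
    fix s assume "\<tau> \<le> s"
    then have s: "0 < s" using assms by simp
    then show "(?F has_real_derivative 2 * W * s powr (1 - q)) (at s)"
      by (rule DERIV_cong[OF DERIV_cmult[OF has_real_derivative_powr]]) (use assms in \<open>simp add: field_simps\<close>)
    show "0 \<le> 2 * W * s powr (1 - q)" using assms by simp
  next
    have "((\<lambda>s. s powr (2 - q)) \<longlongrightarrow> 0) at_top"
      using tendsto_neg_powr[of "2 - q" "\<lambda>s. s" at_top] assms by (simp add: filterlim_ident)
    from tendsto_mult_right_zero[OF this, of "- (2 * W / (q - 2))"]
    show "(?F \<longlongrightarrow> 0) at_top" by simp
  qed simp
  also have "(\<integral>\<^sup>+s. ennreal (2 * W * s powr (1 - q)) * indicator {\<tau> ..} s \<partial>lborel)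
     = (\<integral>\<^sup>+s. (if \<tau> \<le> s then ennreal (2 * W * s powr (1 - q)) else 0) \<partial>lborel)"
    by (intro nn_integral_cong) (auto simp: indicator_def)
  finally show ?thesis by simp
qed

lemma square_layer_cake:
  assumes "0 < \<tau>" "\<tau> < (y::real)"
  shows "ennreal (y\<^sup>2) = ennreal (\<tau>\<^sup>2) + (\<integral>\<^sup>+s. (if \<tau> \<le> s \<and> s < y then ennreal (2 * s) else 0) \<partial>lborel)"
proof -
  have "(\<integral>\<^sup>+s. ennreal (2 * s) * indicator {\<tau> .. y} s \<partial>lborel) = y\<^sup>2 - \<tau>\<^sup>2"
  proof (rule nn_integral_FTC_Icc)
    show "((\<lambda>s. s\<^sup>2) has_real_derivative 2 * s) (at s)" for s :: real
      by (auto intro!: derivative_eq_intros)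
  qed (use assms in auto)
  moreover have "(\<integral>\<^sup>+s. ennreal (2 * s) * indicator {\<tau> .. y} s \<partial>lborel)
      = (\<integral>\<^sup>+s. (if \<tau> \<le> s \<and> s < y then ennreal (2 * s) else 0) \<partial>lborel)"
    using AE_lborel_singleton[of y] by (intro nn_integral_cong_AE) (auto simp: indicator_def elim!: AE_mp)
  moreover have "\<tau>\<^sup>2 \<le> y\<^sup>2" using assms by (intro power_mono) auto
  ultimately show ?thesis by (simp add: ennreal_plus[symmetric] del: ennreal_plus)
qed

text \<open>Layer cake above the level \<open>\<tau>\<close>. The level itself contributes
  \<open>W * \<tau> powr (2 - q)\<close> and the higher levels \<open>2 / (q - 2)\<close> times as
  much, where \<open>q > 2\<close> makes the integral converge; the factors add up to
  \<open>q / (q - 2)\<close>.\<close>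

lemma weak_Lp_tail:
  fixes g :: "'a::euclidean_space \<Rightarrow> complex"
  assumes g[measurable]: "g \<in> borel_measurable lebesgue" and q: "q > 2" and W: "0 \<le> W"
    and weak: "\<And>\<tau>. 0 < \<tau> \<Longrightarrow> ennreal (\<tau> powr q) * emeasure lebesgue {x. norm (g x) > \<tau>} \<le> ennreal W"
    and \<tau>: "0 < \<tau>"
  shows "(\<integral>\<^sup>+x. ennreal ((norm (indicator {x. \<tau> < norm (g x)} x * g x))\<^sup>2) \<partial>lebesgue)
    \<le> ennreal (W * (q / (q - 2)) * \<tau> powr (2 - q))"
proof -
  let ?D = "\<lambda>s. emeasure lebesgue {x. s < norm (g x)}"
  have [measurable]: "{x. s < norm (g x)} \<in> sets lebesgue" for s
  proof -
    have "(\<lambda>x. norm (g x)) \<in> borel_measurable lebesgue" by measurable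
    from measurable_sets[OF this, of "{s<..}"] show ?thesis by (simp add: vimage_def)
  qed
  have D: "?D s \<le> ennreal (W * s powr (- q))" if s: "0 < s" for s
  proof -
    have "s powr (- q) * s powr q = 1" using s by (simp add: powr_add[symmetric])
    then have "?D s = ennreal (s powr (- q)) * (ennreal (s powr q) * ?D s)"
      by (simp add: mult.assoc[symmetric] ennreal_mult'[symmetric] del: emeasure_completion)
    also have "\<dots> \<le> ennreal (s powr (- q)) * ennreal W" by (intro mult_left_mono weak s) simp
    also have "\<dots> = ennreal (s powr (- q) * W)" by (rule ennreal_mult'[symmetric]) simp
    finally show ?thesis by (simp only: mult.commute)
  qed
  have "(\<integral>\<^sup>+x. ennreal ((norm (indicator {x. \<tau> < norm (g x)} x * g x))\<^sup>2) \<partial>lebesgue)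
     = (\<integral>\<^sup>+x. ennreal (\<tau>\<^sup>2) * indicator {x. \<tau> < norm (g x)} x
         + (\<integral>\<^sup>+s. (if \<tau> \<le> s \<and> s < norm (g x) then ennreal (2 * s) else 0) \<partial>lborel) \<partial>lebesgue)"
  proof (rule nn_integral_cong)
    fix x
    show "ennreal ((norm (indicator {x. \<tau> < norm (g x)} x * g x))\<^sup>2) = ennreal (\<tau>\<^sup>2) * indicator {x. \<tau> < norm (g x)} x
         + (\<integral>\<^sup>+s. (if \<tau> \<le> s \<and> s < norm (g x) then ennreal (2 * s) else 0) \<partial>lborel)"
    proof (cases "\<tau> < norm (g x)")
      case True
      then show ?thesis using square_layer_cake[OF \<tau> True] by simp
    next
      case False
      then have "(\<integral>\<^sup>+s. (if \<tau> \<le> s \<and> s < norm (g x) then ennreal (2 * s) else 0) \<partial>lborel) = (\<integral>\<^sup>+s. 0 \<partial>(lborel :: real measure))"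
        by (intro nn_integral_cong) auto
      then show ?thesis using False by simp
    qed
  qed
  also have "\<dots> = ennreal (\<tau>\<^sup>2) * ?D \<tau>
     + (\<integral>\<^sup>+x. \<integral>\<^sup>+s. (if \<tau> \<le> s \<and> s < norm (g x) then ennreal (2 * s) else 0) \<partial>lborel \<partial>lebesgue)"
    by (subst nn_integral_add) (simp_all add: nn_integral_cmult)
  also have "(\<integral>\<^sup>+x. \<integral>\<^sup>+s. (if \<tau> \<le> s \<and> s < norm (g x) then ennreal (2 * s) else 0) \<partial>lborel \<partial>lebesgue)
     = (\<integral>\<^sup>+s. \<integral>\<^sup>+x. (if \<tau> \<le> s \<and> s < norm (g x) then ennreal (2 * s) else 0) \<partial>lebesgue \<partial>lborel)"
    by (rule lborel_lebesgue.Fubini') measurable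
  also have "\<dots> \<le> (\<integral>\<^sup>+s. (if \<tau> \<le> s then ennreal (2 * W * s powr (1 - q)) else 0) \<partial>lborel)"
  proof (rule nn_integral_mono)
    fix s
    show "(\<integral>\<^sup>+x. (if \<tau> \<le> s \<and> s < norm (g x) then ennreal (2 * s) else 0) \<partial>lebesgue)
       \<le> (if \<tau> \<le> s then ennreal (2 * W * s powr (1 - q)) else 0)"
    proof (cases "\<tau> \<le> s")
      case True
      then have s: "0 < s" using \<tau> by simp
      have "(\<integral>\<^sup>+x. (if \<tau> \<le> s \<and> s < norm (g x) then ennreal (2 * s) else 0) \<partial>lebesgue)
         = (\<integral>\<^sup>+x. ennreal (2 * s) * indicator {x. s < norm (g x)} x \<partial>lebesgue)"
        using True by (intro nn_integral_cong) (simp add: indicator_def)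
      also have "\<dots> = ennreal (2 * s) * ?D s" by (simp add: nn_integral_cmult)
      also have "\<dots> \<le> ennreal (2 * s) * ennreal (W * s powr (- q))" by (intro mult_left_mono D s) simp
      also have "\<dots> = ennreal (2 * s * (W * s powr (- q)))" using s by (simp add: ennreal_mult'[symmetric])
      also have "2 * s * (W * s powr (- q)) = 2 * W * s powr (1 - q)"
        using s by (simp add: powr_diff powr_minus field_simps)
      finally show ?thesis using True by simp
    qed simp
  qed
  also have "\<dots> = ennreal (2 * W / (q - 2) * \<tau> powr (2 - q))"
    by (rule nn_integral_powr_tail[OF q \<tau> W])
  also have "ennreal (\<tau>\<^sup>2) * ?D \<tau> \<le> ennreal (\<tau>\<^sup>2) * ennreal (W * \<tau> powr (- q))"
    by (intro mult_left_mono D \<tau>) simp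
  also have "\<dots> = ennreal (\<tau>\<^sup>2 * (W * \<tau> powr (- q)))" by (simp add: ennreal_mult'[symmetric])
  also have "\<tau>\<^sup>2 * (W * \<tau> powr (- q)) = W * \<tau> powr (2 - q)"
    using \<tau> by (simp add: powr_diff powr_minus field_simps)
  also have "ennreal (W * \<tau> powr (2 - q)) + ennreal (2 * W / (q - 2) * \<tau> powr (2 - q))
     = ennreal (W * (q / (q - 2)) * \<tau> powr (2 - q))"
    using W q by (simp add: ennreal_plus[symmetric] field_simps del: ennreal_plus)
  finally show ?thesis by (simp add: add_right_mono)
qed

text \<open>The truncated square vanishes for \<open>E\<close> beyond
  \<open>M = (r / b) powr (1 / a)\<close>. Expanding the square on the interval from 0 to
  \<open>M\<close> gives \<open>r\<^sup>2 * M * (1 - 2 / (a + 1) + 1 / (2 * a + 1))\<close>, which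
  is the origin of the rational factor.\<close>

lemma truncated_square_integral:
  fixes r b a :: real
  assumes r: "0 \<le> r" and b: "0 < b" and a: "0 < a"
  shows "ennreal (2 * a\<^sup>2 / ((a + 1) * (2 * a + 1)) * (r\<^sup>2 * (r / b) powr (1 / a)))
    \<le> (\<integral>\<^sup>+E. (if 0 < E then ennreal ((max 0 (r - b * E powr a))\<^sup>2) else 0) \<partial>lborel)"
proof (cases "r = 0")
  case False
  then have r: "0 < r" using r by simp
  define M where "M = (r / b) powr (1 / a)"
  have M: "0 < M" using r b unfolding M_def powr_gt_zero by simp
  have Ma: "M powr a = r / b" unfolding M_def powr_powr using r b a by simp
  define G where "G E = r\<^sup>2 * E - 2 * r * b / (a + 1) * E powr (a + 1) + b\<^sup>2 / (2 * a + 1) * E powr (2 * a + 1)" for E :: real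
  have pc: "continuous_on {0..M} (\<lambda>E. E powr k)" if "0 < k" for k :: real
    by (rule continuous_on_powr') (use that in \<open>auto intro: continuous_on_id continuous_on_const\<close>)
  have "continuous_on {0..M} G"
    unfolding G_def[abs_def]
    by (intro continuous_on_add continuous_on_diff continuous_on_mult continuous_on_const continuous_on_id pc)
       (use a in auto)
  then have "((\<lambda>E::real. (r - b * E powr a)\<^sup>2) has_integral (G M - G 0)) {0..M}"
  proof (rule fundamental_theorem_of_calculus_interior[rotated])
    fix E :: real assume "E \<in> {0<..<M}"
    then have E: "0 < E" by simp
    have "(G has_real_derivative r\<^sup>2 * 1 - 2 * r * b / (a + 1) * ((a + 1) * E powr (a + 1 - 1))
       + b\<^sup>2 / (2 * a + 1) * ((2 * a + 1) * E powr (2 * a + 1 - 1))) (at E)"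
      unfolding G_def[abs_def] using E
      by (intro DERIV_add DERIV_diff DERIV_cmult has_real_derivative_powr DERIV_ident)
    also have "r\<^sup>2 * 1 - 2 * r * b / (a + 1) * ((a + 1) * E powr (a + 1 - 1))
       + b\<^sup>2 / (2 * a + 1) * ((2 * a + 1) * E powr (2 * a + 1 - 1)) = (r - b * E powr a)\<^sup>2"
    proof -
      have "E powr (2 * a) = (E powr a)\<^sup>2" using E by (simp add: powr_power mult.commute)
      moreover have "2 * r * b / (a + 1) * ((a + 1) * z) = 2 * r * b * z" "b\<^sup>2 / (2 * a + 1) * ((2 * a + 1) * z) = b\<^sup>2 * z" for z
        using a by (simp_all add: field_simps)
      ultimately show ?thesis by (simp add: power2_diff power_mult_distrib)
    qed
    finally show "(G has_vector_derivative (r - b * E powr a)\<^sup>2) (at E)"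
      by (simp add: has_real_derivative_iff_has_vector_derivative)
  qed (use M in simp)
  then have "(\<integral>\<^sup>+E. indicator {0..M} E * ennreal ((r - b * E powr a)\<^sup>2) \<partial>lborel) = ennreal (G M - G 0)"
    using nn_integral_has_integral_lebesgue[of "{0..M}" "\<lambda>E. (r - b * E powr a)\<^sup>2" "G M - G 0"]
    by (simp add: ennreal_mult' ennreal_indicator)
  moreover have "G M - G 0 = 2 * a\<^sup>2 / ((a + 1) * (2 * a + 1)) * (r\<^sup>2 * M)"
  proof -
    have "M powr (a + 1) = M powr a * M powr 1" by (rule powr_add)
    then have 1: "M powr (a + 1) = r / b * M" using M Ma by simp
    have "M powr (2 * a + 1) = M powr (2 * a) * M powr 1" by (rule powr_add)
    also have "M powr (2 * a) = (M powr a)\<^sup>2" using M by (simp add: powr_power mult.commute)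
    finally have 2: "M powr (2 * a + 1) = (r / b)\<^sup>2 * M" using M Ma by simp
    have "2 * r * b / (a + 1) * (r / b * M) = M * r\<^sup>2 * (2 / (a + 1))"
      "b\<^sup>2 / (2 * a + 1) * ((r / b)\<^sup>2 * M) = M * r\<^sup>2 * (1 / (2 * a + 1))"
      using b by (simp_all add: power2_eq_square)
    then have "G M - G 0 = M * r\<^sup>2 * (1 - 2 / (a + 1) + 1 / (2 * a + 1))"
      using a by (simp add: G_def 1 2 right_diff_distrib distrib_left)
    also have "1 - 2 / (a + 1) + 1 / (2 * a + 1) = 2 * a\<^sup>2 / ((a + 1) * (2 * a + 1))"
    proof -
      have "1 - 2 / x + 1 / y = (x * y - 2 * y + x) / (x * y)" if "x \<noteq> 0" "y \<noteq> 0" for x y :: real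
        using that by (simp add: field_simps)
      from this[of "a + 1" "2 * a + 1"]
      have "1 - 2 / (a + 1) + 1 / (2 * a + 1)
        = ((a + 1) * (2 * a + 1) - 2 * (2 * a + 1) + (a + 1)) / ((a + 1) * (2 * a + 1))"
        using a by simp
      also have "(a + 1) * (2 * a + 1) - 2 * (2 * a + 1) + (a + 1) = 2 * a\<^sup>2"
        by (simp add: algebra_simps power2_eq_square)
      finally show ?thesis .
    qed
    finally show ?thesis by (simp add: mult_ac)
  qed
  moreover have "(\<integral>\<^sup>+E. indicator {0..M} E * ennreal ((r - b * E powr a)\<^sup>2) \<partial>lborel)
     \<le> (\<integral>\<^sup>+E. (if 0 < E then ennreal ((max 0 (r - b * E powr a))\<^sup>2) else 0) \<partial>lborel)"
  proof (rule nn_integral_mono_AE)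
    \<comment> \<open>The point \<open>E = 0\<close> is excluded because the right-hand side is
      defined to be 0 there.\<close>
    show "AE E in lborel. indicator {0..M} E * ennreal ((r - b * E powr a)\<^sup>2)
       \<le> (if 0 < E then ennreal ((max 0 (r - b * E powr a))\<^sup>2) else 0)"
      using AE_lborel_singleton[of "0::real"]
    proof eventually_elim
      fix E :: real assume "E \<noteq> 0"
      show "indicator {0..M} E * ennreal ((r - b * E powr a)\<^sup>2)
         \<le> (if 0 < E then ennreal ((max 0 (r - b * E powr a))\<^sup>2) else 0)"
      proof (cases "E \<in> {0..M}")
        case True
        then have E: "0 < E" using \<open>E \<noteq> 0\<close> by simp
        have "E powr a \<le> M powr a" using True a by (intro powr_mono2) auto
        then have "b * E powr a \<le> r" using Ma b by (simp add: field_simps)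
        then show ?thesis using E True by (simp add: max_def)
      qed simp
    qed
  qed
  ultimately show ?thesis by (simp add: M_def)
qed simp

text \<open>\<open>W\<close> is any positive upper bound for the q-th power of the weak quasi-norm
  rather than that power itself. This keeps \<open>A\<close> and \<open>B\<close> positive when
  \<open>g\<close> vanishes almost everywhere, and allows cutoffs of \<open>g\<close> to share one
  \<open>W\<close>.\<close>

locale weak_Lp_weight =
  fixes g :: "'a::euclidean_space \<Rightarrow> complex" and q W :: real
  assumes g_measurable [measurable]: "g \<in> borel_measurable lebesgue"
    and q: "2 < q" and W: "0 < W"
    and weak: "\<And>\<tau>. 0 < \<tau> \<Longrightarrow> ennreal (\<tau> powr q) * emeasure lebesgue {x. norm (g x) > \<tau>} \<le> ennreal W"
begin

text \<open>The tail constant of \<open>weak_Lp_tail\<close> times the square of the normalising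
  factor of the transform.\<close>

definition "A = (2 * pi) powr (- real DIM('a)) * (W * (q / (q - 2)))"

lemma A_pos: "0 < A"
  using q W by (simp add: A_def)

lemma superlevel_measurable [measurable]: "{p. \<tau> < norm (g p)} \<in> sets lebesgue"
proof -
  have "(\<lambda>x. norm (g x)) \<in> borel_measurable lebesgue" by measurable
  from measurable_sets[OF this, of "{\<tau><..}"] show ?thesis by (simp add: vimage_def)
qed

text \<open>The splitting is by the size of \<open>g\<close>, not by the size of the
  momentum.\<close>

definition high :: "real \<Rightarrow> 'a L2 \<Rightarrow> 'a \<Rightarrow> complex" where
  "high \<tau> \<psi> p = indicator {p. \<tau> < norm (g p)} p * (g p * rep_L2 \<psi> p)"

definition low :: "real \<Rightarrow> 'a L2 \<Rightarrow> 'a \<Rightarrow> complex" where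
  "low \<tau> \<psi> p = indicator {p. norm (g p) \<le> \<tau>} p * (g p * rep_L2 \<psi> p)"

lemma high_square_integrable:
  "square_integrable (\<lambda>p. g p * rep_L2 \<psi> p) \<Longrightarrow> square_integrable (high \<tau> \<psi>)"
  unfolding high_def[abs_def] by (rule square_integrable_indicator_mult) auto

lemma low_square_integrable:
  assumes "square_integrable (\<lambda>p. g p * rep_L2 \<psi> p)"
  shows "square_integrable (low \<tau> \<psi>)"
proof -
  have "{p. norm (g p) \<le> \<tau>} = space lebesgue - {p. \<tau> < norm (g p)}" by auto
  then have "{p. norm (g p) \<le> \<tau>} \<in> sets lebesgue" by (metis superlevel_measurable sets.compl_sets)
  then show ?thesis unfolding low_def[abs_def] by (rule square_integrable_indicator_mult[OF assms])
qed

text \<open>At a fixed point \<open>x\<close>, the inverse transform of \<open>high \<tau> \<psi>\<close> is the inner product of \<open>\<psi>\<close> with a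
  vector independent of \<open>\<psi>\<close>, so that Bessel's inequality bounds the sum over \<open>\<Psi>\<close>.\<close>

lemma high_frequency_bound:
  assumes \<Psi>: "finite \<Psi>" "corthonormal \<Psi>" and \<tau>: "0 < \<tau>"
    and sq: "\<And>\<psi>. \<psi> \<in> \<Psi> \<Longrightarrow> square_integrable (\<lambda>p. g p * rep_L2 \<psi> p)"
  shows "AE x in lebesgue. (\<Sum>\<psi>\<in>\<Psi>. (norm (rep_L2 (ftL2 1 (abs_L2 (high \<tau> \<psi>))) x))\<^sup>2) \<le> A * \<tau> powr (2 - q)"
proof -
  define m where "m p = indicator {p. \<tau> < norm (g p)} p * g p" for p
  have m_meas [measurable]: "m \<in> borel_measurable lebesgue" unfolding m_def by measurable
  have tail: "(\<integral>\<^sup>+p. ennreal ((norm (m p))\<^sup>2) \<partial>lebesgue) \<le> ennreal (W * (q / (q - 2)) * \<tau> powr (2 - q))"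
    unfolding m_def by (rule weak_Lp_tail[OF g_measurable q less_imp_le[OF W] weak \<tau>])
  then have m: "square_integrable m"
    by (intro square_integrableI m_meas) (auto intro: le_less_trans)
  have cm: "square_integrable (\<lambda>p. cnj (m p))"
    using m borel_measurable_cnj_mult[OF m, of "\<lambda>_. 1"] unfolding square_integrable_def
    by (auto intro!: measurable_compose[OF m_meas] borel_measurable_continuous_onI continuous_intros)
  have high_eq: "high \<tau> \<psi> p = m p * rep_L2 \<psi> p" for \<psi> p by (simp add: high_def m_def)
  \<comment> \<open>A product of two square-integrable functions is integrable, so the transform is
    a genuine integral and can be evaluated at each point.\<close>
  have L: "L12 (high \<tau> \<psi>)" if "\<psi> \<in> \<Psi>" for \<psi>
    unfolding L12_def
  proof
    show "square_integrable (high \<tau> \<psi>)" using sq[OF that] by (rule high_square_integrable)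
    have "integrable lebesgue (\<lambda>p. cnj (cnj (m p)) * rep_L2 \<psi> p)"
      by (rule integrable_cnj_mult[OF cm square_integrable_rep_L2])
    then show "integrable lebesgue (high \<tau> \<psi>)" by (simp add: high_eq[abs_def])
  qed
  have "AE x in lebesgue. \<forall>\<psi>\<in>\<Psi>. rep_L2 (ftL2 1 (abs_L2 (high \<tau> \<psi>))) x = ft 1 (high \<tau> \<psi>) x"
  proof (rule AE_finite_allI[OF \<Psi>(1)])
    fix \<psi> assume "\<psi> \<in> \<Psi>"
    then show "AE x in lebesgue. rep_L2 (ftL2 1 (abs_L2 (high \<tau> \<psi>))) x = ft 1 (high \<tau> \<psi>) x"
      using rep_abs_L2[OF ft_L12(1)[OF L, of \<psi> 1]] ftL2_abs[OF _ L, of 1 \<psi>] by simp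
  qed
  then show ?thesis
  proof eventually_elim
    fix x assume rep: "\<forall>\<psi>\<in>\<Psi>. rep_L2 (ftL2 1 (abs_L2 (high \<tau> \<psi>))) x = ft 1 (high \<tau> \<psi>) x"
    define c where "c = (2 * pi) powr (- real DIM('a) / 2)"
    \<comment> \<open>The vector that represents evaluation at \<open>x\<close> on the large values
      of \<open>g\<close>. The phase has modulus 1, so its norm is that of \<open>m\<close> for
      every \<open>x\<close>.\<close>
    define e where "e p = cis (- (x \<bullet> p)) * cnj (m p)" for p
    have e: "square_integrable e"
    proof (rule square_integrable_bound[OF m])
      have "(\<lambda>p. cis (- (x \<bullet> p))) \<in> borel_measurable lebesgue" by (intro measurable_completion) simp
      then show "e \<in> borel_measurable lebesgue"
        unfolding e_def[abs_def] using square_integrable_measurable[OF cm] by (rule borel_measurable_times)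
    qed (simp add: e_def norm_mult)
    have "ennreal ((norm (abs_L2 e))\<^sup>2) = (\<integral>\<^sup>+p. ennreal ((norm (m p))\<^sup>2) \<partial>lebesgue)"
      by (simp add: norm_abs_L2[OF e] e_def norm_mult)
    also note tail
    finally have e_norm: "(norm (abs_L2 e))\<^sup>2 \<le> W * (q / (q - 2)) * \<tau> powr (2 - q)"
      using q W by (subst (asm) ennreal_le_iff) auto
    have ft_eq: "(norm (ft 1 (high \<tau> \<psi>) x))\<^sup>2 = c\<^sup>2 * (norm (cinner \<psi> (abs_L2 e)))\<^sup>2" for \<psi>
    proof -
      have "cinner (abs_L2 e) \<psi> = (LINT p|lebesgue. cnj (e p) * rep_L2 \<psi> p)"
        using cinner_abs_L2[OF e square_integrable_rep_L2, of \<psi>] by (simp add: abs_rep_L2)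
      also have "\<dots> = (LINT p|lebesgue. cis (1 * (x \<bullet> p)) * high \<tau> \<psi> p)"
        by (intro Bochner_Integration.integral_cong) (simp_all add: e_def high_eq cis_cnj mult_ac)
      finally have "ft 1 (high \<tau> \<psi>) x = of_real c * cinner (abs_L2 e) \<psi>"
        by (simp only: ft_def c_def)
      moreover have "norm (cinner (abs_L2 e) \<psi>) = norm (cinner \<psi> (abs_L2 e))"
        by (subst cinner_commute) simp
      ultimately show ?thesis by (simp add: norm_mult power_mult_distrib)
    qed
    have "(\<Sum>\<psi>\<in>\<Psi>. (norm (rep_L2 (ftL2 1 (abs_L2 (high \<tau> \<psi>))) x))\<^sup>2)
        = c\<^sup>2 * (\<Sum>\<psi>\<in>\<Psi>. (norm (cinner \<psi> (abs_L2 e)))\<^sup>2)"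
      using rep by (simp add: ft_eq sum_distrib_left)
    also have "\<dots> \<le> c\<^sup>2 * (norm (abs_L2 e))\<^sup>2"
      by (intro mult_left_mono Bessel_inequality \<Psi>) simp
    also have "\<dots> \<le> c\<^sup>2 * (W * (q / (q - 2)) * \<tau> powr (2 - q))"
      by (intro mult_left_mono e_norm) simp
    also have "c\<^sup>2 = (2 * pi) powr (- real DIM('a))" by (simp add: c_def powr_power)
    finally show "(\<Sum>\<psi>\<in>\<Psi>. (norm (rep_L2 (ftL2 1 (abs_L2 (high \<tau> \<psi>))) x))\<^sup>2) \<le> A * \<tau> powr (2 - q)"
      by (simp only: A_def mult.assoc)
  qed
qed

text \<open>The function \<rho> of the overview; its argument is the set of the Fourier transforms
  \<open>\<psi>\<close>.\<close>

definition particle_density :: "'a L2 set \<Rightarrow> 'a \<Rightarrow> real" where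
  "particle_density \<Psi> x = (\<Sum>\<psi>\<in>\<Psi>. (norm (rep_L2 (ftL2 1 (abs_L2 (\<lambda>p. g p * rep_L2 \<psi> p))) x))\<^sup>2)"

lemma particle_density_measurable [measurable]: "particle_density \<Psi> \<in> borel_measurable lebesgue"
  unfolding particle_density_def[abs_def]
  using square_integrable_measurable[OF square_integrable_rep_L2] by measurable

lemma particle_density_nonneg: "0 \<le> particle_density \<Psi> x"
  by (simp add: particle_density_def sum_nonneg)

lemma norm_ftL2_eq: "norm (ftL2 1 u) = norm u"
  using norm_ftL2_le[of 1 u] norm_ftL2_le[of "-1" "ftL2 1 u"] ftL2_inverse[of 1 u] by simp

text \<open>At almost every point the triangle inequality for the l2 norm over \<open>\<Psi>\<close>
  bounds the root of \<rho> by the sum of the roots of the two contributions, and the first obeys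
  the Bessel bound. After integration, unitarity carries the other one back to momentum
  space.\<close>

lemma low_frequency_bound:
  assumes \<Psi>: "finite \<Psi>" "corthonormal \<Psi>" and \<tau>: "0 < \<tau>"
    and sq: "\<And>\<psi>. \<psi> \<in> \<Psi> \<Longrightarrow> square_integrable (\<lambda>p. g p * rep_L2 \<psi> p)"
  shows "(\<integral>\<^sup>+x. ennreal ((max 0 (sqrt (particle_density \<Psi> x) - sqrt (A * \<tau> powr (2 - q))))\<^sup>2) \<partial>lebesgue)
    \<le> (\<Sum>\<psi>\<in>\<Psi>. \<integral>\<^sup>+p. ennreal ((norm (low \<tau> \<psi> p))\<^sup>2) \<partial>lebesgue)"
proof -
  let ?H = "\<lambda>\<psi>. ftL2 1 (abs_L2 (high \<tau> \<psi>))" and ?L = "\<lambda>\<psi>. ftL2 1 (abs_L2 (low \<tau> \<psi>))"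
  let ?U = "\<lambda>\<psi>. ftL2 1 (abs_L2 (\<lambda>p. g p * rep_L2 \<psi> p))"
  have split: "AE x in lebesgue. \<forall>\<psi>\<in>\<Psi>. rep_L2 (?U \<psi>) x = rep_L2 (?H \<psi>) x + rep_L2 (?L \<psi>) x"
  proof (rule AE_finite_allI[OF \<Psi>(1)])
    fix \<psi> assume "\<psi> \<in> \<Psi>"
    note s = sq[OF this] high_square_integrable[OF sq[OF this], of \<tau>] low_square_integrable[OF sq[OF this], of \<tau>]
    have "(\<lambda>p. high \<tau> \<psi> p + low \<tau> \<psi> p) = (\<lambda>p. g p * rep_L2 \<psi> p)"
      by (auto simp: high_def low_def indicator_def)
    then have "abs_L2 (\<lambda>p. g p * rep_L2 \<psi> p) = abs_L2 (high \<tau> \<psi>) + abs_L2 (low \<tau> \<psi>)"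
      using abs_L2_add[OF s(2,3)] by simp
    then have "?U \<psi> = ?H \<psi> + ?L \<psi>"
      by (simp add: clinearD(1)[OF clinear_ftL2[of 1]])
    also have "\<dots> = abs_L2 (\<lambda>x. rep_L2 (?H \<psi>) x + rep_L2 (?L \<psi>) x)"
      using abs_L2_add[OF square_integrable_rep_L2 square_integrable_rep_L2, of "?H \<psi>" "?L \<psi>"] by (simp add: abs_rep_L2)
    finally show "AE x in lebesgue. rep_L2 (?U \<psi>) x = rep_L2 (?H \<psi>) x + rep_L2 (?L \<psi>) x"
      using rep_abs_L2[OF square_integrable_add[OF square_integrable_rep_L2 square_integrable_rep_L2, of "?H \<psi>" "?L \<psi>"]]
      by simp
  qed
  have hf: "AE x in lebesgue. (\<Sum>\<psi>\<in>\<Psi>. (norm (rep_L2 (?H \<psi>) x))\<^sup>2) \<le> A * \<tau> powr (2 - q)"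
    by (rule high_frequency_bound[OF \<Psi> \<tau>]) (rule sq)
  have "AE x in lebesgue. ennreal ((max 0 (sqrt (particle_density \<Psi> x) - sqrt (A * \<tau> powr (2 - q))))\<^sup>2)
      \<le> (\<Sum>\<psi>\<in>\<Psi>. ennreal ((norm (rep_L2 (?L \<psi>) x))\<^sup>2))"
    using split hf
  proof eventually_elim
    fix x
    assume 1: "\<forall>\<psi>\<in>\<Psi>. rep_L2 (?U \<psi>) x = rep_L2 (?H \<psi>) x + rep_L2 (?L \<psi>) x"
      and 2: "(\<Sum>\<psi>\<in>\<Psi>. (norm (rep_L2 (?H \<psi>) x))\<^sup>2) \<le> A * \<tau> powr (2 - q)"
    let ?S = "\<Sum>\<psi>\<in>\<Psi>. (norm (rep_L2 (?L \<psi>) x))\<^sup>2"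
    have "sqrt (particle_density \<Psi> x) \<le> L2_set (\<lambda>\<psi>. norm (rep_L2 (?H \<psi>) x) + norm (rep_L2 (?L \<psi>) x)) \<Psi>"
      unfolding particle_density_def L2_set_def
      by (intro real_sqrt_le_mono sum_mono power_mono) (use 1 in \<open>auto intro: norm_triangle_ineq\<close>)
    also have "\<dots> \<le> L2_set (\<lambda>\<psi>. norm (rep_L2 (?H \<psi>) x)) \<Psi> + L2_set (\<lambda>\<psi>. norm (rep_L2 (?L \<psi>) x)) \<Psi>"
      by (rule L2_set_triangle_ineq)
    also have "\<dots> \<le> sqrt (A * \<tau> powr (2 - q)) + sqrt ?S"
      unfolding L2_set_def using 2 by (intro add_right_mono real_sqrt_le_mono)
    finally have "max 0 (sqrt (particle_density \<Psi> x) - sqrt (A * \<tau> powr (2 - q))) \<le> sqrt ?S"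
      by (simp add: sum_nonneg)
    then have "(max 0 (sqrt (particle_density \<Psi> x) - sqrt (A * \<tau> powr (2 - q))))\<^sup>2 \<le> (sqrt ?S)\<^sup>2"
      by (intro power_mono) auto
    also have "(sqrt ?S)\<^sup>2 = ?S" by (simp add: sum_nonneg)
    finally show "ennreal ((max 0 (sqrt (particle_density \<Psi> x) - sqrt (A * \<tau> powr (2 - q))))\<^sup>2)
      \<le> (\<Sum>\<psi>\<in>\<Psi>. ennreal ((norm (rep_L2 (?L \<psi>) x))\<^sup>2))"
      by (simp add: ennreal_leI)
  qed
  then have "(\<integral>\<^sup>+x. ennreal ((max 0 (sqrt (particle_density \<Psi> x) - sqrt (A * \<tau> powr (2 - q))))\<^sup>2) \<partial>lebesgue)
    \<le> (\<integral>\<^sup>+x. (\<Sum>\<psi>\<in>\<Psi>. ennreal ((norm (rep_L2 (?L \<psi>) x))\<^sup>2)) \<partial>lebesgue)"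
    by (rule nn_integral_mono_AE)
  also have "\<dots> = (\<Sum>\<psi>\<in>\<Psi>. \<integral>\<^sup>+x. ennreal ((norm (rep_L2 (?L \<psi>) x))\<^sup>2) \<partial>lebesgue)"
    using square_integrable_measurable[OF square_integrable_rep_L2]
    by (intro nn_integral_sum) measurable
  also have "\<dots> = (\<Sum>\<psi>\<in>\<Psi>. \<integral>\<^sup>+p. ennreal ((norm (low \<tau> \<psi> p))\<^sup>2) \<partial>lebesgue)"
    by (intro sum.cong refl)
       (simp add: norm_L2_eq[symmetric] norm_ftL2_eq norm_abs_L2 low_square_integrable sq)
  finally show ?thesis .
qed

text \<open>The layer cake identity \<open>\<integral>\<^sub>0\<^sup>\<infinity> 1(|g p|\<^sup>2 \<le> 1/E) |g p|\<^sup>2 dE = 1\<close> (for \<open>g p \<noteq> 0\<close>), as in Rumin's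
  proof of the CLR bound.\<close>

lemma integral_low_le:
  "(\<integral>\<^sup>+E. (if 0 < E then \<integral>\<^sup>+p. ennreal ((norm (low (1 / sqrt E) \<psi> p))\<^sup>2) \<partial>lebesgue else 0) \<partial>lborel)
    \<le> ennreal ((norm \<psi>)\<^sup>2)"
proof -
  note [measurable] = square_integrable_measurable[OF square_integrable_rep_L2]
  have "(\<integral>\<^sup>+E. (if 0 < E then \<integral>\<^sup>+p. ennreal ((norm (low (1 / sqrt E) \<psi> p))\<^sup>2) \<partial>lebesgue else 0) \<partial>lborel)
     = (\<integral>\<^sup>+E. \<integral>\<^sup>+p. (if 0 < E \<and> norm (g p) \<le> 1 / sqrt E then ennreal ((norm (g p * rep_L2 \<psi> p))\<^sup>2) else 0) \<partial>lebesgue \<partial>lborel)"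
    by (intro nn_integral_cong) (auto simp: low_def indicator_def intro!: nn_integral_cong)
  also have "\<dots> = (\<integral>\<^sup>+p. \<integral>\<^sup>+E. (if 0 < E \<and> norm (g p) \<le> 1 / sqrt E then ennreal ((norm (g p * rep_L2 \<psi> p))\<^sup>2) else 0) \<partial>lborel \<partial>lebesgue)"
    by (rule lborel_lebesgue.Fubini'[symmetric]) measurable
  also have "\<dots> \<le> (\<integral>\<^sup>+p. ennreal ((norm (rep_L2 \<psi> p))\<^sup>2) \<partial>lebesgue)"
  proof (rule nn_integral_mono)
    fix p
    show "(\<integral>\<^sup>+E. (if 0 < E \<and> norm (g p) \<le> 1 / sqrt E then ennreal ((norm (g p * rep_L2 \<psi> p))\<^sup>2) else 0) \<partial>lborel)
       \<le> ennreal ((norm (rep_L2 \<psi> p))\<^sup>2)"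
    proof (cases "g p = 0")
      case False
      define y where "y = norm (g p)"
      have y: "0 < y" using False by (simp add: y_def)
      have "(\<integral>\<^sup>+E. (if 0 < E \<and> norm (g p) \<le> 1 / sqrt E then ennreal ((norm (g p * rep_L2 \<psi> p))\<^sup>2) else 0) \<partial>lborel)
         \<le> (\<integral>\<^sup>+E. ennreal ((norm (g p * rep_L2 \<psi> p))\<^sup>2) * indicator {0 .. 1 / y\<^sup>2} E \<partial>lborel)"
      proof (rule nn_integral_mono)
        fix E :: real
        have "E \<in> {0 .. 1 / y\<^sup>2}" if E: "0 < E" "y \<le> 1 / sqrt E"
        proof -
          have "y\<^sup>2 \<le> (1 / sqrt E)\<^sup>2" using E y by (intro power_mono) auto
          then have "y\<^sup>2 \<le> 1 / E" using E by (simp add: power_divide)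
          then show ?thesis using E y by (simp add: field_simps)
        qed
        then show "(if 0 < E \<and> norm (g p) \<le> 1 / sqrt E then ennreal ((norm (g p * rep_L2 \<psi> p))\<^sup>2) else 0)
           \<le> ennreal ((norm (g p * rep_L2 \<psi> p))\<^sup>2) * indicator {0 .. 1 / y\<^sup>2} E"
          by (simp add: y_def)
      qed
      also have "\<dots> = ennreal ((norm (g p * rep_L2 \<psi> p))\<^sup>2) * ennreal (1 / y\<^sup>2)"
        by (simp add: nn_integral_cmult)
      also have "\<dots> = ennreal ((norm (rep_L2 \<psi> p))\<^sup>2)"
        using y by (simp add: ennreal_mult'[symmetric] norm_mult power_mult_distrib y_def[symmetric])
      finally show ?thesis .
    qed (simp cong: if_cong)
  qed
  also have "\<dots> = ennreal ((norm \<psi>)\<^sup>2)" by (rule norm_L2_eq[symmetric])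
  finally show ?thesis .
qed

text \<open>The reciprocal of the constant in \<open>truncated_square_integral\<close> for
  \<open>b = sqrt A\<close> and \<open>a = (q - 2) / 4\<close>, with the power of \<open>A\<close>
  included.\<close>

definition "B = A powr (2 / (q - 2)) * (q * (q + 2) / (q - 2)\<^sup>2)"

lemma B_pos: "0 < B"
  using A_pos q by (simp add: B_def)

lemma particle_density_power_bound:
  assumes \<Psi>: "finite \<Psi>" "corthonormal \<Psi>"
    and sq: "\<And>\<psi>. \<psi> \<in> \<Psi> \<Longrightarrow> square_integrable (\<lambda>p. g p * rep_L2 \<psi> p)"
  shows "(\<integral>\<^sup>+x. ennreal (particle_density \<Psi> x powr (q / (q - 2)) / B) \<partial>lebesgue) \<le> ennreal (card \<Psi>)"
proof -
  \<comment> \<open>The level \<open>\<tau> = 1 / sqrt E\<close> turns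
    \<open>\<tau> powr (2 - q)\<close> into \<open>E powr (2 * a)\<close>.\<close>
  define a where "a = (q - 2) / 4"
  have a: "0 < a" using q by (simp add: a_def)
  let ?r = "\<lambda>x. sqrt (particle_density \<Psi> x)"
  let ?F = "\<lambda>E x. (if 0 < E then ennreal ((max 0 (?r x - sqrt A * E powr a))\<^sup>2) else 0)"
  have const: "particle_density \<Psi> x powr (q / (q - 2)) / B
      = 2 * a\<^sup>2 / ((a + 1) * (2 * a + 1)) * ((?r x)\<^sup>2 * (?r x / sqrt A) powr (1 / a))" for x
  proof (cases "particle_density \<Psi> x = 0")
    case False
    then have \<rho>: "0 < particle_density \<Psi> x" using particle_density_nonneg[of \<Psi> x] by simp
    have e: "a + 1 = (q + 2) / 4" "2 * a + 1 = q / 2" "2 * a\<^sup>2 = (q - 2)\<^sup>2 / 8"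
      by (simp_all add: a_def field_simps power2_eq_square)
    have c: "2 * a\<^sup>2 / ((a + 1) * (2 * a + 1)) = (q - 2)\<^sup>2 / (q * (q + 2))"
      unfolding e by (simp add: mult.commute)
    have half: "1 / 2 * (1 / a) = 2 / (q - 2)" by (simp add: a_def)
    have "(?r x / sqrt A) powr (1 / a) = ((particle_density \<Psi> x / A) powr (1 / 2)) powr (1 / a)"
      using \<rho> A_pos by (simp add: powr_half_sqrt real_sqrt_divide)
    also have "\<dots> = (particle_density \<Psi> x / A) powr (2 / (q - 2))" by (simp only: powr_powr half)
    also have "\<dots> = particle_density \<Psi> x powr (2 / (q - 2)) / A powr (2 / (q - 2))"
      using \<rho> A_pos by (simp add: powr_divide)
    finally have 1: "(?r x / sqrt A) powr (1 / a) = particle_density \<Psi> x powr (2 / (q - 2)) / A powr (2 / (q - 2))" .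
    have "q / (q - 2) = 1 + 2 / (q - 2)" using q by (simp add: field_simps)
    then have 2: "particle_density \<Psi> x powr (q / (q - 2)) = particle_density \<Psi> x * particle_density \<Psi> x powr (2 / (q - 2))"
      using \<rho> by (simp add: powr_add)
    show ?thesis unfolding 1 2 c B_def using \<rho> by (simp add: mult_ac)
  qed simp
  have "(\<integral>\<^sup>+x. ennreal (particle_density \<Psi> x powr (q / (q - 2)) / B) \<partial>lebesgue)
      \<le> (\<integral>\<^sup>+x. \<integral>\<^sup>+E. ?F E x \<partial>lborel \<partial>lebesgue)"
    unfolding const
    by (intro nn_integral_mono truncated_square_integral a) (simp_all add: particle_density_nonneg A_pos)
  also have "\<dots> = (\<integral>\<^sup>+E. \<integral>\<^sup>+x. ?F E x \<partial>lebesgue \<partial>lborel)"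
    by (rule lborel_lebesgue.Fubini') measurable
  also have "\<dots> \<le> (\<integral>\<^sup>+E. (\<Sum>\<psi>\<in>\<Psi>. (if 0 < E then \<integral>\<^sup>+p. ennreal ((norm (low (1 / sqrt E) \<psi> p))\<^sup>2) \<partial>lebesgue else 0)) \<partial>lborel)"
  proof (rule nn_integral_mono)
    fix E :: real
    show "(\<integral>\<^sup>+x. ?F E x \<partial>lebesgue) \<le> (\<Sum>\<psi>\<in>\<Psi>. (if 0 < E then \<integral>\<^sup>+p. ennreal ((norm (low (1 / sqrt E) \<psi> p))\<^sup>2) \<partial>lebesgue else 0))"
    proof (cases "0 < E")
      case True
      have "sqrt (A * (1 / sqrt E) powr (2 - q)) = sqrt A * E powr a"
      proof -
        have "(1 / sqrt E) powr (2 - q) = (E powr (- (1 / 2))) powr (2 - q)"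
          using True by (simp add: powr_minus_divide powr_half_sqrt)
        also have "\<dots> = E powr (2 * a)"
          unfolding powr_powr by (rule arg_cong[where f = "\<lambda>k. E powr k"]) (simp add: a_def field_simps)
        also have "\<dots> = (E powr a)\<^sup>2" using True by (simp add: powr_power mult.commute)
        finally show ?thesis by (simp add: real_sqrt_mult)
      qed
      then show ?thesis
        using low_frequency_bound[OF \<Psi> _ sq, of "1 / sqrt E"] True by simp
    qed simp
  qed
  also have "\<dots> = (\<Sum>\<psi>\<in>\<Psi>. \<integral>\<^sup>+E. (if 0 < E then \<integral>\<^sup>+p. ennreal ((norm (low (1 / sqrt E) \<psi> p))\<^sup>2) \<partial>lebesgue else 0) \<partial>lborel)"
  proof (rule nn_integral_sum)
    fix \<psi>
    note [measurable] = square_integrable_measurable[OF square_integrable_rep_L2]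
    have eq: "(\<integral>\<^sup>+p. ennreal ((norm (low (1 / sqrt E) \<psi> p))\<^sup>2) \<partial>lebesgue)
       = (\<integral>\<^sup>+p. (if norm (g p) \<le> 1 / sqrt E then ennreal ((norm (g p * rep_L2 \<psi> p))\<^sup>2) else 0) \<partial>lebesgue)" for E
      by (intro nn_integral_cong) (auto simp: low_def indicator_def)
    show "(\<lambda>E. if 0 < E then \<integral>\<^sup>+p. ennreal ((norm (low (1 / sqrt E) \<psi> p))\<^sup>2) \<partial>lebesgue else 0) \<in> borel_measurable lborel"
      unfolding eq by measurable
  qed
  also have "\<dots> \<le> (\<Sum>\<psi>\<in>\<Psi>. ennreal ((norm \<psi>)\<^sup>2))" by (intro sum_mono integral_low_le)
  also have "\<dots> = (\<Sum>\<psi>\<in>\<Psi>. 1)" using corthonormal_norm[OF \<Psi>(2)] by (intro sum.cong) auto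
  also have "\<dots> = ennreal (card \<Psi>)" by (simp add: ennreal_of_nat_eq_real_of_nat)
  finally show ?thesis .
qed

text \<open>Young's inequality for the conjugate exponents \<open>q / 2\<close> and
  \<open>q / (q - 2)\<close>. The weight \<open>l\<close> satisfies
  \<open>l powr (q / (q - 2)) = B / \<kappa>\<^sup>2\<close>, so that by
  \<open>particle_density_power_bound\<close> the second term integrates to at most
  \<open>(1 - 2 / q) * \<kappa>\<^sup>2\<close> per vector.\<close>

lemma weighted_young:
  fixes t \<rho> \<kappa> :: real
  assumes "0 \<le> t" "0 \<le> \<rho>" "0 < \<kappa>"
  shows "t\<^sup>2 * \<rho> \<le> 2 / q * (B / \<kappa>\<^sup>2) powr ((q - 2) / 2) * t powr q + (1 - 2 / q) * \<kappa>\<^sup>2 * (\<rho> powr (q / (q - 2)) / B)"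
proof -
  define l where "l = (B / \<kappa>\<^sup>2) powr ((q - 2) / q)"
  have Bk: "0 < B / \<kappa>\<^sup>2" using B_pos assms by simp
  then have l: "0 < l" unfolding l_def powr_gt_zero by (rule less_imp_neq[symmetric])
  have "(l * t\<^sup>2) * (\<rho> / l) \<le> (l * t\<^sup>2) powr (q / 2) / (q / 2) + (\<rho> / l) powr (q / (q - 2)) / (q / (q - 2))"
    by (rule Youngs_inequality) (use q l assms in \<open>auto simp: field_simps\<close>)
  also have "(l * t\<^sup>2) powr (q / 2) = (B / \<kappa>\<^sup>2) powr ((q - 2) / 2) * t powr q"
  proof -
    have "l powr (q / 2) = (B / \<kappa>\<^sup>2) powr ((q - 2) / 2)"
      using q by (simp add: l_def powr_powr)
    moreover have "(t\<^sup>2) powr (q / 2) = t powr q"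
    proof (cases "t = 0")
      case False
      then have "t\<^sup>2 = t powr 2" using assms by simp
      then show ?thesis by (simp add: powr_powr)
    qed simp
    ultimately show ?thesis using l assms by (simp add: powr_mult)
  qed
  also have "(\<rho> / l) powr (q / (q - 2)) = \<kappa>\<^sup>2 * (\<rho> powr (q / (q - 2)) / B)"
  proof -
    have "(q - 2) / q * (q / (q - 2)) = 1" using q by simp
    then have "l powr (q / (q - 2)) = (B / \<kappa>\<^sup>2) powr 1"
      unfolding l_def powr_powr by (rule arg_cong)
    also have "\<dots> = B / \<kappa>\<^sup>2" unfolding powr_one_gt_zero_iff using Bk by (rule less_imp_le)
    finally have "l powr (q / (q - 2)) = B / \<kappa>\<^sup>2" .
    then show ?thesis using l assms by (simp add: powr_divide)
  qed
  finally show ?thesis using l q by (simp add: field_simps)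
qed

text \<open>\<open>\<kappa>\<close> is a free parameter here; the counting argument sets it equal to
  the threshold for \<open>norm (K \<phi>)\<close>.\<close>

theorem master_inequality:
  assumes \<Psi>: "finite \<Psi>" "corthonormal \<Psi>" and \<kappa>: "0 < \<kappa>"
    and sq: "\<And>\<psi>. \<psi> \<in> \<Psi> \<Longrightarrow> square_integrable (\<lambda>p. g p * rep_L2 \<psi> p)"
    and f: "f \<in> Lp q"
  shows "(\<integral>\<^sup>+x. ennreal ((norm (f x))\<^sup>2 * particle_density \<Psi> x) \<partial>lebesgue)
    \<le> ennreal (2 / q * (B / \<kappa>\<^sup>2) powr ((q - 2) / 2) * (LINT x|lebesgue. norm (f x) powr q)
        + (1 - 2 / q) * \<kappa>\<^sup>2 * card \<Psi>)"
proof -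
  define c1 where "c1 = 2 / q * (B / \<kappa>\<^sup>2) powr ((q - 2) / 2)"
  define c2 where "c2 = (1 - 2 / q) * \<kappa>\<^sup>2"
  have c: "0 \<le> c1" "0 \<le> c2" using q by (auto simp: c1_def c2_def)
  have [measurable]: "f \<in> borel_measurable lebesgue" and fi: "integrable lebesgue (\<lambda>x. norm (f x) powr q)"
    using f by (auto simp: Lp_def)
  have "(\<integral>\<^sup>+x. ennreal ((norm (f x))\<^sup>2 * particle_density \<Psi> x) \<partial>lebesgue)
     \<le> (\<integral>\<^sup>+x. ennreal c1 * ennreal (norm (f x) powr q) + ennreal c2 * ennreal (particle_density \<Psi> x powr (q / (q - 2)) / B) \<partial>lebesgue)"
  proof (rule nn_integral_mono)
    fix x
    have "(norm (f x))\<^sup>2 * particle_density \<Psi> x \<le> c1 * norm (f x) powr q + c2 * (particle_density \<Psi> x powr (q / (q - 2)) / B)"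
      unfolding c1_def c2_def by (rule weighted_young) (auto simp: particle_density_nonneg \<kappa>)
    then show "ennreal ((norm (f x))\<^sup>2 * particle_density \<Psi> x)
       \<le> ennreal c1 * ennreal (norm (f x) powr q) + ennreal c2 * ennreal (particle_density \<Psi> x powr (q / (q - 2)) / B)"
      using c B_pos by (simp add: ennreal_mult[symmetric] ennreal_plus[symmetric] del: ennreal_plus)
  qed
  also have "\<dots> = ennreal c1 * (\<integral>\<^sup>+x. ennreal (norm (f x) powr q) \<partial>lebesgue)
      + ennreal c2 * (\<integral>\<^sup>+x. ennreal (particle_density \<Psi> x powr (q / (q - 2)) / B) \<partial>lebesgue)"
    by (subst nn_integral_add) (simp_all add: nn_integral_cmult)
  also have "(\<integral>\<^sup>+x. ennreal (norm (f x) powr q) \<partial>lebesgue) = ennreal (LINT x|lebesgue. norm (f x) powr q)"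
    by (rule nn_integral_eq_integral[OF fi]) simp
  also have "ennreal c1 * ennreal (LINT x|lebesgue. norm (f x) powr q)
      + ennreal c2 * (\<integral>\<^sup>+x. ennreal (particle_density \<Psi> x powr (q / (q - 2)) / B) \<partial>lebesgue)
      \<le> ennreal c1 * ennreal (LINT x|lebesgue. norm (f x) powr q) + ennreal c2 * ennreal (card \<Psi>)"
    by (intro add_left_mono mult_left_mono particle_density_power_bound \<Psi> sq) auto
  also have "\<dots> = ennreal (c1 * (LINT x|lebesgue. norm (f x) powr q) + c2 * card \<Psi>)"
    using c by (simp add: ennreal_mult[symmetric] ennreal_plus[symmetric] del: ennreal_plus)
  finally show ?thesis by (simp add: c1_def c2_def)
qed

end

section \<open>Closure and singular values of the position-momentum operator\<close>

text \<open>\<open>K\<close> is defined through one chosen approximating sequence per vector;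
  boundedness makes the limit independent of that choice. The graph of \<open>K\<close> is closed
  and consists of limits of points of the graph of \<open>M\<close>, hence is its closure.\<close>

lemma bounded_extension:
  fixes M :: "'a::complex_hilbert_space \<Rightarrow> 'a"
  assumes D: "complex_vector.subspace D"
    and add: "\<And>x y. x \<in> D \<Longrightarrow> y \<in> D \<Longrightarrow> M (x + y) = M x + M y"
    and scale: "\<And>c x. x \<in> D \<Longrightarrow> M (c *\<^sub>C x) = c *\<^sub>C M x"
    and bound: "\<And>x. x \<in> D \<Longrightarrow> norm (M x) \<le> C * norm x"
    and dense: "\<And>u. \<exists>s. (\<forall>n. s n \<in> D) \<and> s \<longlonglongrightarrow> u"
  shows "\<exists>K. clinear K \<and> bounded_linear K \<and> (\<forall>x\<in>D. K x = M x) \<and>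
    closure {(x, M x) |x. x \<in> D} = {(u, K u) |u. True}"
proof -
  have diff_D: "x - y \<in> D" if "x \<in> D" "y \<in> D" for x y
    using complex_vector.subspace_diff[OF D that] .
  have M_diff: "M (x - y) = M x - M y" if "x \<in> D" "y \<in> D" for x y
    using add[OF diff_D[OF that] that(2)] by (simp add: algebra_simps)
  obtain s where s: "\<And>u n. s u n \<in> D" "\<And>u. s u \<longlonglongrightarrow> u" using dense by metis
  have "Cauchy (\<lambda>n. M (t n))" if t: "\<And>n. t n \<in> D" "t \<longlonglongrightarrow> u" for t u
  proof (rule CauchyI)
    fix e :: real assume e: "0 < e"
    \<comment> \<open>\<open>C\<close> may be zero or negative, and the constant is used as a
      divisor.\<close>
    define C' where "C' = \<bar>C\<bar> + 1"
    have C': "0 < C'" "\<And>x. x \<in> D \<Longrightarrow> norm (M x) \<le> C' * norm x"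
    proof -
      show "norm (M x) \<le> C' * norm x" if "x \<in> D" for x
      proof -
        have "C * norm x \<le> C' * norm x" unfolding C'_def by (intro mult_right_mono) auto
        then show ?thesis using bound[OF that] by simp
      qed
    qed (simp add: C'_def)
    then have "0 < e / C'" using e by simp
    then obtain N where N: "\<And>m n. m \<ge> N \<Longrightarrow> n \<ge> N \<Longrightarrow> norm (t m - t n) < e / C'"
      using LIMSEQ_imp_Cauchy[OF t(2)] unfolding Cauchy_iff by metis
    have "norm (M (t m) - M (t n)) < e" if "m \<ge> N" "n \<ge> N" for m n
    proof -
      have "norm (M (t m) - M (t n)) \<le> C' * norm (t m - t n)"
        unfolding M_diff[OF t(1) t(1), symmetric] by (intro C' diff_D t)
      also have "\<dots> < e" using N[OF that] C'(1) by (simp add: field_simps)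
      finally show ?thesis .
    qed
    then show "\<exists>N. \<forall>m\<ge>N. \<forall>n\<ge>N. norm (M (t m) - M (t n)) < e" by blast
  qed
  from this[OF s] have "\<exists>y. (\<lambda>n. M (s u n)) \<longlonglongrightarrow> y" for u
    by (simp add: Cauchy_convergent_iff convergent_def)
  then obtain K where K: "\<And>u. (\<lambda>n. M (s u n)) \<longlonglongrightarrow> K u" by metis
  have lim: "(\<lambda>n. M (t n)) \<longlonglongrightarrow> K u" if t: "\<And>n. t n \<in> D" "t \<longlonglongrightarrow> u" for t u
  proof -
    have "(\<lambda>n. t n - s u n) \<longlonglongrightarrow> u - u" by (intro tendsto_diff t s)
    then have "(\<lambda>n. C * norm (t n - s u n)) \<longlonglongrightarrow> 0"
      using tendsto_mult_right_zero tendsto_norm_zero by fastforce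
    then have "(\<lambda>n. M (t n) - M (s u n)) \<longlonglongrightarrow> 0"
      by (rule Lim_null_comparison[rotated])
         (auto simp: M_diff[OF t(1) s(1), symmetric] intro!: always_eventually bound diff_D t s)
    from tendsto_add[OF this K[of u]] show ?thesis by simp
  qed
  have K_M: "K x = M x" if "x \<in> D" for x
    using lim[of "\<lambda>_. x" x] that LIMSEQ_unique tendsto_const by blast
  have K_lin: "clinear K" unfolding clinear_iff
  proof (intro conjI allI)
    fix x y c
    have "(\<lambda>n. M (s x n + s y n)) \<longlonglongrightarrow> K (x + y)"
      by (intro lim tendsto_add s complex_vector.subspace_add[OF D])
    then show "K (x + y) = K x + K y"
      using LIMSEQ_unique tendsto_add[OF K K, of x y] add[OF s(1) s(1)] by simp
    have "(\<lambda>n. M (c *\<^sub>C s x n)) \<longlonglongrightarrow> K (c *\<^sub>C x)"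
      by (intro lim tendsto_scaleC_right s complex_vector.subspace_scale[OF D])
    then show "K (c *\<^sub>C x) = c *\<^sub>C K x"
      using LIMSEQ_unique tendsto_scaleC_right[OF K, of c x] scale[OF s(1)] by simp
  qed
  have K_bound: "norm (K x) \<le> C * norm x" for x
    by (rule LIMSEQ_le[OF tendsto_norm[OF K] tendsto_mult_left[OF tendsto_norm[OF s(2)]]])
       (auto intro: bound s)
  have K_bl: "bounded_linear K" by (rule clinear_bounded_linear[OF K_lin K_bound])
  have "closure {(x, M x) |x. x \<in> D} = {(u, K u) |u. True}"
  proof
    have "closed {p. K (fst p) = snd p}"
      by (intro closed_Collect_eq continuous_intros bounded_linear.continuous_on[OF K_bl])
    moreover have "{p. K (fst p) = snd p} = {(u, K u) |u. True}" by auto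
    ultimately have "closed {(u, K u) |u. True}" by simp
    then show "closure {(x, M x) |x. x \<in> D} \<subseteq> {(u, K u) |u. True}"
      by (rule closure_minimal[rotated]) (auto simp: K_M)
    show "{(u, K u) |u. True} \<subseteq> closure {(x, M x) |x. x \<in> D}"
    proof safe
      fix u
      have "(\<lambda>n. (s u n, M (s u n))) \<longlonglongrightarrow> (u, K u)" by (intro tendsto_Pair s K)
      then show "(u, K u) \<in> closure {(x, M x) |x. x \<in> D}"
        unfolding closure_sequential using s(1) by (intro exI[of _ "\<lambda>n. (s u n, M (s u n))"]) auto
    qed
  qed
  then show ?thesis using K_lin K_bl K_M by blast
qed

section \<open>Multiplication operators and their graphs\<close>

definition mul_dom :: "('a::euclidean_space \<Rightarrow> complex) \<Rightarrow> 'a L2 set" where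
  "mul_dom f = {x. square_integrable (\<lambda>p. f p * rep_L2 x p)}"

text \<open>A total function that is meaningful on \<open>mul_dom f\<close> only; its graph over
  that domain is \<open>position_op f\<close>.\<close>

definition mul_op :: "('a::euclidean_space \<Rightarrow> complex) \<Rightarrow> 'a L2 \<Rightarrow> 'a L2" where
  "mul_op f x = abs_L2 (\<lambda>p. f p * rep_L2 x p)"

lemma square_integrable_cong_AE:
  assumes "square_integrable v" "u \<in> borel_measurable lebesgue" "AE x in lebesgue. u x = v x"
  shows "square_integrable u"
proof (rule square_integrableI[OF assms(2)])
  have "(\<integral>\<^sup>+x. ennreal ((norm (u x))\<^sup>2) \<partial>lebesgue) = (\<integral>\<^sup>+x. ennreal ((norm (v x))\<^sup>2) \<partial>lebesgue)"
    using assms(3) by (intro nn_integral_cong_AE) (auto elim: AE_mp)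
  then show "(\<integral>\<^sup>+x. ennreal ((norm (u x))\<^sup>2) \<partial>lebesgue) < \<infinity>"
    by (simp add: norm_abs_L2[OF assms(1), symmetric])
qed

lemma mul_measurable:
  "f \<in> borel_measurable lebesgue \<Longrightarrow> (\<lambda>p. f p * rep_L2 x p) \<in> borel_measurable lebesgue"
  by (rule borel_measurable_times[OF _ square_integrable_measurable[OF square_integrable_rep_L2]])

lemma mul_opI:
  assumes f: "f \<in> borel_measurable lebesgue" and v: "square_integrable v"
    and ae: "AE p in lebesgue. f p * rep_L2 x p = v p"
  shows "x \<in> mul_dom f" "mul_op f x = abs_L2 v"
proof -
  have "square_integrable (\<lambda>p. f p * rep_L2 x p)"
    by (rule square_integrable_cong_AE[OF v mul_measurable[OF f] ae])
  then show "x \<in> mul_dom f" "mul_op f x = abs_L2 v"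
    using v ae by (auto simp: mul_dom_def mul_op_def intro: abs_L2_eqI)
qed

lemma mul_op_add:
  assumes f: "f \<in> borel_measurable lebesgue" and xy: "x \<in> mul_dom f" "y \<in> mul_dom f"
  shows "x + y \<in> mul_dom f" "mul_op f (x + y) = mul_op f x + mul_op f y"
proof -
  have sq: "square_integrable (\<lambda>p. f p * rep_L2 x p)" "square_integrable (\<lambda>p. f p * rep_L2 y p)"
    using xy by (auto simp: mul_dom_def)
  have "x + y = abs_L2 (\<lambda>p. rep_L2 x p + rep_L2 y p)"
    using abs_L2_add[OF square_integrable_rep_L2 square_integrable_rep_L2, of x y] by (simp add: abs_rep_L2)
  then have "AE p in lebesgue. rep_L2 (x + y) p = rep_L2 x p + rep_L2 y p"
    using rep_abs_L2[OF square_integrable_add[OF square_integrable_rep_L2 square_integrable_rep_L2, of x y]] by simp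
  then have ae: "AE p in lebesgue. f p * rep_L2 (x + y) p = f p * rep_L2 x p + f p * rep_L2 y p"
    by eventually_elim (simp add: distrib_left)
  note mul_opI[OF f square_integrable_add[OF sq] ae]
  then show "x + y \<in> mul_dom f" "mul_op f (x + y) = mul_op f x + mul_op f y"
    using abs_L2_add[OF sq] by (auto simp: mul_op_def)
qed

lemma mul_op_scaleC:
  assumes f: "f \<in> borel_measurable lebesgue" and x: "x \<in> mul_dom f"
  shows "c *\<^sub>C x \<in> mul_dom f" "mul_op f (c *\<^sub>C x) = c *\<^sub>C mul_op f x"
proof -
  have sq: "square_integrable (\<lambda>p. f p * rep_L2 x p)"
    using x by (auto simp: mul_dom_def)
  have "c *\<^sub>C x = abs_L2 (\<lambda>p. c * rep_L2 x p)"
    using abs_L2_scaleC[OF square_integrable_rep_L2, of c x] by (simp add: abs_rep_L2)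
  then have "AE p in lebesgue. rep_L2 (c *\<^sub>C x) p = c * rep_L2 x p"
    using rep_abs_L2[OF square_integrable_scale[OF square_integrable_rep_L2, of c x]] by simp
  then have ae: "AE p in lebesgue. f p * rep_L2 (c *\<^sub>C x) p = c * (f p * rep_L2 x p)"
    by eventually_elim simp
  note mul_opI[OF f square_integrable_scale[OF sq] ae]
  then show "c *\<^sub>C x \<in> mul_dom f" "mul_op f (c *\<^sub>C x) = c *\<^sub>C mul_op f x"
    using abs_L2_scaleC[OF sq] by (auto simp: mul_op_def)
qed

lemma position_op_eq:
  assumes f: "f \<in> borel_measurable lebesgue"
  shows "position_op f = {(x, mul_op f x) |x. x \<in> mul_dom f}"
proof (intro equalityI subsetI)
  fix z assume "z \<in> position_op f"
  then obtain x y where z: "z = (x, y)" and ae: "AE p in lebesgue. rep_L2 y p = f p * rep_L2 x p"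
    by (auto simp: position_op_def)
  then have "AE p in lebesgue. f p * rep_L2 x p = rep_L2 y p" by (simp add: eq_commute)
  from mul_opI[OF f square_integrable_rep_L2 this] show "z \<in> {(x, mul_op f x) |x. x \<in> mul_dom f}"
    by (simp add: z abs_rep_L2)
next
  fix z assume "z \<in> {(x, mul_op f x) |x. x \<in> mul_dom f}"
  then show "z \<in> position_op f"
    by (auto simp: position_op_def mul_op_def mul_dom_def rep_abs_L2)
qed

section \<open>Unitarity of \<open>fourier\<close> and the natural domain of the product\<close>

lemma fourier_inverse [simp]: "ftL2 1 (fourier u) = u" "fourier (ftL2 1 u) = u"
  using ftL2_inverse[of "-1" u] ftL2_inverse[of 1 u] by (simp_all add: fourier_eq_ftL2)

lemma inv_fourier: "inv fourier = ftL2 1"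
  by (rule inv_equality) simp_all

lemma clinear_fourier: "clinear fourier"
  unfolding fourier_eq_ftL2 by (rule clinear_ftL2) simp

lemma clinear_ftL2_1: "clinear (ftL2 1)"
  by (rule clinear_ftL2) simp

lemma cinner_fourier: "cinner (fourier x) (fourier y) = cinner x y"
  using ftL2_adjoint[of "-1" x "fourier y"] by (simp add: fourier_eq_ftL2[symmetric])

lemma corthonormal_fourier: "corthonormal \<Phi> \<Longrightarrow> corthonormal (fourier ` \<Phi>)"
  by (auto simp: corthonormal_def cinner_fourier) (metis fourier_inverse(1))

lemma inj_fourier: "inj fourier"
  by (metis fourier_inverse(1) injI)

text \<open>Only the condition coming from \<open>g\<close> appears. That the resulting vector lies
  in the domain of f(X) is a consequence of the estimate, by
  \<open>pm_op_linear_bounded\<close>.\<close>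

definition pm_dom :: "('a::euclidean_space \<Rightarrow> complex) \<Rightarrow> 'a L2 set" where
  "pm_dom g = {u. fourier u \<in> mul_dom g}"

definition pm_op :: "('a::euclidean_space \<Rightarrow> complex) \<Rightarrow> ('a \<Rightarrow> complex) \<Rightarrow> 'a L2 \<Rightarrow> 'a L2" where
  "pm_op f g u = mul_op f (ftL2 1 (mul_op g (fourier u)))"

lemma position_momentum_op_eq:
  assumes f: "f \<in> borel_measurable lebesgue" and g: "g \<in> borel_measurable lebesgue"
    and dom: "\<And>u. u \<in> pm_dom g \<Longrightarrow> ftL2 1 (mul_op g (fourier u)) \<in> mul_dom f"
  shows "position_momentum_op f g = {(u, pm_op f g u) |u. u \<in> pm_dom g}"
proof -
  have "momentum_op g = {(u, ftL2 1 (mul_op g (fourier u))) |u. u \<in> pm_dom g}"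
    by (auto simp: momentum_op_def position_op_eq[OF g] inv_fourier pm_dom_def)
  then show ?thesis
    using dom by (auto simp: position_momentum_op_def position_op_eq[OF f] pm_op_def relcomp_unfold)
qed

context weak_Lp_weight
begin

lemma subspace_pm_dom: "complex_vector.subspace (pm_dom g)"
proof -
  have "AE p in lebesgue. rep_L2 0 p = (0 :: complex)"
    using rep_abs_L2[OF square_integrable_0] by (simp add: abs_L2_zero)
  then have "AE p in lebesgue. g p * rep_L2 0 p = 0" by eventually_elim simp
  then have "0 \<in> mul_dom g" by (rule mul_opI(1)[OF g_measurable square_integrable_0])
  then show ?thesis
    unfolding complex_vector.subspace_def pm_dom_def
    by (auto simp: clinearD[OF clinear_fourier] mul_op_add[OF g_measurable] mul_op_scaleC[OF g_measurable])
qed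

text \<open>Spectral cutoff to the momenta where |g| is at most \<open>n\<close>. It maps every
  vector into \<open>pm_dom g\<close>, which gives density, and it converts \<open>g\<close> into
  the bounded weight \<open>g_cut n\<close>, whose domain is everything.\<close>

definition cut :: "nat \<Rightarrow> 'a L2 \<Rightarrow> 'a L2" where
  "cut n u = ftL2 1 (abs_L2 (\<lambda>p. indicator {p. norm (g p) \<le> real n} p * rep_L2 (fourier u) p))"

definition g_cut :: "nat \<Rightarrow> 'a \<Rightarrow> complex" where
  "g_cut n p = indicator {p. norm (g p) \<le> real n} p * g p"

lemma sublevel_measurable [measurable]: "{p. norm (g p) \<le> \<tau>} \<in> sets lebesgue"
proof -
  have "{p. norm (g p) \<le> \<tau>} = space lebesgue - {p. \<tau> < norm (g p)}" by auto
  then show ?thesis by (metis superlevel_measurable sets.compl_sets)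
qed

lemma cut_properties:
  shows "cut n u \<in> pm_dom g" "fourier u \<in> mul_dom (g_cut n)"
    "mul_op g (fourier (cut n u)) = mul_op (g_cut n) (fourier u)" "(\<lambda>n. cut n u) \<longlonglongrightarrow> u"
proof -
  let ?v = "\<lambda>n p. indicator {p. norm (g p) \<le> real n} p * rep_L2 (fourier u) p"
  have v: "square_integrable (?v n)" for n
    by (rule square_integrable_indicator_mult[OF square_integrable_rep_L2 sublevel_measurable])
  have gc [measurable]: "g_cut n \<in> borel_measurable lebesgue" unfolding g_cut_def[abs_def] by measurable
  have gv: "square_integrable (\<lambda>p. g_cut n p * rep_L2 (fourier u) p)"
  proof (rule square_integrable_bound)
    show "square_integrable (\<lambda>p. of_nat n * rep_L2 (fourier u) p)"
      by (rule square_integrable_scale[OF square_integrable_rep_L2])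
    show "norm (g_cut n p * rep_L2 (fourier u) p) \<le> norm (of_nat n * rep_L2 (fourier u) p)" for p
      by (auto simp: g_cut_def indicator_def norm_mult intro: mult_right_mono)
  qed (rule mul_measurable[OF gc])
  then show "fourier u \<in> mul_dom (g_cut n)" by (simp add: mul_dom_def)
  have "AE p in lebesgue. g p * rep_L2 (fourier (cut n u)) p = g_cut n p * rep_L2 (fourier u) p"
    using rep_abs_L2[OF v[of n]] unfolding cut_def fourier_inverse
    by eventually_elim (simp add: g_cut_def mult_ac)
  from mul_opI[OF g_measurable gv this]
  show "cut n u \<in> pm_dom g" "mul_op g (fourier (cut n u)) = mul_op (g_cut n) (fourier u)"
    by (simp_all add: pm_dom_def mul_op_def[of "g_cut n"])
  have lim: "(\<lambda>n. abs_L2 (?v n)) \<longlonglongrightarrow> abs_L2 (rep_L2 (fourier u))"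
  proof (rule L2_indicator_tendsto[OF square_integrable_rep_L2 sublevel_measurable])
    fix p
    obtain N where "norm (g p) \<le> real N" using real_arch_simple by blast
    then show "\<forall>\<^sub>F n in sequentially. p \<in> {p. norm (g p) \<le> real n}"
      by (auto simp: eventually_sequentially intro!: exI[of _ N])
  qed
  have "bounded_linear (ftL2 1 :: 'a L2 \<Rightarrow> 'a L2)"
    by (rule clinear_bounded_linear[OF clinear_ftL2_1, of 1]) (simp add: norm_ftL2_eq)
  from bounded_linear.tendsto[OF this lim] show "(\<lambda>n. cut n u) \<longlonglongrightarrow> u"
    by (simp add: cut_def abs_rep_L2)
qed

lemma weak_Lp_weight_g_cut: "weak_Lp_weight (g_cut n) q W"
proof
  show "g_cut n \<in> borel_measurable lebesgue" unfolding g_cut_def[abs_def] by measurable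
  fix \<tau> :: real assume \<tau>: "0 < \<tau>"
  have "{x. \<tau> < norm (g_cut n x)} \<subseteq> {x. \<tau> < norm (g x)}"
    using \<tau> by (auto simp: g_cut_def indicator_def split: if_splits)
  then have "emeasure lebesgue {x. \<tau> < norm (g_cut n x)} \<le> emeasure lebesgue {x. \<tau> < norm (g x)}"
    by (intro emeasure_mono) auto
  then have "ennreal (\<tau> powr q) * emeasure lebesgue {x. \<tau> < norm (g_cut n x)}
      \<le> ennreal (\<tau> powr q) * emeasure lebesgue {x. \<tau> < norm (g x)}"
    by (intro mult_left_mono) auto
  also have "\<dots> \<le> ennreal W" by (rule weak[OF \<tau>])
  finally show "ennreal (\<tau> powr q) * emeasure lebesgue {x. \<tau> < norm (g_cut n x)} \<le> ennreal W" .
qed (fact q W)+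

definition bound :: "('a \<Rightarrow> complex) \<Rightarrow> real \<Rightarrow> nat \<Rightarrow> real" where
  "bound f \<kappa> N = 2 / q * (B / \<kappa>\<^sup>2) powr ((q - 2) / 2) * (LINT x|lebesgue. norm (f x) powr q)
        + (1 - 2 / q) * \<kappa>\<^sup>2 * N"

text \<open>One estimate does both: finiteness of the integral of |f|^2 \<rho> makes every single
  product square-integrable, so each vector is in the domain of f(X), and the integral is then the
  sum of the squared norms.\<close>

lemma pm_op_sum_bound:
  assumes f: "f \<in> Lp q" and \<Phi>: "finite \<Phi>" "corthonormal \<Phi>" "\<Phi> \<subseteq> pm_dom g" and \<kappa>: "0 < \<kappa>"
  shows "\<phi> \<in> \<Phi> \<Longrightarrow> ftL2 1 (mul_op g (fourier \<phi>)) \<in> mul_dom f"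
    and "(\<Sum>\<phi>\<in>\<Phi>. (norm (pm_op f g \<phi>))\<^sup>2) \<le> bound f \<kappa> (card \<Phi>)"
proof -
  have fm [measurable]: "f \<in> borel_measurable lebesgue" using f by (simp add: Lp_def)
  let ?w = "\<lambda>\<phi>. ftL2 1 (mul_op g (fourier \<phi>))"
  let ?fw = "\<lambda>\<phi> p. f p * rep_L2 (?w \<phi>) p"
  note [measurable] = mul_measurable[OF fm]
  have dens: "(norm (f x))\<^sup>2 * particle_density (fourier ` \<Phi>) x = (\<Sum>\<phi>\<in>\<Phi>. (norm (?fw \<phi> x))\<^sup>2)" for x
    unfolding particle_density_def
    by (subst sum.reindex[OF inj_on_subset[OF inj_fourier]])
       (simp_all add: sum_distrib_left norm_mult power_mult_distrib mul_op_def)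
  have sum_le: "(\<Sum>\<phi>\<in>\<Phi>. \<integral>\<^sup>+x. ennreal ((norm (?fw \<phi> x))\<^sup>2) \<partial>lebesgue) \<le> ennreal (bound f \<kappa> (card \<Phi>))"
  proof -
    have "(\<Sum>\<phi>\<in>\<Phi>. \<integral>\<^sup>+x. ennreal ((norm (?fw \<phi> x))\<^sup>2) \<partial>lebesgue)
      = (\<integral>\<^sup>+x. (\<Sum>\<phi>\<in>\<Phi>. ennreal ((norm (?fw \<phi> x))\<^sup>2)) \<partial>lebesgue)"
      by (intro nn_integral_sum[symmetric]) measurable
    also have "\<dots> = (\<integral>\<^sup>+x. ennreal ((norm (f x))\<^sup>2 * particle_density (fourier ` \<Phi>) x) \<partial>lebesgue)"
      unfolding dens by (simp add: sum_nonneg)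
    also have "\<dots> \<le> ennreal (bound f \<kappa> (card (fourier ` \<Phi>)))"
      unfolding bound_def
    proof (rule master_inequality[OF _ corthonormal_fourier[OF \<Phi>(2)] \<kappa> _ f])
      fix \<psi> assume "\<psi> \<in> fourier ` \<Phi>"
      then show "square_integrable (\<lambda>p. g p * rep_L2 \<psi> p)"
        using \<Phi>(3) by (auto simp: pm_dom_def mul_dom_def)
    qed (use \<Phi> in simp)
    also have "card (fourier ` \<Phi>) = card \<Phi>" by (rule card_image[OF inj_on_subset[OF inj_fourier]]) simp
    finally show ?thesis .
  qed
  have sq: "square_integrable (?fw \<phi>)" if "\<phi> \<in> \<Phi>" for \<phi>
  proof (rule square_integrableI)
    have "(\<integral>\<^sup>+x. ennreal ((norm (?fw \<phi> x))\<^sup>2) \<partial>lebesgue) \<le> (\<Sum>\<phi>\<in>\<Phi>. \<integral>\<^sup>+x. ennreal ((norm (?fw \<phi> x))\<^sup>2) \<partial>lebesgue)"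
      by (rule member_le_sum[OF that]) (use \<Phi> in auto)
    also note sum_le
    also have "ennreal (bound f \<kappa> (card \<Phi>)) < \<infinity>" by simp
    finally show "(\<integral>\<^sup>+x. ennreal ((norm (?fw \<phi> x))\<^sup>2) \<partial>lebesgue) < \<infinity>" .
  qed measurable
  then show "\<phi> \<in> \<Phi> \<Longrightarrow> ?w \<phi> \<in> mul_dom f" by (simp add: mul_dom_def)
  have "ennreal (\<Sum>\<phi>\<in>\<Phi>. (norm (pm_op f g \<phi>))\<^sup>2) = (\<Sum>\<phi>\<in>\<Phi>. \<integral>\<^sup>+x. ennreal ((norm (?fw \<phi> x))\<^sup>2) \<partial>lebesgue)"
    using sq by (simp add: pm_op_def mul_op_def[of f] norm_abs_L2 flip: sum_ennreal)
  also note sum_le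
  finally show "(\<Sum>\<phi>\<in>\<Phi>. (norm (pm_op f g \<phi>))\<^sup>2) \<le> bound f \<kappa> (card \<Phi>)"
  proof (subst (asm) ennreal_le_iff)
    show "0 \<le> bound f \<kappa> (card \<Phi>)" using q by (simp add: bound_def integral_nonneg_AE)
  qed
qed

text \<open>The norm bound is \<open>pm_op_sum_bound\<close> for the orthonormal set consisting of
  the normalised vector alone, with the arbitrary choice \<open>\<kappa> = 1\<close>.\<close>

lemma pm_op_linear_bounded:
  assumes f: "f \<in> Lp q"
  shows "u \<in> pm_dom g \<Longrightarrow> ftL2 1 (mul_op g (fourier u)) \<in> mul_dom f"
    and "u \<in> pm_dom g \<Longrightarrow> v \<in> pm_dom g \<Longrightarrow> pm_op f g (u + v) = pm_op f g u + pm_op f g v"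
    and "u \<in> pm_dom g \<Longrightarrow> pm_op f g (c *\<^sub>C u) = c *\<^sub>C pm_op f g u"
    and "u \<in> pm_dom g \<Longrightarrow> norm (pm_op f g u) \<le> sqrt (bound f 1 1) * norm u"
proof -
  have fm: "f \<in> borel_measurable lebesgue" using f by (simp add: Lp_def)
  let ?w = "\<lambda>u. ftL2 1 (mul_op g (fourier u))"
  have w_add: "?w (u + v) = ?w u + ?w v" if "u \<in> pm_dom g" "v \<in> pm_dom g" for u v
    using that by (simp add: pm_dom_def clinearD[OF clinear_fourier] clinearD[OF clinear_ftL2_1] mul_op_add[OF g_measurable])
  have w_scale: "?w (c *\<^sub>C u) = c *\<^sub>C ?w u" if "u \<in> pm_dom g" for c u
    using that by (simp add: pm_dom_def clinearD[OF clinear_fourier] clinearD[OF clinear_ftL2_1] mul_op_scaleC[OF g_measurable])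
  have scaled: "?w u \<in> mul_dom f \<and> norm (pm_op f g u) \<le> sqrt (bound f 1 1) * norm u" if u: "u \<in> pm_dom g" for u
  proof -
    show ?thesis
    proof (cases "u = 0")
      case True
      have "AE p in lebesgue. f p * rep_L2 0 p = 0"
        using rep_abs_L2[OF square_integrable_0] by (auto simp: abs_L2_zero elim: AE_mp)
      from mul_opI[OF fm square_integrable_0 this] have "0 \<in> mul_dom f" "mul_op f 0 = 0"
        by (simp_all add: abs_L2_zero)
      moreover have "?w 0 = 0" using w_scale[OF u, of 0] True by simp
      ultimately show ?thesis using True by (simp add: pm_op_def)
    next
      case False
      define e where "e = complex_of_real (1 / norm u) *\<^sub>C u"
      have e: "e \<in> pm_dom g" unfolding e_def by (rule complex_vector.subspace_scale[OF subspace_pm_dom u])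
      have "norm e = 1" using False by (simp add: e_def norm_scaleC norm_divide)
      then have on: "corthonormal {e}" by (simp add: corthonormal_def cinner_self)
      note b = pm_op_sum_bound[OF f _ on, of 1]
      have we: "?w e \<in> mul_dom f" using b(1)[of e] e by simp
      have "(norm (pm_op f g e))\<^sup>2 \<le> bound f 1 1" using b(2) e by simp
      then have ne: "norm (pm_op f g e) \<le> sqrt (bound f 1 1)" by (rule real_le_rsqrt)
      have "u = complex_of_real (norm u) *\<^sub>C e" using False by (simp add: e_def scaleC_of_real scaleC_scaleC)
      then have "?w u = complex_of_real (norm u) *\<^sub>C ?w e" using w_scale[OF e] by metis
      then have "?w u \<in> mul_dom f" "pm_op f g u = complex_of_real (norm u) *\<^sub>C pm_op f g e"
        using mul_op_scaleC[OF fm we] by (simp_all add: pm_op_def)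
      then show ?thesis using ne by (simp add: norm_scaleC mult.commute mult_left_mono)
    qed
  qed
  show dom: "u \<in> pm_dom g \<Longrightarrow> ?w u \<in> mul_dom f" for u using scaled by blast
  show "u \<in> pm_dom g \<Longrightarrow> v \<in> pm_dom g \<Longrightarrow> pm_op f g (u + v) = pm_op f g u + pm_op f g v"
    by (simp add: pm_op_def w_add mul_op_add[OF fm] dom)
  show "u \<in> pm_dom g \<Longrightarrow> pm_op f g (c *\<^sub>C u) = c *\<^sub>C pm_op f g u"
    by (simp add: pm_op_def w_scale mul_op_scaleC[OF fm] dom)
  show "u \<in> pm_dom g \<Longrightarrow> norm (pm_op f g u) \<le> sqrt (bound f 1 1) * norm u" using scaled by blast
qed

text \<open>With \<open>x = q / (q - 2)\<close> and \<open>y = (q + 2) / (q - 2)\<close> one has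
  \<open>B = A powr (2 / (q - 2)) * (x * y)\<close>. The power leaves a single factor
  \<open>A\<close>, which itself contains one \<open>x\<close> from the weak-type tail; this raises
  the exponent of \<open>x\<close> from \<open>(q - 2) / 2\<close> to \<open>q / 2\<close>.\<close>

lemma B_powr:
  "B powr ((q - 2) / 2) = (q / (q - 2)) powr (q / 2) * ((q + 2) / (q - 2)) powr ((q - 2) / 2)
     * (2 * pi) powr (- real DIM('a)) * W"
proof -
  define x y where "x = q / (q - 2)" and "y = (q + 2) / (q - 2)"
  have xy: "0 < x" "0 < y" using q by (simp_all add: x_def y_def)
  have "B = A powr (2 / (q - 2)) * (x * y)"
    by (simp add: B_def x_def y_def power2_eq_square)
  then have "B powr ((q - 2) / 2) = (A powr (2 / (q - 2))) powr ((q - 2) / 2) * (x powr ((q - 2) / 2) * y powr ((q - 2) / 2))"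
    using xy A_pos by (simp add: powr_mult)
  also have "(A powr (2 / (q - 2))) powr ((q - 2) / 2) = A powr 1"
    unfolding powr_powr using q by (intro arg_cong[where f = "\<lambda>k. A powr k"]) simp
  also have "A powr 1 = (2 * pi) powr (- real DIM('a)) * (W * x)"
  proof -
    have "A powr 1 = A" unfolding powr_one_gt_zero_iff using A_pos by simp
    then show ?thesis by (simp only: A_def x_def)
  qed
  also have "(2 * pi) powr (- real DIM('a)) * (W * x) * (x powr ((q - 2) / 2) * y powr ((q - 2) / 2))
     = (x powr 1 * x powr ((q - 2) / 2)) * y powr ((q - 2) / 2) * (2 * pi) powr (- real DIM('a)) * W"
    using xy by simp
  also have "x powr 1 * x powr ((q - 2) / 2) = x powr (q / 2)"
    unfolding powr_add[symmetric] by (intro arg_cong[where f = "\<lambda>k. x powr k"]) (simp add: field_simps)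
  finally show ?thesis by (simp only: x_def y_def)
qed

theorem Cwikel_estimate:
  assumes f: "f \<in> Lp q"
  shows "\<exists>K. is_operator_closure (position_momentum_op f g) K \<and> compact_operator K \<and>
    weak_schatten_sup q K \<le> ennreal ((q / (q - 2)) powr (q / 2) * ((q + 2) / (q - 2)) powr ((q - 2) / 2)
     * (2 * pi) powr (- real DIM('a)) * W * (LINT x|lebesgue. norm (f x) powr q))"
proof -
  have fm: "f \<in> borel_measurable lebesgue" using f by (simp add: Lp_def)
  note pm = pm_op_linear_bounded[OF f]
  have "\<exists>s. (\<forall>n. s n \<in> pm_dom g) \<and> s \<longlonglongrightarrow> u" for u
    using cut_properties by (intro exI[of _ "\<lambda>n. cut n u"]) auto
  from bounded_extension[OF subspace_pm_dom pm(2,3,4) this]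
  obtain K where K: "clinear K" "bounded_linear K" "\<forall>x\<in>pm_dom g. K x = pm_op f g x"
    and closure: "closure {(x, pm_op f g x) |x. x \<in> pm_dom g} = {(u, K u) |u. True}" by blast
  have cl: "is_operator_closure (position_momentum_op f g) K"
    using closure position_momentum_op_eq[OF fm g_measurable pm(1)] by (simp add: is_operator_closure_def)
  define I where "I = (LINT x|lebesgue. norm (f x) powr q)"
  have sum_bound: "(\<Sum>\<phi>\<in>\<Phi>. (norm (K \<phi>))\<^sup>2) \<le> bound f \<kappa> (card \<Phi>)"
    if \<kappa>: "0 < \<kappa>" and \<Phi>: "finite \<Phi>" "corthonormal \<Phi>" for \<kappa> \<Phi>
  proof (rule LIMSEQ_le_const2)
    show "(\<lambda>n. \<Sum>\<phi>\<in>\<Phi>. (norm (K (cut n \<phi>)))\<^sup>2) \<longlonglongrightarrow> (\<Sum>\<phi>\<in>\<Phi>. (norm (K \<phi>))\<^sup>2)"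
      by (intro tendsto_sum tendsto_power tendsto_norm bounded_linear.tendsto[OF K(2)] cut_properties)
    have "(\<Sum>\<phi>\<in>\<Phi>. (norm (K (cut n \<phi>)))\<^sup>2) \<le> bound f \<kappa> (card \<Phi>)" for n
    proof -
      \<comment> \<open>The vectors \<open>cut n \<phi>\<close> are no longer orthonormal, so the
        estimate is applied to the weight \<open>g_cut n\<close> with the original
        \<open>\<phi>\<close>. \<open>B\<close> depends on the weight only through \<open>q\<close>
        and \<open>W\<close>, hence the bound is the same for all \<open>n\<close>.\<close>
      interpret cut: weak_Lp_weight "g_cut n" q W by (rule weak_Lp_weight_g_cut)
      have "K (cut n \<phi>) = pm_op f (g_cut n) \<phi>" for \<phi>
        using K(3) cut_properties(1,3)[where n = n and u = \<phi>] by (simp add: pm_op_def)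
      then show ?thesis
        using cut.pm_op_sum_bound(2)[OF f \<Phi> _ \<kappa>] cut_properties(2)
        by (auto simp: pm_dom_def bound_def cut.bound_def)
    qed
    then show "\<exists>N. \<forall>n\<ge>N. (\<Sum>\<phi>\<in>\<Phi>. (norm (K (cut n \<phi>)))\<^sup>2) \<le> bound f \<kappa> (card \<Phi>)" by blast
  qed
  have count: "\<kappa> powr q * real (card \<Phi>) \<le> B powr ((q - 2) / 2) * I"
    if \<kappa>: "0 < \<kappa>" and \<Phi>: "finite \<Phi>" "corthonormal \<Phi>" and big: "\<forall>\<phi>\<in>\<Phi>. \<kappa> < norm (K \<phi>)" for \<kappa> \<Phi>
  proof -
    have "real (card \<Phi>) * \<kappa>\<^sup>2 \<le> (\<Sum>\<phi>\<in>\<Phi>. (norm (K \<phi>))\<^sup>2)"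
    proof (rule sum_bounded_below)
      fix \<phi> assume "\<phi> \<in> \<Phi>"
      then show "\<kappa>\<^sup>2 \<le> (norm (K \<phi>))\<^sup>2" using big \<kappa> by (intro power_mono) auto
    qed
    also have "\<dots> \<le> bound f \<kappa> (card \<Phi>)" by (rule sum_bound[OF \<kappa> \<Phi>])
    \<comment> \<open>The term \<open>(1 - 2 / q) * \<kappa>\<^sup>2 * card \<Phi>\<close> of
      \<open>bound\<close> has been moved to the left.\<close>
    finally have "2 / q * (real (card \<Phi>) * \<kappa>\<^sup>2) \<le> 2 / q * ((B / \<kappa>\<^sup>2) powr ((q - 2) / 2) * I)"
      by (simp add: bound_def I_def algebra_simps)
    then have "real (card \<Phi>) * \<kappa>\<^sup>2 \<le> (B / \<kappa>\<^sup>2) powr ((q - 2) / 2) * I"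
      using q by (subst (asm) mult_le_cancel_left_pos) auto
    also have "(B / \<kappa>\<^sup>2) powr ((q - 2) / 2) = B powr ((q - 2) / 2) / \<kappa> powr (q - 2)"
    proof -
      have "(\<kappa>\<^sup>2) powr ((q - 2) / 2) = (\<kappa> powr 2) powr ((q - 2) / 2)" using \<kappa> by simp
      also have "\<dots> = \<kappa> powr (q - 2)"
        unfolding powr_powr by (intro arg_cong[where f = "\<lambda>k. \<kappa> powr k"]) (simp add: field_simps)
      finally show ?thesis using \<kappa> B_pos by (simp add: powr_divide)
    qed
    finally have "\<kappa> powr (q - 2) * \<kappa>\<^sup>2 * real (card \<Phi>) \<le> B powr ((q - 2) / 2) * I"
      using \<kappa> by (simp add: field_simps)
    moreover have "\<kappa> powr (q - 2) * \<kappa>\<^sup>2 = \<kappa> powr q"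
      using \<kappa> by (simp add: powr_diff)
    ultimately show ?thesis by simp
  qed
  from weak_schatten_criterion[OF K(1,2) count] cl show ?thesis
    unfolding B_powr I_def by blast
qed

end

lemma is_operator_closure_unique: "is_operator_closure T K \<Longrightarrow> is_operator_closure T K' \<Longrightarrow> K = K'"
  by (auto simp: is_operator_closure_def fun_eq_iff)

theorem corollary2p2:
  fixes f g :: "'a::euclidean_space \<Rightarrow> complex" and q :: real
  assumes "q > 2" and "f \<in> Lp q" and "g \<in> weak_Lp q"
  shows "\<exists>K :: 'a L2 \<Rightarrow> 'a L2.
    is_operator_closure (position_momentum_op f g) K \<and>
    K \<in> weak_schatten q \<and>
    weak_schatten_norm q K powr q
      \<le> (q / (q - 2)) powr (q / 2) * ((q + 2) / (q - 2)) powr ((q - 2) / 2)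
         * (2 * pi) powr (- real DIM('a)) * Lp_norm q f powr q * weak_Lp_norm q g powr q"
proof -
  define w where "w = enn2real (weak_Lp_sup q g)"
  define I where "I = (LINT x|lebesgue. norm (f x) powr q)"
  define c where "c = (q / (q - 2)) powr (q / 2) * ((q + 2) / (q - 2)) powr ((q - 2) / 2)
     * (2 * pi) powr (- real DIM('a))"
  have w0: "0 \<le> w" by (simp add: w_def)
  have sup: "weak_Lp_sup q g = ennreal w"
    using assms(3) by (simp add: w_def weak_Lp_def less_top)
  have main: "\<exists>K. is_operator_closure (position_momentum_op f g) K \<and> compact_operator K \<and>
      weak_schatten_sup q K \<le> ennreal (c * W * I)" if W: "0 < W" "w \<le> W" for W
  proof -
    interpret weak_Lp_weight g q W
    proof
      show "ennreal (\<tau> powr q) * emeasure lebesgue {x. \<tau> < norm (g x)} \<le> ennreal W" if "0 < \<tau>" for \<tau>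
      proof -
        have "ennreal (\<tau> powr q) * emeasure lebesgue {x. \<tau> < norm (g x)} \<le> weak_Lp_sup q g"
          unfolding weak_Lp_sup_def by (rule SUP_upper) (use that in simp)
        also have "\<dots> \<le> ennreal W" unfolding sup by (rule ennreal_leI[OF W(2)])
        finally show ?thesis .
      qed
    qed (use assms W in \<open>auto simp: weak_Lp_def\<close>)
    show ?thesis using Cwikel_estimate[OF assms(2)] by (simp add: c_def I_def)
  qed
  obtain K where K: "is_operator_closure (position_momentum_op f g) K" "compact_operator K"
    and fin: "weak_schatten_sup q K \<le> ennreal (c * (w + 1) * I)"
    using main[of "w + 1"] w0 by auto
  \<comment> \<open>\<open>main\<close> produces an operator for each \<open>W\<close> separately;
    uniqueness of the closure makes one \<open>K\<close> satisfy all these bounds.\<close>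
  have le: "weak_schatten_sup q K \<le> ennreal (c * W * I)" if "0 < W" "w \<le> W" for W
    using main[OF that] is_operator_closure_unique[OF K(1)] by blast
  have I0: "0 \<le> I" by (simp add: I_def)
  have c0: "0 \<le> c" by (simp add: c_def)
  have "enn2real (weak_schatten_sup q K) \<le> c * w * I"
  proof (rule field_le_epsilon)
    fix e :: real assume e: "0 < e"
    \<comment> \<open>Replacing \<open>w\<close> by \<open>w + \<delta>\<close> then costs at most
      \<open>e\<close>; the added 1 covers the case \<open>c * I = 0\<close>.\<close>
    define \<delta> where "\<delta> = e / (c * I + 1)"
    have cI: "0 \<le> c * I" using c0 I0 by simp
    then have \<delta>: "0 < \<delta>" using e by (simp add: \<delta>_def)
    have "enn2real (weak_schatten_sup q K) \<le> c * (w + \<delta>) * I"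
      using le[of "w + \<delta>"] w0 \<delta> c0 I0 by (intro enn2real_leI) auto
    also have "\<dots> = c * w * I + \<delta> * (c * I)" by (simp add: algebra_simps)
    also have "\<delta> * (c * I) \<le> \<delta> * (c * I + 1)" using \<delta> by (intro mult_left_mono) auto
    also have "\<dots> = e" using cI by (simp add: \<delta>_def)
    finally show "enn2real (weak_schatten_sup q K) \<le> c * w * I + e" by simp
  qed
  moreover have "weak_schatten_norm q K powr q = enn2real (weak_schatten_sup q K)"
    using assms(1) by (simp add: weak_schatten_norm_def powr_powr)
  moreover have "Lp_norm q f powr q = I" "weak_Lp_norm q g powr q = w"
    using assms(1) I0 w0 by (simp_all add: Lp_norm_def weak_Lp_norm_def powr_powr I_def w_def)
  ultimately have "weak_schatten_norm q K powr q \<le> c * Lp_norm q f powr q * weak_Lp_norm q g powr q"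
    by (simp add: mult_ac)
  moreover have "K \<in> weak_schatten q"
    using K(2) fin by (auto simp: weak_schatten_def intro: le_less_trans)
  ultimately show ?thesis using K(1) unfolding c_def by blast
qed

end
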